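(* Let $D$ be a positive integer and let $(X,\mathbb{Z}^k,T)$ be a dynamical system (compact metric space with continuous $\mathbb{Z}^k$-action) that has an aperiodic symbolic factor. If $\mathrm{mdim}(X)<D/2$, then there exists an equivariant topological embedding of $X$ into the $\mathbb{Z}^k$-shift $([0,1]^D)^{\mathbb{Z}^k}$.
   Context: An aperiodic symbolic system is a closed shift-invariant subset of $\{1,2,\dots,l\}^{\mathbb{Z}^k}$ (for some $l$) on which the shift action of $\mathbb{Z}^k$ is free; a factor of $X$ is a $\mathbb{Z}^k$-system $Z$ with an equivariant continuous surjection $X\to Z$. The $\mathbb{Z}^k$-shift on $K^{\mathbb{Z}^k}$ is $(a,(x_n))\mapsto(x_{n+a})$. Mean dimension: with $[N]=\{0,\dots,N-1\}^k$, $d_\Omega(x,y)=\sup_{n\in\Omega}d(T^nx,T^ny)$, a continuous $f:(X,d)\to Y$ is an $\varepsilon$-embedding if $\mathrm{diam}\,f^{-1}(y)<\varepsilon$ for all $y$, $\mathrm{widim}_\varepsilon(X,d)$ is the minimal dimension of a finite simplicial complex admitting an $\varepsilon$-embedding, and $\mathrm{mdim}(X)=\lim_{\varepsilon\to0}\lim_{N\to\infty}N^{-k}\mathrm{widim}_\varepsilon(X,d_{[N]})$. *)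

theory Defs
  imports "HOL-Analysis.Analysis" "HOL-Library.Extended_Real"
begin

text \<open>The group Z^k is represented by functions 'k \<Rightarrow> int for a finite type 'k
  (k = CARD('k)).  Addition is pointwise.\<close>

definition zadd :: "('k \<Rightarrow> int) \<Rightarrow> ('k \<Rightarrow> int) \<Rightarrow> ('k \<Rightarrow> int)" where
  "zadd m n = (\<lambda>i. m i + n i)"

definition zk_system :: "'a::metric_space set \<Rightarrow> (('k::finite \<Rightarrow> int) \<Rightarrow> 'a \<Rightarrow> 'a) \<Rightarrow> bool" where
  "zk_system X T \<longleftrightarrow> compact X
     \<and> (\<forall>a. continuous_on X (T a) \<and> T a ` X \<subseteq> X)
     \<and> (\<forall>x\<in>X. T (\<lambda>i. 0) x = x)
     \<and> (\<forall>a b. \<forall>x\<in>X. T (zadd a b) x = T a (T b x))"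

definition zshift :: "('k \<Rightarrow> int) \<Rightarrow> (('k \<Rightarrow> int) \<Rightarrow> 'b) \<Rightarrow> (('k \<Rightarrow> int) \<Rightarrow> 'b)" where
  "zshift a x = (\<lambda>n. x (zadd n a))"

definition aperiodic_symbolic :: "nat \<Rightarrow> (('k::finite \<Rightarrow> int) \<Rightarrow> nat) set \<Rightarrow> bool" where
  "aperiodic_symbolic l Y \<longleftrightarrow>
     Y \<subseteq> {y. \<forall>n. y n \<in> {1..l}} \<and> closed Y
     \<and> (\<forall>a. \<forall>y\<in>Y. zshift a y \<in> Y)
     \<and> (\<forall>a. \<forall>y\<in>Y. zshift a y = y \<longrightarrow> a = (\<lambda>i. 0))"

definition has_aperiodic_symbolic_factor ::
  "'a::metric_space set \<Rightarrow> (('k::finite \<Rightarrow> int) \<Rightarrow> 'a \<Rightarrow> 'a) \<Rightarrow> bool" where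
  "has_aperiodic_symbolic_factor X T \<longleftrightarrow>
     (\<exists>(l::nat). \<exists>Y :: (('k \<Rightarrow> int) \<Rightarrow> nat) set. \<exists>\<pi>.
        aperiodic_symbolic l Y \<and> continuous_on X \<pi> \<and> \<pi> ` X = Y
        \<and> (\<forall>a. \<forall>x\<in>X. \<pi> (T a x) = zshift a (\<pi> x)))"

definition zbox :: "nat \<Rightarrow> ('k::finite \<Rightarrow> int) set" where
  "zbox N = {n. \<forall>i. 0 \<le> n i \<and> n i < int N}"

definition dyn_dist :: "(('k \<Rightarrow> int) \<Rightarrow> 'a \<Rightarrow> 'a::metric_space) \<Rightarrow> ('k \<Rightarrow> int) set \<Rightarrow> 'a \<Rightarrow> 'a \<Rightarrow> real" where
  "dyn_dist T \<Omega> x y = (SUP n\<in>\<Omega>. dist (T n x) (T n y))"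

definition dyn_diam :: "(('k \<Rightarrow> int) \<Rightarrow> 'a \<Rightarrow> 'a::metric_space) \<Rightarrow> ('k \<Rightarrow> int) set \<Rightarrow> 'a set \<Rightarrow> real" where
  "dyn_diam T \<Omega> S = (if S = {} then 0 else SUP (x, y)\<in>S \<times> S. dyn_dist T \<Omega> x y)"

text \<open>Finite (abstract) simplicial complexes with vertices in nat, their dimension,
  and their geometric realisation in barycentric coordinates (as a subspace of
  nat \<Rightarrow> real with the product topology).\<close>
definition simplicial_cx :: "nat set set \<Rightarrow> bool" where
  "simplicial_cx K \<longleftrightarrow> finite K \<and> (\<forall>\<sigma>\<in>K. finite \<sigma> \<and> \<sigma> \<noteq> {})
     \<and> (\<forall>\<sigma>\<in>K. \<forall>\<tau>. \<tau> \<subseteq> \<sigma> \<and> \<tau> \<noteq> {} \<longrightarrow> \<tau> \<in> K)"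

definition cx_dim :: "nat set set \<Rightarrow> int" where
  "cx_dim K = Max (insert (-1) ((\<lambda>\<sigma>. int (card \<sigma>) - 1) ` K))"

definition cx_realization :: "nat set set \<Rightarrow> (nat \<Rightarrow> real) set" where
  "cx_realization K = {p. \<exists>\<sigma>\<in>K. (\<forall>v. 0 \<le> p v) \<and> (\<forall>v. v \<notin> \<sigma> \<longrightarrow> p v = 0) \<and> sum p \<sigma> = 1}"

definition eps_embedding ::
  "'a::metric_space set \<Rightarrow> (('k \<Rightarrow> int) \<Rightarrow> 'a \<Rightarrow> 'a) \<Rightarrow> ('k \<Rightarrow> int) set \<Rightarrow> real
     \<Rightarrow> nat set set \<Rightarrow> ('a \<Rightarrow> nat \<Rightarrow> real) \<Rightarrow> bool" where
  "eps_embedding X T \<Omega> \<epsilon> K f \<longleftrightarrow>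
     simplicial_cx K \<and> continuous_on X f \<and> f ` X \<subseteq> cx_realization K
     \<and> (\<forall>p. dyn_diam T \<Omega> {x\<in>X. f x = p} < \<epsilon>)"

definition widim ::
  "'a::metric_space set \<Rightarrow> (('k \<Rightarrow> int) \<Rightarrow> 'a \<Rightarrow> 'a) \<Rightarrow> ('k \<Rightarrow> int) set \<Rightarrow> real \<Rightarrow> int" where
  "widim X T \<Omega> \<epsilon> = (LEAST n. \<exists>K f. eps_embedding X T \<Omega> \<epsilon> K f \<and> cx_dim K = n)"

definition mdim :: "'a::metric_space set \<Rightarrow> (('k::finite \<Rightarrow> int) \<Rightarrow> 'a \<Rightarrow> 'a) \<Rightarrow> ereal" where
  "mdim X T = Lim (at_right 0)
     (\<lambda>\<epsilon>. ereal (lim (\<lambda>N. real_of_int (widim X T (zbox N) \<epsilon>) / real N ^ CARD('k))))"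

definition equivariant_cube_embedding ::
  "'a::metric_space set \<Rightarrow> (('k::finite \<Rightarrow> int) \<Rightarrow> 'a \<Rightarrow> 'a)
     \<Rightarrow> ('a \<Rightarrow> ('k \<Rightarrow> int) \<Rightarrow> real ^ 'd::finite) \<Rightarrow> bool" where
  "equivariant_cube_embedding X T f \<longleftrightarrow>
     f ` X \<subseteq> {z. \<forall>n i. z n $ i \<in> {0..1}}
     \<and> (\<exists>g. homeomorphism X (f ` X) f g)
     \<and> (\<forall>a. \<forall>x\<in>X. f (T a x) = zshift a (f x))"

end

theory Submission
  imports Defs
begin

text \<open>An observable \<open>g : X \<rightarrow> \<real>\<^sup>D\<close> is sought whose orbit map is injective on the fibres of the
  symbolic factor \<open>\<pi>\<close>; the symbols themselves are stored in disjoint subintervals of \<open>[0,1]\<close>.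
  Being injective up to \<open>\<epsilon>\<close> is stable under small perturbations, so it suffices to show that such
  observables are dense. Aperiodicity yields clopen marker sets, hence Voronoi tiles of \<open>\<int>\<^sup>k\<close> that
  depend on \<open>\<pi> x\<close> only. The tiles are so round that they are covered by about
  \<open>|\<Omega>| / M\<^sup>k\<close> boxes \<open>[M]\<close>, so subadditivity of widim and \<open>mdim < D/2\<close> give
  \<open>2 widim + 1 \<le> D |\<Omega>|\<close>, and a general position argument writes the orbit segment along a tile
  \<open>\<Omega>\<close> into the \<open>D |\<Omega>|\<close> coordinates available there.

  Maps to complexes of dimension \<open>n\<close> are replaced by families of \<open>[0,1]\<close>-valued functions that
  at each point take at most \<open>n\<close> distinct values in \<open>(0,1)\<close>. In this form products of
  complexes become concatenations and fine subdivisions become an explicit formula.\<close>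

section \<open>Cut families\<close>

text \<open>Data read off from the symbolic factor is locally constant, so codes of different tiles
  can be switched without interpolation. The delicate point is the boundary of a tile: a site
  equidistant from two markers has no canonical owner. Each tile therefore comes in two versions.
  Open tiles contain the sites strictly closest to their marker; they are disjoint, so they can be
  written to independently. Closed tiles also contain the ties; they cover the lattice, so
  controlling orbits on all of them controls every point. A code written on the open tile resolves
  the orbit on the closed one, and at tied sites the observable keeps its old value, so no
  tie-breaking rule is needed. The demand for coordinates is counted on the closed tile, the supply
  on the open one; the strictness of \<open>mdim < D/2\<close> pays for the difference.

  Cut families come from ordering the vertices of a complex: the partial sums of the barycentric
  coordinates determine the point, and those strictly between 0 and 1 take at most as many values as
  the dimension.\<close>

definition cuts :: "'a::topological_space set \<Rightarrow> nat \<Rightarrow> nat \<Rightarrow> (nat \<Rightarrow> 'a \<Rightarrow> real) \<Rightarrow> bool" where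
  "cuts X B n c \<longleftrightarrow> (\<forall>j<B. continuous_on X (c j)) \<and> (\<forall>j<B. \<forall>x\<in>X. c j x \<in> {0..1})
     \<and> (\<forall>x\<in>X. card ((\<lambda>j. c j x) ` {..<B} \<inter> {0<..<1}) \<le> n)"

text \<open>The weight of \<open>S\<close> is the length of the set of thresholds \<open>\<theta> \<in> [0,1)\<close> for which
  \<open>S\<close> is exactly the set of indices of cut points \<open>\<le> \<theta>\<close>.\<close>

definition slab :: "nat \<Rightarrow> (nat \<Rightarrow> real) \<Rightarrow> nat set \<Rightarrow> real" where
  "slab B t S = max 0 (Min (insert 1 (t ` ({..<B} - S))) - Max (insert 0 (t ` S)))"

text \<open>The condition on \<open>\<theta>\<close> splits into lower bounds
  \<open>t j \<le> \<theta>\<close> inside \<open>S\<close> and upper bounds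
  \<open>\<theta> < t j\<close> outside. The inserted 0 and 1 express
  \<open>\<theta> \<in> {0..<1}\<close> and keep \<open>Max\<close> and \<open>Min\<close> away from
  the empty set.\<close>

lemma thresholds_eq:
  fixes B :: nat
  assumes "S \<subseteq> {..<B}"
  shows "{\<theta>\<in>{0..<1}. {j\<in>{..<B}. t j \<le> \<theta>} = S}
    = {Max (insert 0 (t ` S))..<Min (insert (1::real) (t ` ({..<B} - S)))}"
proof -
  have fin: "finite S" using assms finite_subset by blast
  have eq: "{j\<in>{..<B}. t j \<le> \<theta>} = S \<longleftrightarrow> (\<forall>j\<in>S. t j \<le> \<theta>) \<and> (\<forall>j\<in>{..<B} - S. \<theta> < t j)"
    (is "?l \<theta> \<longleftrightarrow> ?r \<theta>") for \<theta>
  proof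
    show "?r \<theta>" if "?l \<theta>" unfolding that[symmetric] by auto
    show "?l \<theta>" if r: "?r \<theta>"
    proof (intro set_eqI iffI)
      fix j assume j: "j \<in> {j\<in>{..<B}. t j \<le> \<theta>}"
      show "j \<in> S"
      proof (rule ccontr)
        assume "j \<notin> S"
        with j have "j \<in> {..<B} - S" by simp
        with r have "\<theta> < t j" by blast
        with j show False by simp
      qed
    next
      fix j assume "j \<in> S"
      then show "j \<in> {j\<in>{..<B}. t j \<le> \<theta>}" using r assms by auto
    qed
  qed
  have Mx: "Max (insert 0 (t ` S)) \<le> \<theta> \<longleftrightarrow> 0 \<le> \<theta> \<and> (\<forall>j\<in>S. t j \<le> \<theta>)" for \<theta>
    using fin by (subst Max_le_iff) auto
  have Mn: "\<theta> < Min (insert 1 (t ` ({..<B} - S))) \<longleftrightarrow> \<theta> < 1 \<and> (\<forall>j\<in>{..<B} - S. \<theta> < t j)" for \<theta>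
    by (subst Min_gr_iff) auto
  show ?thesis
  proof (rule set_eqI)
    show "\<theta> \<in> {\<theta>\<in>{0..<1}. ?l \<theta>} \<longleftrightarrow> \<theta> \<in> {Max (insert 0 (t ` S))..<Min (insert 1 (t ` ({..<B} - S)))}" for \<theta>
      unfolding mem_Collect_eq eq atLeastLessThan_iff Mx Mn by blast
  qed
qed

lemma lborel_Ico:
  fixes a b :: real
  shows "emeasure lborel {a..<b} = ennreal (max 0 (b - a))" "measure lborel {a..<b} = max 0 (b - a)"
  by (cases "a \<le> b"; simp)+

lemma measure_thresholds:
  fixes B :: nat
  assumes "S \<subseteq> {..<B}"
  shows "measure lborel {\<theta>\<in>{0..<1}. {j\<in>{..<B}. t j \<le> \<theta>} = S} = slab B t S"
  unfolding thresholds_eq[OF assms] slab_def lborel_Ico ..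

lemma slab_nonneg: "slab B t S \<ge> 0"
  by (simp add: slab_def)

lemma sum_slab_eq_measure:
  assumes "F \<subseteq> Pow {..<B}"
  shows "(\<Sum>S\<in>F. slab B t S) = measure lborel {\<theta>\<in>{0..<1}. {j\<in>{..<B}. t j \<le> \<theta>} \<in> F}"
proof -
  let ?A = "\<lambda>S. {\<theta>\<in>{0..<1}. {j\<in>{..<B}. t j \<le> \<theta>} = S}"
  have "finite F" by (rule finite_subset[OF assms]) auto
  have A: "?A S = {Max (insert 0 (t ` S))..<Min (insert (1::real) (t ` ({..<B} - S)))}" if "S \<in> F" for S
    using thresholds_eq[of S B t] that assms by blast
  have "measure lborel (\<Union>S\<in>F. ?A S) = (\<Sum>S\<in>F. measure lborel (?A S))"
  proof (rule measure_finite_Union)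
    show "?A ` F \<subseteq> sets lborel" using A by auto
    show "emeasure lborel (?A S) \<noteq> \<infinity>" if "S \<in> F" for S
      unfolding A[OF that] by (simp add: lborel_Ico(1) del: Max_insert Min_insert)
  qed (auto simp: \<open>finite F\<close> disjoint_family_on_def)
  also have "\<dots> = (\<Sum>S\<in>F. slab B t S)"
    using assms by (intro sum.cong refl measure_thresholds) auto
  also have "(\<Union>S\<in>F. ?A S) = {\<theta>\<in>{0..<1}. {j\<in>{..<B}. t j \<le> \<theta>} \<in> F}" by auto
  finally show ?thesis by simp
qed

lemma sum_slab: "(\<Sum>S\<in>Pow {..<B}. slab B t S) = 1"
proof -
  have "{\<theta>\<in>{0..<1::real}. {j\<in>{..<B}. t j \<le> \<theta>} \<in> Pow {..<B}} = {0..<1}" by auto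
  then show ?thesis by (simp add: sum_slab_eq_measure del: Pow_iff)
qed

text \<open>Shows that passing from cut points to weights loses nothing: a threshold has
  \<open>j\<close> outside its index set iff it lies below \<open>t j\<close>.\<close>

lemma slab_marginal:
  assumes "j < B" "t j \<in> {0..1}"
  shows "(\<Sum>S | S \<subseteq> {..<B} \<and> j \<notin> S. slab B t S) = t j"
proof -
  have "{\<theta>\<in>{0..<1::real}. {i\<in>{..<B}. t i \<le> \<theta>} \<in> {S. S \<subseteq> {..<B} \<and> j \<notin> S}} = {0..<t j}"
    using assms by auto
  moreover have "{S. S \<subseteq> {..<B} \<and> j \<notin> S} \<subseteq> Pow {..<B}" by auto
  ultimately show ?thesis using assms by (simp add: sum_slab_eq_measure)
qed

lemma slab_posD:
  assumes "slab B t S > 0" "S \<subseteq> {..<B}"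
  obtains \<theta> where "\<theta> \<in> insert 0 (t ` S)" "0 \<le> \<theta>" "\<theta> < 1" "S = {j\<in>{..<B}. t j \<le> \<theta>}"
proof -
  let ?\<theta> = "Max (insert 0 (t ` S))"
  have fin: "finite S" using assms finite_subset by blast
  have "?\<theta> \<in> {?\<theta>..<Min (insert 1 (t ` ({..<B} - S)))}"
    using assms(1) unfolding slab_def atLeastLessThan_iff by linarith
  then have "?\<theta> \<in> {\<theta>\<in>{0..<1}. {j\<in>{..<B}. t j \<le> \<theta>} = S}"
    unfolding thresholds_eq[OF assms(2), symmetric] .
  moreover have "?\<theta> \<in> insert 0 (t ` S)" using fin by (intro Max_in) auto
  ultimately show ?thesis using that[of ?\<theta>] by auto
qed

text \<open>A set of positive weight is determined by the left end of its interval of thresholds,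
  which is 0 or a cut value in (0,1). Thus \<open>n\<close> cut values give the \<open>n + 1\<close>
  vertices of an \<open>n\<close>-simplex.\<close>

lemma card_slab_support:
  assumes "card (t ` {..<B} \<inter> {0<..<1}) \<le> n"
  shows "card {S\<in>Pow {..<B}. slab B t S > 0} \<le> n + 1"
proof -
  let ?V = "insert 0 (t ` {..<B} \<inter> {0<..<1})"
  have "{S\<in>Pow {..<B}. slab B t S > 0} \<subseteq> (\<lambda>\<theta>. {j\<in>{..<B}. t j \<le> \<theta>}) ` ?V"
  proof
    fix S assume S: "S \<in> {S\<in>Pow {..<B}. slab B t S > 0}"
    then obtain \<theta> where "\<theta> \<in> insert 0 (t ` S)" "0 \<le> \<theta>" "\<theta> < 1" "S = {j\<in>{..<B}. t j \<le> \<theta>}"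
      using slab_posD by blast
    then show "S \<in> (\<lambda>\<theta>. {j\<in>{..<B}. t j \<le> \<theta>}) ` ?V" by fastforce
  qed
  then have "card {S\<in>Pow {..<B}. slab B t S > 0} \<le> card ((\<lambda>\<theta>. {j\<in>{..<B}. t j \<le> \<theta>}) ` ?V)"
    by (intro card_mono) auto
  also have "\<dots> \<le> card ?V" by (intro card_image_le) auto
  also have "\<dots> \<le> n + 1" using assms by (simp add: card_insert_if)
  finally show ?thesis .
qed

lemma continuous_on_Max_insert:
  fixes f :: "'i \<Rightarrow> 'a::topological_space \<Rightarrow> real"
  assumes "finite I" "\<And>i. i \<in> I \<Longrightarrow> continuous_on X (f i)"
  shows "continuous_on X (\<lambda>x. Max (insert a ((\<lambda>i. f i x) ` I)))"
  using assms
proof (induction I rule: finite_induct)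
  case (insert i I)
  have "Max (insert a ((\<lambda>i. f i x) ` insert i I)) = max (f i x) (Max (insert a ((\<lambda>i. f i x) ` I)))" for x
    using insert.hyps(1) by (simp add: insert_commute[of a])
  then show ?case using insert by (auto intro!: continuous_on_max)
qed auto

lemma continuous_on_Min_insert:
  fixes f :: "'i \<Rightarrow> 'a::topological_space \<Rightarrow> real"
  assumes "finite I" "\<And>i. i \<in> I \<Longrightarrow> continuous_on X (f i)"
  shows "continuous_on X (\<lambda>x. Min (insert a ((\<lambda>i. f i x) ` I)))"
  using assms
proof (induction I rule: finite_induct)
  case (insert i I)
  have "Min (insert a ((\<lambda>i. f i x) ` insert i I)) = min (f i x) (Min (insert a ((\<lambda>i. f i x) ` I)))" for x
    using insert.hyps(1) by (simp add: insert_commute[of a])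
  then show ?case using insert by (auto intro!: continuous_on_min)
qed auto

lemma continuous_on_slab:
  assumes "\<And>j. j < B \<Longrightarrow> continuous_on X (c j)" "S \<subseteq> {..<B}"
  shows "continuous_on X (\<lambda>x. slab B (\<lambda>j. c j x) S)"
proof -
  have "finite S" using assms finite_subset by blast
  then show ?thesis unfolding slab_def using assms
    by (intro continuous_on_max continuous_on_const continuous_on_diff
        continuous_on_Max_insert continuous_on_Min_insert) auto
qed

section \<open>Edgewise subdivision and products\<close>

definition clamp01 :: "real \<Rightarrow> real" where "clamp01 u = max 0 (min 1 u)"

text \<open>The vertices of the \<open>m\<close>-fold edgewise subdivision containing a point with cut points \<open>t\<close>
  are the values of \<open>\<lfloor>m t + \<theta>\<rfloor>\<close> for \<open>\<theta> \<in> [0,1)\<close>, and \<open>\<lfloor>m t + \<theta>\<rfloor> \<ge> i\<close> iff \<open>i - m t \<le> \<theta>\<close>.\<close>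

definition refine_cuts :: "nat \<Rightarrow> (nat \<Rightarrow> 'a \<Rightarrow> real) \<Rightarrow> nat \<Rightarrow> 'a \<Rightarrow> real" where
  "refine_cuts m c q x = clamp01 (real (q mod m) + 1 - real m * c (q div m) x)"

text \<open>The index \<open>q\<close> stands for the pair of \<open>j = q div m\<close> and a level
  \<open>q mod m\<close>. A refined value in (0,1) forces the level to be the floor of
  \<open>m t\<close> with \<open>t = c j x\<close>, so it is a function of \<open>t\<close> alone;
  moreover \<open>t\<close> itself then lies in (0,1). Hence subdivision creates no new distinct
  values.\<close>

lemma cuts_refine:
  assumes "cuts X B n c" "m > 0"
  shows "cuts X (B * m) n (refine_cuts m c)"
  unfolding cuts_def
proof (intro conjI allI impI ballI)
  fix q assume "q < B * m"
  then have "q div m < B" by (simp add: less_mult_imp_div_less)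
  then show "continuous_on X (refine_cuts m c q)"
    using assms unfolding refine_cuts_def clamp01_def cuts_def
    by (auto intro!: continuous_intros)
next
  fix q x show "refine_cuts m c q x \<in> {0..1}" by (auto simp: refine_cuts_def clamp01_def)
next
  fix x assume x: "x \<in> X"
  let ?h = "\<lambda>t. of_int \<lfloor>real m * t\<rfloor> + 1 - real m * t"
  let ?V = "(\<lambda>j. c j x) ` {..<B} \<inter> {0<..<1}"
  have "(\<lambda>q. refine_cuts m c q x) ` {..<B * m} \<inter> {0<..<1} \<subseteq> ?h ` ?V"
  proof
    fix v assume "v \<in> (\<lambda>q. refine_cuts m c q x) ` {..<B * m} \<inter> {0<..<1}"
    then obtain q where q: "q < B * m" and v: "v = refine_cuts m c q x" "0 < v" "v < 1" by auto
    let ?t = "c (q div m) x"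
    have qB: "q div m < B" using q by (simp add: less_mult_imp_div_less)
    then have t: "0 \<le> ?t" "?t \<le> 1" using assms x by (auto simp: cuts_def)
    have v': "v = real (q mod m) + 1 - real m * ?t"
      using v by (auto simp: refine_cuts_def clamp01_def max_def min_def split: if_splits)
    have "\<lfloor>real m * ?t\<rfloor> = int (q mod m)"
      using v(2,3) unfolding v' by (intro floor_unique) auto
    then have "v = ?h ?t" using v' by simp
    moreover have "?t \<noteq> 0"
      using v(3) unfolding v' by auto
    moreover have "?t \<noteq> 1"
    proof
      assume "?t = 1"
      then have "real m < real (q mod m) + 1" using v(2) v' by simp
      then have "m < q mod m + 1" by linarith
      moreover have "q mod m < m" using assms(2) by simp
      ultimately show False by linarith
    qed
    ultimately show "v \<in> ?h ` ?V" using t qB by auto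
  qed
  then have "card ((\<lambda>q. refine_cuts m c q x) ` {..<B * m} \<inter> {0<..<1}) \<le> card (?h ` ?V)"
    by (intro card_mono) auto
  also have "\<dots> \<le> card ?V" by (intro card_image_le) auto
  also have "\<dots> \<le> n" using assms x by (auto simp: cuts_def)
  finally show "card ((\<lambda>q. refine_cuts m c q x) ` {..<B * m} \<inter> {0<..<1}) \<le> n" .
qed

lemma clamp01_le_iff: "0 \<le> \<theta> \<Longrightarrow> \<theta> < 1 \<Longrightarrow> clamp01 u \<le> \<theta> \<longleftrightarrow> u \<le> \<theta>"
  by (auto simp: clamp01_def)

text \<open>The vertex \<open>S\<close> fixes the floor of \<open>m c j + \<theta>\<close> for some
  \<open>\<theta>\<close> in [0,1) depending on the point, so at two points of its star the numbers
  \<open>m c j\<close> differ by less than 2. The opposite bound follows by exchanging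
  \<open>x\<close> and \<open>y\<close>.\<close>

lemma refine_cuts_star_aux:
  assumes "c j x \<in> {0..1}" "c j y \<in> {0..1}" "j < B" "m > 0"
    and "slab (B * m) (\<lambda>q. refine_cuts m c q x) S > 0"
    and "slab (B * m) (\<lambda>q. refine_cuts m c q y) S > 0" and S: "S \<subseteq> {..<B * m}"
  shows "real m * c j y < real m * c j x + 2"
proof (rule ccontr)
  assume neg: "\<not> ?thesis"
  obtain \<theta> where \<theta>: "0 \<le> \<theta>" "\<theta> < 1" "S = {q\<in>{..<B * m}. refine_cuts m c q x \<le> \<theta>}"
    using slab_posD[OF assms(5) S] by metis
  obtain \<theta>' where \<theta>': "0 \<le> \<theta>'" "\<theta>' < 1" "S = {q\<in>{..<B * m}. refine_cuts m c q y \<le> \<theta>'}"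
    using slab_posD[OF assms(6) S] by metis
  define i where "i = nat \<lfloor>real m * c j x + \<theta>\<rfloor>"
  have nn: "0 \<le> real m * c j x" using assms(1) by simp
  have i: "real i \<le> real m * c j x + \<theta>" "real m * c j x + \<theta> < real i + 1"
    using nn \<theta>(1) unfolding i_def by linarith+
  have "real m * c j y \<le> real m" using assms(2,4) by simp
  \<comment> \<open>If \<open>i\<close> were at least \<open>m\<close>, the supposed gap of 2 would
    push \<open>m c j y\<close> beyond \<open>m\<close>.\<close>
  then have im: "i < m" using i neg \<theta> by linarith
  let ?q = "j * m + i"
  have q: "?q < B * m" "?q mod m = i" "?q div m = j"
  proof -
    have "?q < Suc j * m" using im by simp
    also have "\<dots> \<le> B * m" using assms(3) by (intro mult_right_mono) auto
    finally show "?q < B * m" .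
  qed (use im in auto)
  \<comment> \<open>The index \<open>?q\<close> tests whether the \<open>j\<close>-th coordinate of
    the vertex is at least \<open>i + 1\<close>: read at \<open>x\<close> it is not, read at
    \<open>y\<close> it is.\<close>
  have "?q \<notin> S" unfolding \<theta>(3)
    using i q by (simp add: refine_cuts_def clamp01_le_iff[OF \<theta>(1,2)])
  moreover have "?q \<in> S" unfolding \<theta>'(3)
    using i q neg \<theta>(1,2) \<theta>'(1,2) by (simp add: refine_cuts_def clamp01_le_iff)
  ultimately show False by simp
qed

lemma cuts_append:
  assumes "cuts X B n c" "cuts X B' n' c'"
  shows "cuts X (B + B') (n + n') (\<lambda>j. if j < B then c j else c' (j - B))"
  unfolding cuts_def
proof (intro conjI allI impI ballI)
  fix x assume x: "x \<in> X"
  let ?V = "(\<lambda>j. c j x) ` {..<B} \<inter> {0<..<1}" and ?V' = "(\<lambda>j. c' j x) ` {..<B'} \<inter> {0<..<1}"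
  have "(\<lambda>j. (if j < B then c j else c' (j - B)) x) ` {..<B + B'} \<inter> {0<..<1} \<subseteq> ?V \<union> ?V'"
    by auto
  then have "card ((\<lambda>j. (if j < B then c j else c' (j - B)) x) ` {..<B + B'} \<inter> {0<..<1}) \<le> card (?V \<union> ?V')"
    by (intro card_mono) auto
  also have "\<dots> \<le> card ?V + card ?V'" by (rule card_Un_le)
  also have "\<dots> \<le> n + n'" using assms x by (intro add_mono) (auto simp: cuts_def)
  finally show "card ((\<lambda>j. (if j < B then c j else c' (j - B)) x) ` {..<B + B'} \<inter> {0<..<1}) \<le> n + n'" .
qed (use assms in \<open>auto simp: cuts_def\<close>)

lemma cuts_mono: "cuts X B n c \<Longrightarrow> n \<le> n' \<Longrightarrow> cuts X B n' c"
  unfolding cuts_def using le_trans by blast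

section \<open>Widim in terms of cut families\<close>

definition resolves ::
  "'a::metric_space set \<Rightarrow> (('k \<Rightarrow> int) \<Rightarrow> 'a \<Rightarrow> 'a) \<Rightarrow> ('k \<Rightarrow> int) set \<Rightarrow> real \<Rightarrow> nat \<Rightarrow> (nat \<Rightarrow> 'a \<Rightarrow> real) \<Rightarrow> bool"
  where "resolves X T \<Omega> \<epsilon> B c \<longleftrightarrow>
    (\<forall>x\<in>X. \<forall>y\<in>X. (\<forall>j<B. c j x = c j y) \<longrightarrow> (\<forall>n\<in>\<Omega>. dist (T n x) (T n y) < \<epsilon>))"

definition cut_dim_le ::
  "'a::metric_space set \<Rightarrow> (('k \<Rightarrow> int) \<Rightarrow> 'a \<Rightarrow> 'a) \<Rightarrow> ('k \<Rightarrow> int) set \<Rightarrow> real \<Rightarrow> nat \<Rightarrow> bool"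
  where "cut_dim_le X T \<Omega> \<epsilon> n \<longleftrightarrow> (\<exists>B c. cuts X B n c \<and> resolves X T \<Omega> \<epsilon> B c)"

locale nonempty_zk_system =
  fixes X :: "'a::metric_space set" and T :: "('k::finite \<Rightarrow> int) \<Rightarrow> 'a \<Rightarrow> 'a"
  assumes sys: "zk_system X T" and nonempty: "X \<noteq> {}"
begin

lemma compact_X: "compact X"
  and continuous_on_T: "continuous_on X (T a)"
  and T_in: "x \<in> X \<Longrightarrow> T a x \<in> X"
  and T_0: "x \<in> X \<Longrightarrow> T (\<lambda>i. 0) x = x"
  and T_zadd: "x \<in> X \<Longrightarrow> T (zadd a b) x = T a (T b x)"
  using sys unfolding zk_system_def by blast+

lemma dyn_dist_le_diameter:
  assumes "x \<in> X" "y \<in> X" "\<Omega> \<noteq> {}"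
  shows "dyn_dist T \<Omega> x y \<le> diameter X"
  unfolding dyn_dist_def
  by (intro cSUP_least diameter_bounded_bound compact_imp_bounded compact_X T_in assms)

lemma dist_le_dyn_dist:
  assumes "x \<in> X" "y \<in> X" "n \<in> \<Omega>"
  shows "dist (T n x) (T n y) \<le> dyn_dist T \<Omega> x y"
  unfolding dyn_dist_def
proof (rule cSUP_upper[OF assms(3)])
  show "bdd_above ((\<lambda>n. dist (T n x) (T n y)) ` \<Omega>)"
    by (rule bdd_aboveI2[of _ _ "diameter X"])
      (intro diameter_bounded_bound compact_imp_bounded compact_X T_in assms)
qed

lemma dist_le_dyn_diam:
  assumes "S \<subseteq> X" "x \<in> S" "y \<in> S" "n \<in> \<Omega>"
  shows "dist (T n x) (T n y) \<le> dyn_diam T \<Omega> S"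
proof -
  have "dist (T n x) (T n y) \<le> dyn_dist T \<Omega> x y" using assms by (intro dist_le_dyn_dist) auto
  also have "\<dots> \<le> (SUP p\<in>S \<times> S. dyn_dist T \<Omega> (fst p) (snd p))"
  proof (rule order_trans[OF _ cSUP_upper])
    show "(x, y) \<in> S \<times> S" using assms by simp
    show "bdd_above ((\<lambda>p. dyn_dist T \<Omega> (fst p) (snd p)) ` (S \<times> S))"
      using assms by (intro bdd_aboveI2[of _ _ "diameter X"] dyn_dist_le_diameter) auto
  qed simp
  finally show ?thesis using assms unfolding dyn_diam_def by (auto simp: case_prod_unfold)
qed

text \<open>A supremum of numbers below \<open>\<epsilon>\<close> may equal
  \<open>\<epsilon>\<close>; compactness of \<open>S \<times> S\<close> and finiteness of
  \<open>\<Omega>\<close> make it a maximum.\<close>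

lemma dyn_diam_less:
  assumes S: "compact S" "S \<subseteq> X" and \<Omega>: "finite \<Omega>" "\<Omega> \<noteq> {}" and "\<epsilon> > 0"
    and less: "\<And>x y n. x \<in> S \<Longrightarrow> y \<in> S \<Longrightarrow> n \<in> \<Omega> \<Longrightarrow> dist (T n x) (T n y) < \<epsilon>"
  shows "dyn_diam T \<Omega> S < \<epsilon>"
proof (cases "S = {}")
  case False
  have "\<exists>e<\<epsilon>. \<forall>x\<in>S. \<forall>y\<in>S. dist (T n x) (T n y) \<le> e" if "n \<in> \<Omega>" for n
  proof -
    have cT: "continuous_on S (T n)" using continuous_on_T S continuous_on_subset by blast
    have "\<exists>p\<in>S \<times> S. \<forall>q\<in>S \<times> S. dist (T n (fst q)) (T n (snd q)) \<le> dist (T n (fst p)) (T n (snd p))"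
      using False S
      by (intro continuous_attains_sup compact_Times continuous_on_dist
          continuous_on_compose2[OF cT] continuous_on_fst continuous_on_snd continuous_on_id) auto
    then obtain p where "p \<in> S \<times> S"
        "\<forall>q\<in>S \<times> S. dist (T n (fst q)) (T n (snd q)) \<le> dist (T n (fst p)) (T n (snd p))" by blast
    then show ?thesis using less[of "fst p" "snd p" n] that
      by (intro exI[of _ "dist (T n (fst p)) (T n (snd p))"]) auto
  qed
  then obtain e where e: "\<And>n. n \<in> \<Omega> \<Longrightarrow> e n < \<epsilon>"
      "\<And>n x y. n \<in> \<Omega> \<Longrightarrow> x \<in> S \<Longrightarrow> y \<in> S \<Longrightarrow> dist (T n x) (T n y) \<le> e n"
    by metis
  have "dyn_dist T \<Omega> x y \<le> Max (e ` \<Omega>)" if "x \<in> S" "y \<in> S" for x y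
    unfolding dyn_dist_def
  proof (rule cSUP_least)
    fix n assume n: "n \<in> \<Omega>"
    have "dist (T n x) (T n y) \<le> e n" using e n that by blast
    also have "\<dots> \<le> Max (e ` \<Omega>)" using n \<Omega> by auto
    finally show "dist (T n x) (T n y) \<le> Max (e ` \<Omega>)" .
  qed (use \<Omega> in auto)
  then have "dyn_diam T \<Omega> S \<le> Max (e ` \<Omega>)"
    unfolding dyn_diam_def using False by (auto intro!: cSUP_least)
  also have "\<dots> < \<epsilon>" using e \<Omega> by auto
  finally show ?thesis .
qed (use \<open>\<epsilon> > 0\<close> in \<open>simp add: dyn_diam_def\<close>)

lemma card_le_cx_dim:
  assumes "finite K" "\<sigma> \<in> K"
  shows "int (card \<sigma>) - 1 \<le> cx_dim K"
  unfolding cx_dim_def using assms by (intro Max_ge) auto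

text \<open>The cut points are the partial sums of the barycentric coordinates.\<close>

lemma eps_embedding_imp_cut_dim_le:
  assumes emb: "eps_embedding X T \<Omega> \<epsilon> K f"
  shows "cut_dim_le X T \<Omega> \<epsilon> (nat (cx_dim K))"
proof -
  have K: "finite K" "\<And>\<sigma>. \<sigma> \<in> K \<Longrightarrow> finite \<sigma>"
    using emb unfolding eps_embedding_def simplicial_cx_def by auto
  have "finite (\<Union>K)" using K by blast
  then obtain B where "\<forall>u\<in>\<Union>K. u < B" unfolding finite_nat_set_iff_bounded ..
  then have B: "\<Union>K \<subseteq> {..<B}" by auto
  define c where "c j x = (\<Sum>u<j. f x u)" for j x
  have "continuous_on X f" using emb by (simp add: eps_embedding_def)
  then have contf: "continuous_on X (\<lambda>x. f x u)" for u
    by (rule continuous_on_product_then_coordinatewise)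
  have supp: "\<exists>\<sigma>\<in>K. (\<forall>v. 0 \<le> f x v) \<and> (\<forall>v. v \<notin> \<sigma> \<longrightarrow> f x v = 0) \<and> sum (f x) \<sigma> = 1" if "x \<in> X" for x
    using emb that unfolding eps_embedding_def cx_realization_def by blast
  \<comment> \<open>One function more than there are vertices: the coordinate at \<open>u\<close> is
    the difference of the partial sums at \<open>Suc u\<close> and \<open>u\<close>.\<close>
  have "cuts X (Suc B) (nat (cx_dim K)) c"
    unfolding cuts_def
  proof (intro conjI allI impI ballI)
    show "continuous_on X (c j)" for j
      unfolding c_def by (intro continuous_on_sum contf)
  next
    fix j x assume "x \<in> X"
    then obtain \<sigma> where \<sigma>: "\<sigma> \<in> K" "\<forall>v. 0 \<le> f x v" "\<forall>v. v \<notin> \<sigma> \<longrightarrow> f x v = 0" "sum (f x) \<sigma> = 1"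
      using supp by blast
    have "c j x = sum (f x) (\<sigma> \<inter> {..<j})"
      unfolding c_def using \<sigma> by (intro sum.mono_neutral_right) auto
    also have "\<dots> \<le> sum (f x) \<sigma>" using \<sigma> K by (intro sum_mono2) auto
    finally show "c j x \<in> {0..1}" using \<sigma> by (auto simp: c_def intro: sum_nonneg)
  next
    fix x assume "x \<in> X"
    then obtain \<sigma> where \<sigma>: "\<sigma> \<in> K" "\<And>v. 0 \<le> f x v" "\<And>v. v \<notin> \<sigma> \<Longrightarrow> f x v = 0" "sum (f x) \<sigma> = 1"
      using supp by blast
    define s where "s = {u\<in>\<sigma>. f x u \<noteq> 0}"
    have fs: "finite s" and s0: "\<And>v. v \<notin> s \<Longrightarrow> f x v = 0" using \<sigma> K unfolding s_def by auto
    have s1: "sum (f x) s = 1" using \<sigma> K unfolding s_def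
      by (subst sum.mono_neutral_left[of \<sigma>]) auto
    then have "s \<noteq> {}" by auto
    have cs: "c j x = sum (f x) (s \<inter> {..<j})" for j
      unfolding c_def using s0 by (intro sum.mono_neutral_right) auto
    \<comment> \<open>A partial sum changes only at vertices of the support \<open>s\<close>, and it
      reaches 1 at the last of them. This leaves at most \<open>card s - 1\<close> values strictly
      between 0 and 1.\<close>
    have "(\<lambda>j. c j x) ` {..<Suc B} \<inter> {0<..<1} \<subseteq> (\<lambda>u. sum (f x) (s \<inter> {..u})) ` (s - {Max s})"
    proof
      fix v assume "v \<in> (\<lambda>j. c j x) ` {..<Suc B} \<inter> {0<..<1}"
      then obtain j where j: "v = c j x" "0 < v" "v < 1" by auto
      have ne: "s \<inter> {..<j} \<noteq> {}" using j unfolding cs by auto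
      define u where "u = Max (s \<inter> {..<j})"
      have u: "u \<in> s \<inter> {..<j}" unfolding u_def using ne fs by (intro Max_in) auto
      have "s \<inter> {..<j} = s \<inter> {..u}"
        using u fs unfolding u_def by (auto intro!: Max_ge)
      then have v: "v = sum (f x) (s \<inter> {..u})" using j cs by simp
      have "u \<noteq> Max s"
      proof
        assume "u = Max s"
        then have "s \<inter> {..u} = s" using fs by auto
        then show False using v s1 j by simp
      qed
      then show "v \<in> (\<lambda>u. sum (f x) (s \<inter> {..u})) ` (s - {Max s})" using u v by auto
    qed
    then have "card ((\<lambda>j. c j x) ` {..<Suc B} \<inter> {0<..<1}) \<le> card ((\<lambda>u. sum (f x) (s \<inter> {..u})) ` (s - {Max s}))"
      using fs by (intro card_mono) auto
    also have "\<dots> \<le> card (s - {Max s})" using fs by (intro card_image_le) auto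
    also have "\<dots> = card s - 1" using fs \<open>s \<noteq> {}\<close> by (simp add: card_Diff_singleton)
    also have "\<dots> \<le> card \<sigma> - 1" using K \<sigma> unfolding s_def by (intro diff_le_mono card_mono) auto
    also have "\<dots> \<le> nat (cx_dim K)" using card_le_cx_dim[OF K(1) \<sigma>(1)] by linarith
    finally show "card ((\<lambda>j. c j x) ` {..<Suc B} \<inter> {0<..<1}) \<le> nat (cx_dim K)" .
  qed
  moreover have "resolves X T \<Omega> \<epsilon> (Suc B) c"
    unfolding resolves_def
  proof (intro ballI impI)
    fix x y n assume xy: "x \<in> X" "y \<in> X" "\<forall>j<Suc B. c j x = c j y" and n: "n \<in> \<Omega>"
    have f0: "f z u = 0" if "z \<in> X" "u \<ge> B" for z u
      using supp[OF that(1)] that(2) B by (meson UnionI lessThan_iff not_le subsetD)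
    have "f x u = f y u" for u
    proof (cases "u < B")
      case True
      have "f z u = c (Suc u) z - c u z" for z by (simp add: c_def)
      then show ?thesis using xy True by simp
    qed (use f0 xy in auto)
    then have "f x = f y" by blast
    then have "dist (T n x) (T n y) \<le> dyn_diam T \<Omega> {z\<in>X. f z = f y}"
      using xy n by (intro dist_le_dyn_diam) auto
    also have "\<dots> < \<epsilon>" using emb unfolding eps_embedding_def by blast
    finally show "dist (T n x) (T n y) < \<epsilon>" .
  qed
  ultimately show ?thesis unfolding cut_dim_le_def by blast
qed

text \<open>The weights \<open>slab\<close> serve as barycentric coordinates in the
  \<open>n\<close>-skeleton of the full simplex whose vertices are all subsets of
  \<open>{..<B}\<close>, coded as numbers. By \<open>slab_marginal\<close>, points with the same
  image have the same cut values.\<close>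

lemma cut_dim_le_imp_eps_embedding:
  assumes "cut_dim_le X T \<Omega> \<epsilon> n" "finite \<Omega>" "\<Omega> \<noteq> {}" "\<epsilon> > 0"
  shows "\<exists>K f. eps_embedding X T \<Omega> \<epsilon> K f \<and> cx_dim K \<le> int n"
proof -
  obtain B c where c: "cuts X B n c" "resolves X T \<Omega> \<epsilon> B c"
    using assms unfolding cut_dim_le_def by blast
  define V where "V = set_encode ` Pow {..<B}"
  define K where "K = {\<sigma>. \<sigma> \<subseteq> V \<and> \<sigma> \<noteq> {} \<and> card \<sigma> \<le> n + 1}"
  define f where "f x v = (if v \<in> V then slab B (\<lambda>j. c j x) (set_decode v) else 0)" for x v
  have "finite V" unfolding V_def by simp
  have dec: "set_decode v \<subseteq> {..<B}" if "v \<in> V" for v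
    using that unfolding V_def by (auto simp: set_encode_inverse finite_subset)
  have fin: "finite S" if "S \<subseteq> {..<B}" for S using that finite_subset by blast
  have sumV: "(\<Sum>v\<in>set_encode ` F. f x v) = (\<Sum>S\<in>F. slab B (\<lambda>j. c j x) S)" if "F \<subseteq> Pow {..<B}" for F x
  proof -
    have "inj_on set_encode F"
      by (rule inj_on_subset[OF inj_on_set_encode]) (use that fin in auto)
    then have "(\<Sum>v\<in>set_encode ` F. f x v) = (\<Sum>S\<in>F. f x (set_encode S))" by (simp add: sum.reindex)
    also have "\<dots> = (\<Sum>S\<in>F. slab B (\<lambda>j. c j x) S)"
      using that fin by (intro sum.cong refl) (auto simp: f_def V_def subset_iff set_encode_inverse)
    finally show ?thesis .
  qed
  have cont: "continuous_on X f"
  proof (rule continuous_on_coordinatewise_then_product)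
    fix v show "continuous_on X (\<lambda>x. f x v)"
      using c(1) dec by (cases "v \<in> V") (auto simp: f_def cuts_def intro!: continuous_on_slab)
  qed
  have "finite K" unfolding K_def by (rule finite_subset[of _ "Pow V"]) (use \<open>finite V\<close> in auto)
  have cx: "simplicial_cx K"
    unfolding simplicial_cx_def
  proof (intro conjI ballI allI impI)
    show "finite K" by fact
    fix \<sigma> assume \<sigma>: "\<sigma> \<in> K"
    then show fs: "finite \<sigma>" and "\<sigma> \<noteq> {}"
      using \<open>finite V\<close> finite_subset unfolding K_def by auto
    fix \<tau> assume \<tau>: "\<tau> \<subseteq> \<sigma> \<and> \<tau> \<noteq> {}"
    then have "card \<tau> \<le> card \<sigma>" using fs by (intro card_mono) auto
    then show "\<tau> \<in> K" using \<sigma> \<tau> unfolding K_def by auto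
  qed
  have real: "f ` X \<subseteq> cx_realization K"
  proof
    fix p assume "p \<in> f ` X"
    then obtain x where x: "x \<in> X" "p = f x" by blast
    let ?P = "{S\<in>Pow {..<B}. slab B (\<lambda>j. c j x) S > 0}"
    define \<sigma> where "\<sigma> = {v\<in>V. f x v > 0}"
    have f0: "0 \<le> f x v" for v by (simp add: f_def slab_nonneg)
    then have z: "f x v = 0" if "v \<notin> \<sigma>" for v
      using that unfolding \<sigma>_def by (metis (mono_tags, lifting) f_def le_less mem_Collect_eq)
    have "sum (f x) V = 1" using sumV[of "Pow {..<B}" x] by (simp add: V_def sum_slab)
    moreover have "sum (f x) V = sum (f x) \<sigma>"
      using z \<open>finite V\<close> by (intro sum.mono_neutral_right) (auto simp: \<sigma>_def)
    ultimately have s1: "sum (f x) \<sigma> = 1" by simp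
    have fS: "f x (set_encode S) = slab B (\<lambda>j. c j x) S" if "S \<subseteq> {..<B}" for S
      using that fin by (auto simp: f_def V_def set_encode_inverse)
    have "\<sigma> = set_encode ` ?P"
    proof (intro set_eqI iffI)
      fix v assume v: "v \<in> \<sigma>"
      then obtain S where "S \<subseteq> {..<B}" "v = set_encode S" unfolding \<sigma>_def V_def by auto
      then show "v \<in> set_encode ` ?P" using v fS unfolding \<sigma>_def by auto
    qed (use fS in \<open>auto simp: \<sigma>_def V_def\<close>)
    then have "card \<sigma> \<le> card ?P" by (simp add: card_image_le)
    also have "\<dots> \<le> n + 1" using c(1) x by (intro card_slab_support) (auto simp: cuts_def)
    finally have "card \<sigma> \<le> n + 1" .
    moreover have "\<sigma> \<noteq> {}" using s1 by auto
    ultimately have "\<sigma> \<in> K" unfolding K_def by (auto simp: \<sigma>_def)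
    then show "p \<in> cx_realization K"
      unfolding cx_realization_def using x f0 z s1 by blast
  qed
  have "dyn_diam T \<Omega> {x\<in>X. f x = p} < \<epsilon>" for p
  proof (rule dyn_diam_less)
    show "compact {x\<in>X. f x = p}"
      by (rule closedin_compact[OF compact_X continuous_closedin_preimage_constant[OF cont]])
    fix x y m assume xy: "x \<in> {x\<in>X. f x = p}" "y \<in> {x\<in>X. f x = p}" and m: "m \<in> \<Omega>"
    have "c j x = c j y" if j: "j < B" for j
    proof -
      let ?F = "{S. S \<subseteq> {..<B} \<and> j \<notin> S}"
      have F: "?F \<subseteq> Pow {..<B}" by auto
      have t: "c j z \<in> {0..1}" if "z \<in> X" for z using that j c(1) unfolding cuts_def by blast
      have "c j x = (\<Sum>S\<in>?F. slab B (\<lambda>j. c j x) S)"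
        using slab_marginal[of j B "\<lambda>j. c j x"] j t xy by auto
      also have "\<dots> = (\<Sum>S\<in>?F. slab B (\<lambda>j. c j y) S)"
        unfolding sumV[OF F, symmetric] using xy by simp
      also have "\<dots> = c j y" using slab_marginal[of j B "\<lambda>j. c j y"] j t xy by auto
      finally show ?thesis .
    qed
    then show "dist (T m x) (T m y) < \<epsilon>" using c(2) xy m unfolding resolves_def by blast
  qed (use assms in auto)
  then have "eps_embedding X T \<Omega> \<epsilon> K f" unfolding eps_embedding_def using cx cont real by blast
  moreover have "cx_dim K \<le> int n"
    unfolding cx_dim_def using \<open>finite K\<close> by (subst Max_le_iff) (auto simp: K_def)
  ultimately show ?thesis by blast
qed

text \<open>Ensures that the \<open>LEAST\<close> in \<open>cut_dim\<close> is attained. The cut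
  functions are truncated distances of the points \<open>T n x\<close> to a finite
  \<open>\<epsilon> / 2\<close>-net: if all agree at \<open>x\<close> and \<open>y\<close>, the net
  point near \<open>T n x\<close> is equally near \<open>T n y\<close>.\<close>

lemma ex_cut_dim_le:
  assumes "finite \<Omega>" "\<epsilon> > 0"
  shows "\<exists>n. cut_dim_le X T \<Omega> \<epsilon> n"
proof -
  obtain Z where Z: "finite Z" "Z \<subseteq> X" "X \<subseteq> (\<Union>z\<in>Z. ball z (\<epsilon> / 2))"
  proof (rule compactE_image[OF compact_X, of X "\<lambda>z. ball z (\<epsilon> / 2)"])
    show "X \<subseteq> (\<Union>z\<in>X. ball z (\<epsilon> / 2))" using assms(2) by auto
  qed auto
  define I where "I = Z \<times> \<Omega>"
  have "finite I" using Z assms by (simp add: I_def)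
  then obtain B e where e: "I = e ` {..<B::nat}"
    using finite_imp_nat_seg_image_inj_on[of I] by (metis lessThan_def)
  define c where "c j x = min 1 (dist (T (snd (e j)) x) (fst (e j)) / \<epsilon>)" for j x
  have "cuts X B B c"
    unfolding cuts_def
  proof (intro conjI allI impI ballI)
    show "continuous_on X (c j)" for j
      unfolding c_def using assms(2) by (intro continuous_intros continuous_on_T) auto
    show "c j x \<in> {0..1}" for j x using assms(2) by (auto simp: c_def)
    fix x
    have "card ((\<lambda>j. c j x) ` {..<B} \<inter> {0<..<1}) \<le> card ((\<lambda>j. c j x) ` {..<B})"
      by (intro card_mono) auto
    also have "\<dots> \<le> B" using card_image_le[of "{..<B}" "\<lambda>j. c j x"] by simp
    finally show "card ((\<lambda>j. c j x) ` {..<B} \<inter> {0<..<1}) \<le> B" .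
  qed
  moreover have "resolves X T \<Omega> \<epsilon> B c"
    unfolding resolves_def
  proof (intro ballI impI)
    fix x y n assume xy: "x \<in> X" "y \<in> X" "\<forall>j<B. c j x = c j y" and n: "n \<in> \<Omega>"
    obtain z where z: "z \<in> Z" "dist z (T n x) < \<epsilon> / 2"
      using subsetD[OF Z(3) T_in[OF xy(1), of n]] by auto
    then have "(z, n) \<in> e ` {..<B}" using n unfolding e[symmetric] I_def by simp
    then obtain j where j: "j < B" "e j = (z, n)" by auto
    have "dist (T n x) z / \<epsilon> < 1 / 2" using z assms(2) by (simp add: dist_commute field_simps)
    moreover have "min 1 (dist (T n x) z / \<epsilon>) = min 1 (dist (T n y) z / \<epsilon>)"
      using xy(3) j unfolding c_def by force
    ultimately have "dist (T n y) z / \<epsilon> < 1 / 2" by linarith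
    then have "dist (T n y) z < \<epsilon> / 2" using assms(2) by (simp add: field_simps)
    then show "dist (T n x) (T n y) < \<epsilon>"
      using z(2) dist_triangle_half_r[of z "T n x" \<epsilon> "T n y"] by (simp add: dist_commute)
  qed
  ultimately show ?thesis unfolding cut_dim_le_def by blast
qed

definition cut_dim :: "('k \<Rightarrow> int) set \<Rightarrow> real \<Rightarrow> nat" where
  "cut_dim \<Omega> \<epsilon> = (LEAST n. cut_dim_le X T \<Omega> \<epsilon> n)"

lemma cut_dim_le_cut_dim: "finite \<Omega> \<Longrightarrow> \<epsilon> > 0 \<Longrightarrow> cut_dim_le X T \<Omega> \<epsilon> (cut_dim \<Omega> \<epsilon>)"
  unfolding cut_dim_def by (rule LeastI_ex) (rule ex_cut_dim_le)

lemma cut_dim_least: "cut_dim_le X T \<Omega> \<epsilon> n \<Longrightarrow> cut_dim \<Omega> \<epsilon> \<le> n"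
  unfolding cut_dim_def by (rule Least_le)

text \<open>\<open>LEAST\<close> on the integers is a minimum only where one exists. As
  \<open>X\<close> is nonempty, every complex that receives it has a simplex, so its dimension is
  nonnegative and survives the truncation by \<open>nat\<close>.\<close>

lemma widim_eq_cut_dim:
  assumes "finite \<Omega>" "\<Omega> \<noteq> {}" "\<epsilon> > 0"
  shows "widim X T \<Omega> \<epsilon> = int (cut_dim \<Omega> \<epsilon>)"
proof -
  have lower: "int (cut_dim \<Omega> \<epsilon>) \<le> cx_dim K" if emb: "eps_embedding X T \<Omega> \<epsilon> K f" for K f
  proof -
    obtain x where "x \<in> X" using nonempty by blast
    then obtain \<sigma> where \<sigma>: "\<sigma> \<in> K" "finite K"
      using emb unfolding eps_embedding_def cx_realization_def simplicial_cx_def by blast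
    then have "finite \<sigma>" "\<sigma> \<noteq> {}" using emb unfolding eps_embedding_def simplicial_cx_def by auto
    then have "card \<sigma> > 0" by auto
    then have "cx_dim K \<ge> 0" using card_le_cx_dim[OF \<sigma>(2,1)] by linarith
    moreover have "cut_dim \<Omega> \<epsilon> \<le> nat (cx_dim K)"
      by (intro cut_dim_least eps_embedding_imp_cut_dim_le[OF emb])
    ultimately show ?thesis by linarith
  qed
  obtain K f where "eps_embedding X T \<Omega> \<epsilon> K f" "cx_dim K \<le> int (cut_dim \<Omega> \<epsilon>)"
    using cut_dim_le_imp_eps_embedding[OF cut_dim_le_cut_dim] assms by blast
  then have "\<exists>K f. eps_embedding X T \<Omega> \<epsilon> K f \<and> cx_dim K = int (cut_dim \<Omega> \<epsilon>)"
    using lower by fastforce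
  then show ?thesis unfolding widim_def using lower by (intro Least_equality) auto
qed

end

section \<open>Subadditivity over lattice boxes and mean dimension\<close>

lemma zbox_eq_PiE: "zbox N = (PiE UNIV (\<lambda>_. {0..<int N}) :: ('k::finite \<Rightarrow> int) set)"
  by (auto simp: zbox_def PiE_def Pi_def extensional_def)

lemma finite_zbox: "finite (zbox N :: ('k::finite \<Rightarrow> int) set)"
  unfolding zbox_eq_PiE by (intro finite_PiE) auto

lemma card_zbox: "card (zbox N :: ('k::finite \<Rightarrow> int) set) = N ^ CARD('k)"
  unfolding zbox_eq_PiE by (simp add: card_PiE)

lemma zbox_nonempty: "N > 0 \<Longrightarrow> zbox N \<noteq> {}"
  unfolding zbox_def by (auto intro!: exI[of _ "\<lambda>_. 0"])

lemma zbox_subset_translates: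
  assumes "M > 0"
  shows "zbox N \<subseteq> (\<Union>a\<in>(\<lambda>b i. int M * b i) ` zbox (N div M + 1). (\<lambda>n. zadd n a) ` zbox M)"
proof
  fix n :: "'a \<Rightarrow> int" assume n: "n \<in> zbox N"
  have "(\<lambda>i. n i mod int M) \<in> zbox M" using assms by (auto simp: zbox_def)
  moreover have "(\<lambda>i. n i div int M) \<in> zbox (N div M + 1)"
  proof -
    have le: "n i div int M \<le> int N div int M" for i
      using n assms by (intro zdiv_mono1) (auto simp: zbox_def less_imp_le)
    have "n i div int M < int (N div M + 1)" for i
      using zdiv_int[of N M] le[of i] by linarith
    then show ?thesis using n assms by (simp add: zbox_def pos_imp_zdiv_nonneg_iff)
  qed
  moreover have "n = zadd (\<lambda>i. n i mod int M) (\<lambda>i. int M * (n i div int M))"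
    by (simp add: zadd_def)
  ultimately show "n \<in> (\<Union>a\<in>(\<lambda>b i. int M * b i) ` zbox (N div M + 1). (\<lambda>n. zadd n a) ` zbox M)"
    by blast
qed

text \<open>Fekete's argument in dimension \<open>k\<close>: the infimum bounds every ratio from
  below, and for fixed \<open>M\<close> the hypothesis bounds the ratio at \<open>N\<close> by
  \<open>(1 / M + 1 / N) ^ k * h M\<close>, which tends to the ratio at \<open>M\<close>.\<close>

lemma subadditive_box_limit:
  fixes h :: "nat \<Rightarrow> nat"
  assumes "\<And>N M. M \<ge> 1 \<Longrightarrow> h N \<le> (N div M + 1) ^ k * h M"
  shows "(\<lambda>N. real (h N) / real N ^ k) \<longlonglongrightarrow> (INF M\<in>{1..}. real (h M) / real M ^ k)"
proof (rule order_tendstoI)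
  let ?r = "\<lambda>N. real (h N) / real N ^ k"
  have bdd: "bdd_below (?r ` {1..})" by (rule bdd_belowI[of _ 0]) auto
  fix a assume a: "a < (INF M\<in>{1..}. ?r M)"
  have "\<forall>\<^sub>F N in sequentially. N \<ge> 1" by (rule eventually_ge_at_top)
  then show "\<forall>\<^sub>F N in sequentially. a < ?r N"
  proof eventually_elim
    case (elim N)
    then have "(INF M\<in>{1..}. ?r M) \<le> ?r N" by (intro cINF_lower bdd) auto
    then show ?case using a by linarith
  qed
next
  let ?r = "\<lambda>N. real (h N) / real N ^ k"
  fix a assume "(INF M\<in>{1..}. ?r M) < a"
  then obtain M where M: "M \<ge> 1" "?r M < a"
    by (subst (asm) cINF_less_iff) (auto intro!: bdd_belowI[of _ 0])
  have "(\<lambda>N. (1 / real M + 1 / real N) ^ k * real (h M)) \<longlonglongrightarrow> (1 / real M + 0) ^ k * real (h M)"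
    by (intro tendsto_intros lim_1_over_n)
  then have "(\<lambda>N. (1 / real M + 1 / real N) ^ k * real (h M)) \<longlonglongrightarrow> ?r M"
    by (simp add: power_one_over)
  then have "\<forall>\<^sub>F N in sequentially. (1 / real M + 1 / real N) ^ k * real (h M) < a"
    using M(2) by (rule order_tendstoD)
  moreover have "\<forall>\<^sub>F N in sequentially. N \<ge> (1::nat)" by (rule eventually_ge_at_top)
  ultimately show "\<forall>\<^sub>F N in sequentially. ?r N < a"
  proof eventually_elim
    case (elim N)
    have "real (h N) \<le> real ((N div M + 1) ^ k * h M)" using assms[OF M(1)] by (simp only: of_nat_le_iff)
    also have "\<dots> = (real (N div M) + 1) ^ k * real (h M)" by (simp add: add.commute)
    also have "\<dots> \<le> (real N / real M + 1) ^ k * real (h M)"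
      by (intro mult_right_mono power_mono add_right_mono of_nat_div_le_of_nat) auto
    finally have "?r N \<le> (real N / real M + 1) ^ k * real (h M) / real N ^ k"
      by (rule divide_right_mono) simp
    also have "\<dots> = ((real N / real M + 1) / real N) ^ k * real (h M)"
      by (simp add: power_divide)
    also have "(real N / real M + 1) / real N = 1 / real M + 1 / real N"
      using elim by (simp add: field_simps)
    finally show ?case using elim(1) by linarith
  qed
qed

context nonempty_zk_system
begin

lemma cut_dim_le_mono:
  assumes "cut_dim_le X T \<Omega>' \<epsilon> n" "\<Omega> \<subseteq> \<Omega>'" "n \<le> n'" "\<epsilon> \<le> \<epsilon>'"
  shows "cut_dim_le X T \<Omega> \<epsilon>' n'"
  using assms cuts_mono unfolding cut_dim_le_def resolves_def
  by (meson less_le_trans subsetD)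

lemma cut_dim_le_Un:
  assumes "cut_dim_le X T \<Omega> \<epsilon> n" "cut_dim_le X T \<Omega>' \<epsilon> n'"
  shows "cut_dim_le X T (\<Omega> \<union> \<Omega>') \<epsilon> (n + n')"
proof -
  obtain B c B' c' where c: "cuts X B n c" "resolves X T \<Omega> \<epsilon> B c"
    and c': "cuts X B' n' c'" "resolves X T \<Omega>' \<epsilon> B' c'"
    using assms unfolding cut_dim_le_def by blast
  let ?c = "\<lambda>j. if j < B then c j else c' (j - B)"
  have "resolves X T (\<Omega> \<union> \<Omega>') \<epsilon> (B + B') ?c"
    unfolding resolves_def
  proof (intro ballI impI)
    fix x y n assume xy: "x \<in> X" "y \<in> X" "\<forall>j<B + B'. ?c j x = ?c j y" and n: "n \<in> \<Omega> \<union> \<Omega>'"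
    have "\<forall>j<B. c j x = c j y" using xy(3) by (metis trans_less_add1)
    moreover have "\<forall>j<B'. c' j x = c' j y"
    proof (intro allI impI)
      fix j assume "j < B'"
      then show "c' j x = c' j y" using xy(3)[rule_format, of "B + j"] by simp
    qed
    ultimately show "dist (T n x) (T n y) < \<epsilon>"
      using c c' xy(1,2) n unfolding resolves_def by blast
  qed
  then show ?thesis using cuts_append[OF c(1) c'(1)] unfolding cut_dim_le_def by blast
qed

lemma cut_dim_le_translate:
  assumes "cut_dim_le X T \<Omega> \<epsilon> n"
  shows "cut_dim_le X T ((\<lambda>m. zadd m a) ` \<Omega>) \<epsilon> n"
proof -
  obtain B c where c: "cuts X B n c" "resolves X T \<Omega> \<epsilon> B c"
    using assms unfolding cut_dim_le_def by blast
  have "cuts X B n (\<lambda>j x. c j (T a x))"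
    using c(1) T_in unfolding cuts_def
    by (auto intro!: continuous_on_compose2[OF _ continuous_on_T])
  moreover have "resolves X T ((\<lambda>m. zadd m a) ` \<Omega>) \<epsilon> B (\<lambda>j x. c j (T a x))"
    using c(2) T_in unfolding resolves_def by (auto simp: T_zadd)
  ultimately show ?thesis unfolding cut_dim_le_def by blast
qed

lemma cut_dim_le_translates:
  assumes "finite A" "cut_dim_le X T \<Omega> \<epsilon> n"
  shows "cut_dim_le X T (\<Union>a\<in>A. (\<lambda>m. zadd m a) ` \<Omega>) \<epsilon> (card A * n)"
  using assms(1)
proof induction
  case empty
  have "cuts X 0 0 (\<lambda>_ _. 0)" by (simp add: cuts_def)
  then show ?case unfolding cut_dim_le_def resolves_def by auto
next
  case (insert a A)
  then show ?case using cut_dim_le_Un[OF cut_dim_le_translate[OF assms(2), of a] insert.IH] by simp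
qed

lemma cut_dim_zbox_le:
  assumes "\<epsilon> > 0" "M \<ge> 1"
  shows "cut_dim (zbox N) \<epsilon> \<le> (N div M + 1) ^ CARD('k) * cut_dim (zbox M) \<epsilon>"
proof -
  let ?A = "(\<lambda>b i. int M * b i) ` (zbox (N div M + 1) :: ('k \<Rightarrow> int) set)"
  have "cut_dim_le X T (\<Union>a\<in>?A. (\<lambda>n. zadd n a) ` zbox M) \<epsilon> (card ?A * cut_dim (zbox M) \<epsilon>)"
    using assms by (intro cut_dim_le_translates cut_dim_le_cut_dim finite_imageI finite_zbox)
  then have "cut_dim_le X T (zbox N) \<epsilon> ((N div M + 1) ^ CARD('k) * cut_dim (zbox M) \<epsilon>)"
  proof (rule cut_dim_le_mono)
    have "card ?A \<le> (N div M + 1) ^ CARD('k)"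
      using card_image_le[OF finite_zbox] card_zbox by metis
    then show "card ?A * cut_dim (zbox M) \<epsilon> \<le> (N div M + 1) ^ CARD('k) * cut_dim (zbox M) \<epsilon>"
      by (rule mult_right_mono) simp
    show "zbox N \<subseteq> (\<Union>a\<in>?A. (\<lambda>n. zadd n a) ` zbox M)"
      using assms by (intro zbox_subset_translates) simp
  qed simp
  then show ?thesis by (rule cut_dim_least)
qed

definition widim_rate :: "real \<Rightarrow> real" where
  "widim_rate \<epsilon> = (INF M\<in>{1..}. real (cut_dim (zbox M) \<epsilon>) / real M ^ CARD('k))"

lemma widim_limit:
  assumes "\<epsilon> > 0"
  shows "(\<lambda>N. real_of_int (widim X T (zbox N) \<epsilon>) / real N ^ CARD('k)) \<longlonglongrightarrow> widim_rate \<epsilon>"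
proof -
  have "\<forall>\<^sub>F N in sequentially. N \<ge> (1::nat)" by (rule eventually_ge_at_top)
  then have "\<forall>\<^sub>F N in sequentially. real (cut_dim (zbox N) \<epsilon>) / real N ^ CARD('k)
      = real_of_int (widim X T (zbox N) \<epsilon>) / real N ^ CARD('k)"
  proof eventually_elim
    case (elim N)
    then show ?case using assms by (simp add: widim_eq_cut_dim finite_zbox zbox_nonempty)
  qed
  with subadditive_box_limit[of "\<lambda>N. cut_dim (zbox N) \<epsilon>", OF cut_dim_zbox_le[OF assms]]
  show ?thesis unfolding widim_rate_def by (rule Lim_transform_eventually)
qed

lemma widim_rate_antimono:
  assumes "0 < \<epsilon>" "\<epsilon> \<le> \<epsilon>'"
  shows "widim_rate \<epsilon>' \<le> widim_rate \<epsilon>"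
  unfolding widim_rate_def
proof (rule cINF_mono)
  show "bdd_below ((\<lambda>M. real (cut_dim (zbox M) \<epsilon>') / real M ^ CARD('k)) ` {1..})"
    by (rule bdd_belowI[of _ 0]) auto
  fix M :: nat assume "M \<in> {1..}"
  have "cut_dim (zbox M) \<epsilon>' \<le> cut_dim (zbox M) \<epsilon>"
    using assms
    by (intro cut_dim_least cut_dim_le_mono[OF cut_dim_le_cut_dim order_refl order_refl] finite_zbox)
  then show "\<exists>N\<in>{1..}. real (cut_dim (zbox N) \<epsilon>') / real N ^ CARD('k) \<le> real (cut_dim (zbox M) \<epsilon>) / real M ^ CARD('k)"
    using \<open>M \<in> {1..}\<close> by (intro bexI[of _ M] divide_right_mono) auto
qed auto

text \<open>\<open>Lim\<close> and \<open>lim\<close> denote limits only where these exist. The rate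
  grows as \<open>\<epsilon>\<close> shrinks, so in \<open>ereal\<close> the outer limit exists and
  is the supremum of all rates.\<close>

lemma widim_rate_le_mdim:
  assumes "\<epsilon> > 0"
  shows "ereal (widim_rate \<epsilon>) \<le> mdim X T"
proof -
  let ?g = "\<lambda>\<epsilon>. ereal (lim (\<lambda>N. real_of_int (widim X T (zbox N) \<epsilon>) / real N ^ CARD('k)))"
  let ?S = "SUP \<epsilon>\<in>{0<..}. ereal (widim_rate \<epsilon>)"
  have g: "?g e = ereal (widim_rate e)" if "e > 0" for e
    using limI[OF widim_limit[OF that]] by simp
  have "(?g \<longlongrightarrow> ?S) (at_right 0)"
  proof (rule order_tendstoI)
    fix a assume "a < ?S"
    then obtain e where e: "e > 0" "a < ereal (widim_rate e)" by (auto simp: less_SUP_iff)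
    have "\<forall>\<^sub>F d in at_right 0. d \<in> {0<..<e}" using e(1) by (rule eventually_at_right_real)
    then show "\<forall>\<^sub>F d in at_right 0. a < ?g d"
    proof eventually_elim
      case (elim d)
      then have "widim_rate e \<le> widim_rate d" by (intro widim_rate_antimono) auto
      then have "a < ereal (widim_rate d)" using e(2) less_le_trans by (metis ereal_less_eq(3))
      then show ?case using g elim by auto
    qed
  next
    fix a assume a: "?S < a"
    have "\<forall>\<^sub>F d in at_right 0. d \<in> {0<..<1::real}" by (rule eventually_at_right_real) simp
    then show "\<forall>\<^sub>F d in at_right 0. ?g d < a"
    proof eventually_elim
      case (elim d)
      then have "ereal (widim_rate d) \<le> ?S" by (intro SUP_upper) auto
      then show ?case using a g elim by auto
    qed
  qed
  then have "mdim X T = ?S" unfolding mdim_def by (intro tendsto_Lim) auto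
  then show ?thesis using assms by (auto intro: SUP_upper)
qed

text \<open>The rate is an infimum over box sides, so the strict inequality already holds for one
  finite box. Its side \<open>M\<close> is the scale of the grid on which tiles are later
  counted.\<close>

lemma ex_cut_dim_zbox_less:
  assumes "mdim X T < ereal (real d / 2)" "\<epsilon> > 0"
  obtains M where "M \<ge> 1" "2 * cut_dim (zbox M) \<epsilon> < d * M ^ CARD('k)"
proof -
  have "widim_rate \<epsilon> < real d / 2"
    using le_less_trans[OF widim_rate_le_mdim[OF assms(2)] assms(1)] by simp
  then obtain M where M: "M \<ge> 1" "real (cut_dim (zbox M) \<epsilon>) / real M ^ CARD('k) < real d / 2"
    unfolding widim_rate_def by (subst (asm) cINF_less_iff) (auto intro!: bdd_belowI[of _ 0])
  then have "real (2 * cut_dim (zbox M) \<epsilon>) < real (d * M ^ CARD('k))"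
    by (simp add: field_simps)
  then show ?thesis using that[OF M(1)] by (simp only: of_nat_less_iff)
qed

end

section \<open>General position\<close>

text \<open>The forms are treated one at a time: a coordinate on which the new form depends is moved
  by a small \<open>t\<close>, avoiding for each form so far the value of \<open>t\<close> at which
  it would vanish.\<close>

lemma perturb_nonvanishing:
  fixes L :: "'i \<Rightarrow> 'v \<Rightarrow> real" and x0 :: "'v \<Rightarrow> real"
  assumes "finite I" "finite V" "\<And>i. i \<in> I \<Longrightarrow> \<exists>v\<in>V. L i v \<noteq> 0" "e > 0"
  shows "\<exists>x. (\<forall>v. \<bar>x v - x0 v\<bar> < e) \<and> (\<forall>i\<in>I. (\<Sum>v\<in>V. L i v * x v) \<noteq> 0)"
  using assms(1,3,4)
proof (induction I arbitrary: e rule: finite_induct)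
  case empty
  then show ?case by (intro exI[of _ x0]) auto
next
  case (insert k I)
  obtain x where x: "\<And>v. \<bar>x v - x0 v\<bar> < e / 2" "\<And>i. i \<in> I \<Longrightarrow> (\<Sum>v\<in>V. L i v * x v) \<noteq> 0"
    using insert.IH[of "e / 2"] insert.prems by auto
  obtain v0 where v0: "v0 \<in> V" "L k v0 \<noteq> 0" using insert.prems by blast
  let ?l = "\<lambda>i. \<Sum>v\<in>V. L i v * x v"
  \<comment> \<open>For a form that does not involve \<open>v0\<close>, division by zero excludes
    only \<open>t = 0\<close>; its value does not change.\<close>
  define F where "F = {0<..<e / 2} - (\<lambda>i. - ?l i / L i v0) ` insert k I"
  have "infinite F"
    unfolding F_def using insert.hyps insert.prems by (intro Diff_infinite_finite) auto
  then have "F \<noteq> {}" by auto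
  then obtain t where "t \<in> F" by blast
  then have t: "0 < t" "t < e / 2" "\<And>i. i \<in> insert k I \<Longrightarrow> t \<noteq> - ?l i / L i v0"
    unfolding F_def by auto
  let ?x = "x(v0 := x v0 + t)"
  have lx: "(\<Sum>v\<in>V. L i v * ?x v) = ?l i + L i v0 * t" for i
  proof -
    have "(\<Sum>v\<in>V. L i v * ?x v) = (\<Sum>v\<in>V. L i v * x v + (if v = v0 then L i v0 * t else 0))"
      by (intro sum.cong) (auto simp: algebra_simps)
    then show ?thesis using v0 assms(2) by (simp add: sum.distrib)
  qed
  have "?l i + L i v0 * t \<noteq> 0" if i: "i \<in> insert k I" for i
  proof (cases "L i v0 = 0")
    case True
    then show ?thesis using i x(2) v0 by auto
  next
    case False
    then show ?thesis using t(3)[OF i] by (auto simp: field_simps)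
  qed
  moreover have "\<bar>?x v - x0 v\<bar> < e" for v
  proof (cases "v = v0")
    case True
    show ?thesis unfolding True fun_upd_same using x(1)[of v0] t(1,2) by linarith
  next
    case False
    then show ?thesis using x(1)[of v] insert.prems(2) by simp
  qed
  ultimately show ?case unfolding lx[symmetric] by blast
qed

text \<open>The coordinates are perturbed one at a time: a set of \<open>card J + 2\<close> vertices carries, up to
  scaling, at most one affine relation in the coordinates from \<open>J\<close>, and the new coordinate is
  chosen so as to violate it.\<close>

lemma perturb_general_position:
  fixes w0 :: "'v \<Rightarrow> 'j \<Rightarrow> real"
  assumes "finite V" "finite J" "e > 0"
  shows "\<exists>w. (\<forall>v j. \<bar>w v j - w0 v j\<bar> < e) \<and>
    (\<forall>c. card {v\<in>V. c v \<noteq> 0} \<le> card J + 1 \<longrightarrow> sum c V = 0 \<longrightarrow>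
      (\<forall>j\<in>J. (\<Sum>v\<in>V. c v * w v j) = 0) \<longrightarrow> (\<forall>v\<in>V. c v = 0))"
  using assms(2)
proof (induction J rule: finite_induct)
  case empty
  \<comment> \<open>Without coordinates the only condition is that the coefficients sum to 0, and on
    a single vertex this forces the coefficient to vanish.\<close>
  have *: "\<forall>v\<in>V. c v = 0" if "card {v\<in>V. c v \<noteq> 0} \<le> 1" "sum c V = 0" for c :: "'v \<Rightarrow> real"
  proof (rule ccontr)
    assume "\<not> ?thesis"
    then obtain v0 where v0: "v0 \<in> V" "c v0 \<noteq> 0" by blast
    have "{v\<in>V. c v \<noteq> 0} = {v0}"
    proof (rule card_seteq[symmetric])
      show "card {v\<in>V. c v \<noteq> 0} \<le> card {v0}" using that by simp
    qed (use assms(1) v0 in auto)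
    moreover have "sum c V = sum c {v\<in>V. c v \<noteq> 0}"
      using assms(1) by (intro sum.mono_neutral_right) auto
    ultimately show False using that v0 by simp
  qed
  show ?case
  proof (intro exI[of _ w0] conjI allI impI)
    fix c :: "'v \<Rightarrow> real" assume c: "card {v\<in>V. c v \<noteq> 0} \<le> card ({} :: 'j set) + 1" "sum c V = 0"
    then show "\<forall>v\<in>V. c v = 0" by (intro *) simp_all
  qed (use assms(3) in simp)
next
  case (insert j0 J)
  obtain w where w: "\<And>v j. \<bar>w v j - w0 v j\<bar> < e"
    and gp: "\<And>c. card {v\<in>V. c v \<noteq> 0} \<le> card J + 1 \<Longrightarrow> sum c V = 0 \<Longrightarrow>
      (\<forall>j\<in>J. (\<Sum>v\<in>V. c v * w v j) = 0) \<Longrightarrow> (\<forall>v\<in>V. c v = 0)"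
    using insert.IH by auto
  define R where "R c \<longleftrightarrow> sum c V = 0 \<and> (\<forall>j\<in>J. (\<Sum>v\<in>V. c v * w v j) = 0)" for c
  \<comment> \<open>The vertex sets that carry a nontrivial relation among the old coordinates. One
    relation \<open>r S\<close> is picked for each, and the new coordinate is chosen to violate all
    of these finitely many relations.\<close>
  define I where "I = {S\<in>Pow V. \<exists>c. R c \<and> (\<forall>v\<in>V - S. c v = 0) \<and> (\<exists>v\<in>V. c v \<noteq> 0)}"
  have "\<forall>S\<in>I. \<exists>c. R c \<and> (\<forall>v\<in>V - S. c v = 0) \<and> (\<exists>v\<in>V. c v \<noteq> 0)" unfolding I_def by blast
  then obtain r where r: "\<And>S. S \<in> I \<Longrightarrow> R (r S)" "\<And>S v. S \<in> I \<Longrightarrow> v \<in> V - S \<Longrightarrow> r S v = 0"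
      "\<And>S. S \<in> I \<Longrightarrow> \<exists>v\<in>V. r S v \<noteq> 0"
    by metis
  have "finite I" unfolding I_def using assms(1) by simp
  then obtain x where x: "\<And>v. \<bar>x v - w0 v j0\<bar> < e" "\<And>S. S \<in> I \<Longrightarrow> (\<Sum>v\<in>V. r S v * x v) \<noteq> 0"
    using perturb_nonvanishing[of I V r e "\<lambda>v. w0 v j0"] r(3) assms by auto
  let ?w = "\<lambda>v. (w v)(j0 := x v)"
  have "\<forall>v\<in>V. c v = 0" if card: "card {v\<in>V. c v \<noteq> 0} \<le> card (insert j0 J) + 1" and c0: "sum c V = 0"
    and cw: "\<forall>j\<in>insert j0 J. (\<Sum>v\<in>V. c v * ?w v j) = 0" for c
  proof (rule ccontr)
    assume nz: "\<not> ?thesis"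
    have "(\<Sum>v\<in>V. c v * w v j) = 0" if "j \<in> J" for j
    proof -
      have "j \<noteq> j0" using that insert.hyps by blast
      then show ?thesis using cw[rule_format, of j] that by simp
    qed
    then have Rc: "R c" unfolding R_def using c0 by blast
    define S where "S = {v\<in>V. c v \<noteq> 0}"
    have fS: "finite S" unfolding S_def using assms(1) by simp
    have S: "S \<in> I" unfolding I_def S_def using Rc nz by auto
    obtain v0 where v0: "v0 \<in> V" "r S v0 \<noteq> 0" using r(3)[OF S] by blast
    then have "v0 \<in> S" using r(2)[OF S] by blast
    \<comment> \<open>The multiple of \<open>r S\<close> that cancels \<open>c\<close> at
      \<open>v0\<close>. The difference is supported on \<open>S - {v0}\<close>, small enough for
      the induction hypothesis, so \<open>c\<close> is a nonzero multiple of \<open>r S\<close> and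
      is violated as well.\<close>
    define l where "l = c v0 / r S v0"
    have "l \<noteq> 0" using \<open>v0 \<in> S\<close> v0 unfolding l_def S_def by auto
    have "\<forall>v\<in>V. c v - l * r S v = 0"
    proof (rule gp)
      have "{v\<in>V. c v - l * r S v \<noteq> 0} \<subseteq> S - {v0}"
        using r(2)[OF S] v0 by (auto simp: S_def l_def)
      then have "card {v\<in>V. c v - l * r S v \<noteq> 0} \<le> card (S - {v0})" using fS by (intro card_mono) auto
      also have "\<dots> = card S - 1" using \<open>v0 \<in> S\<close> by simp
      also have "\<dots> \<le> card J + 1" using card insert.hyps unfolding S_def by simp
      finally show "card {v\<in>V. c v - l * r S v \<noteq> 0} \<le> card J + 1" .
      show "(\<Sum>v\<in>V. c v - l * r S v) = 0"
        using Rc r(1)[OF S] unfolding R_def by (simp add: sum_subtractf flip: sum_distrib_left)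
      show "\<forall>j\<in>J. (\<Sum>v\<in>V. (c v - l * r S v) * w v j) = 0"
        using Rc r(1)[OF S] unfolding R_def
        by (simp add: left_diff_distrib sum_subtractf mult.assoc flip: sum_distrib_left)
    qed
    then have "(\<Sum>v\<in>V. c v * x v) = (\<Sum>v\<in>V. l * (r S v * x v))"
      by (intro sum.cong) auto
    also have "\<dots> = l * (\<Sum>v\<in>V. r S v * x v)" by (simp add: sum_distrib_left)
    also have "\<dots> \<noteq> 0" using x(2)[OF S] \<open>l \<noteq> 0\<close> by simp
    finally show False using cw by simp
  qed
  moreover have "\<bar>?w v j - w0 v j\<bar> < e" for v j using w x by simp
  ultimately show ?case by (intro exI[of _ ?w]) blast
qed

text \<open>The difference of two points of the \<open>n\<close>-skeleton has at most
  \<open>2 * n + 2 \<le> card J + 1\<close> nonzero coefficients, and these sum to 0. This is the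
  origin of the classical number \<open>2 * n + 1\<close> of coordinates.\<close>

lemma perturb_simplicial_injective:
  fixes w0 :: "'v \<Rightarrow> 'j \<Rightarrow> real"
  assumes "finite V" "finite J" "e > 0" "2 * n + 1 \<le> card J"
  obtains w where "\<And>v j. \<bar>w v j - w0 v j\<bar> < e"
    "\<And>p q v. card {v\<in>V. p v \<noteq> 0} \<le> n + 1 \<Longrightarrow> card {v\<in>V. q v \<noteq> 0} \<le> n + 1 \<Longrightarrow> sum p V = sum q V \<Longrightarrow>
      (\<And>j. j \<in> J \<Longrightarrow> (\<Sum>v\<in>V. p v * w v j) = (\<Sum>v\<in>V. q v * w v j)) \<Longrightarrow> v \<in> V \<Longrightarrow> p v = q v"
proof -
  obtain w where w: "\<And>v j. \<bar>w v j - w0 v j\<bar> < e"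
    and gp: "\<And>c. card {v\<in>V. c v \<noteq> 0} \<le> card J + 1 \<Longrightarrow> sum c V = 0 \<Longrightarrow>
      (\<forall>j\<in>J. (\<Sum>v\<in>V. c v * w v j) = 0) \<Longrightarrow> (\<forall>v\<in>V. c v = 0)"
    using perturb_general_position[OF assms(1-3), of w0] by auto
  have "p v = q v" if p: "card {v\<in>V. p v \<noteq> 0} \<le> n + 1" and q: "card {v\<in>V. q v \<noteq> 0} \<le> n + 1"
    and s: "sum p V = sum q V" and eq: "\<And>j. j \<in> J \<Longrightarrow> (\<Sum>v\<in>V. p v * w v j) = (\<Sum>v\<in>V. q v * w v j)"
    and v: "v \<in> V" for p q v
  proof -
    have "\<forall>v\<in>V. p v - q v = 0"
    proof (rule gp)
      have "card {v\<in>V. p v - q v \<noteq> 0} \<le> card ({v\<in>V. p v \<noteq> 0} \<union> {v\<in>V. q v \<noteq> 0})"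
        using assms(1) by (intro card_mono) auto
      also have "\<dots> \<le> card {v\<in>V. p v \<noteq> 0} + card {v\<in>V. q v \<noteq> 0}" by (rule card_Un_le)
      also have "\<dots> \<le> card J + 1" using p q assms(4) by simp
      finally show "card {v\<in>V. p v - q v \<noteq> 0} \<le> card J + 1" .
    qed (use s eq in \<open>auto simp: sum_subtractf left_diff_distrib\<close>)
    then show ?thesis using v by auto
  qed
  then show ?thesis using that w by blast
qed

section \<open>Partitions of unity with small stars\<close>

context nonempty_zk_system
begin

text \<open>For each \<open>n\<close>, the pairs with
  \<open>dist (T n x) (T n y) \<ge> \<epsilon>\<close> form a compact set on which the total
  difference of cut values is positive, hence bounded away from 0.\<close>

lemma resolves_uniformly:
  assumes c: "cuts X B n c" "resolves X T \<Omega> \<epsilon> B c" and "finite \<Omega>"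
  obtains \<eta> where "\<eta> > 0"
    "\<And>x y n. x \<in> X \<Longrightarrow> y \<in> X \<Longrightarrow> (\<And>j. j < B \<Longrightarrow> \<bar>c j x - c j y\<bar> < \<eta>) \<Longrightarrow> n \<in> \<Omega> \<Longrightarrow> dist (T n x) (T n y) < \<epsilon>"
proof -
  have "\<exists>\<eta>>0. \<forall>x\<in>X. \<forall>y\<in>X. (\<forall>j<B. \<bar>c j x - c j y\<bar> < \<eta>) \<longrightarrow> dist (T n x) (T n y) < \<epsilon>" if n: "n \<in> \<Omega>" for n
  proof -
    let ?d = "\<lambda>p. dist (T n (fst p)) (T n (snd p))" and ?g = "\<lambda>p. \<Sum>j<B. \<bar>c j (fst p) - c j (snd p)\<bar>"
    define A where "A = X \<times> X \<inter> ?d -` {\<epsilon>..}"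
    have "continuous_on (X \<times> X) ?d"
      by (intro continuous_on_dist continuous_on_compose2[OF continuous_on_T]
          continuous_on_fst continuous_on_snd continuous_on_id) auto
    then have "closedin (top_of_set (X \<times> X)) A"
      unfolding A_def by (rule continuous_closedin_preimage) simp
    then have "compact A" by (rule closedin_compact[OF compact_Times[OF compact_X compact_X]])
    have contc: "continuous_on X (c j)" if "j < B" for j using c(1) that unfolding cuts_def by blast
    have contg: "continuous_on A ?g"
      by (intro continuous_on_sum continuous_on_rabs continuous_on_diff continuous_on_compose2[OF contc]
          continuous_on_fst continuous_on_snd continuous_on_id) (auto simp: A_def)
    show ?thesis
    proof (cases "A = {}")
      case True
      have "?d (x, y) < \<epsilon>" if "x \<in> X" "y \<in> X" for x y
      proof (rule ccontr)
        assume "\<not> ?d (x, y) < \<epsilon>"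
        then have "(x, y) \<in> A" using that by (simp add: A_def)
        then show False using True by simp
      qed
      then show ?thesis by (intro exI[of _ 1]) auto
    next
      case False
      then obtain p0 where p0: "p0 \<in> A" "\<And>p. p \<in> A \<Longrightarrow> ?g p0 \<le> ?g p"
        using continuous_attains_inf[OF \<open>compact A\<close> _ contg] by blast
      have "?g p0 \<noteq> 0"
      proof
        assume "?g p0 = 0"
        then have "\<forall>j<B. c j (fst p0) = c j (snd p0)" by (subst (asm) sum_nonneg_eq_0_iff) auto
        moreover have "fst p0 \<in> X" "snd p0 \<in> X" using p0(1) by (auto simp: A_def)
        ultimately have "?d p0 < \<epsilon>" using c(2) n unfolding resolves_def by blast
        then show False using p0(1) by (auto simp: A_def)
      qed
      moreover have "?g p0 \<ge> 0" by (intro sum_nonneg) auto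
      ultimately have g0: "?g p0 > 0" by linarith
      show ?thesis
      \<comment> \<open>With the denominator \<open>B + 1\<close>, even \<open>B\<close> differences
        of this size add up to less than the minimum.\<close>
      proof (intro exI[of _ "?g p0 / (real B + 1)"] conjI ballI impI)
        show "?g p0 / (real B + 1) > 0" using g0 by simp
        fix x y assume xy: "x \<in> X" "y \<in> X" and near: "\<forall>j<B. \<bar>c j x - c j y\<bar> < ?g p0 / (real B + 1)"
        show "dist (T n x) (T n y) < \<epsilon>"
        proof (rule ccontr)
          assume "\<not> ?thesis"
          then have "?g p0 \<le> ?g (x, y)" using xy by (intro p0) (auto simp: A_def)
          also have "\<dots> \<le> (\<Sum>j<B. ?g p0 / (real B + 1))" using near by (intro sum_mono) (auto intro: less_imp_le)
          also have "\<dots> = ?g p0 * (real B / (real B + 1))" by simp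
          also have "\<dots> < ?g p0 * 1" using g0 by (intro mult_strict_left_mono) auto
          finally show False by simp
        qed
      qed
    qed
  qed
  then obtain \<eta> where \<eta>: "\<And>n. n \<in> \<Omega> \<Longrightarrow> \<eta> n > 0"
    "\<And>n x y. n \<in> \<Omega> \<Longrightarrow> x \<in> X \<Longrightarrow> y \<in> X \<Longrightarrow> (\<forall>j<B. \<bar>c j x - c j y\<bar> < \<eta> n) \<Longrightarrow> dist (T n x) (T n y) < \<epsilon>"
    by metis
  show ?thesis
  proof (rule that[of "Min (insert 1 (\<eta> ` \<Omega>))"])
    show "Min (insert 1 (\<eta> ` \<Omega>)) > 0" using \<eta>(1) assms(3) by auto
    fix x y n assume xy: "x \<in> X" "y \<in> X" and near: "\<And>j. j < B \<Longrightarrow> \<bar>c j x - c j y\<bar> < Min (insert 1 (\<eta> ` \<Omega>))"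
      and n: "n \<in> \<Omega>"
    have "Min (insert 1 (\<eta> ` \<Omega>)) \<le> \<eta> n" using n assms(3) by (intro Min_le) auto
    then show "dist (T n x) (T n y) < \<epsilon>" using near by (intro \<eta>(2) n xy) (auto intro: less_le_trans)
  qed
qed

text \<open>\<open>resolves\<close> makes fibres small, but approximating a function by its values
  at vertices needs small stars. In the \<open>M\<close>-fold subdivision the cut values of two
  points of a star differ by less than \<open>2 / M\<close>, which is below the
  \<open>\<eta>\<close> of uniform resolution.\<close>

lemma partition_of_unity_small_stars:
  assumes "cut_dim_le X T \<Omega> \<epsilon> n" "finite \<Omega>"
  obtains V :: "nat set set" and \<phi> :: "'a \<Rightarrow> nat set \<Rightarrow> real" where "finite V"
    "\<And>v. v \<in> V \<Longrightarrow> continuous_on X (\<lambda>x. \<phi> x v)"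
    "\<And>x v. \<phi> x v \<ge> 0" "\<And>x. sum (\<phi> x) V = 1"
    "\<And>x. x \<in> X \<Longrightarrow> card {v\<in>V. \<phi> x v \<noteq> 0} \<le> n + 1"
    "\<And>x y v m. x \<in> X \<Longrightarrow> y \<in> X \<Longrightarrow> v \<in> V \<Longrightarrow> \<phi> x v > 0 \<Longrightarrow> \<phi> y v > 0 \<Longrightarrow> m \<in> \<Omega> \<Longrightarrow> dist (T m x) (T m y) < \<epsilon>"
proof -
  obtain B c where c: "cuts X B n c" "resolves X T \<Omega> \<epsilon> B c"
    using assms unfolding cut_dim_le_def by blast
  obtain \<eta> where \<eta>: "\<eta> > 0"
    "\<And>x y n. x \<in> X \<Longrightarrow> y \<in> X \<Longrightarrow> (\<And>j. j < B \<Longrightarrow> \<bar>c j x - c j y\<bar> < \<eta>) \<Longrightarrow> n \<in> \<Omega> \<Longrightarrow> dist (T n x) (T n y) < \<epsilon>"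
    using resolves_uniformly[OF c assms(2)] by metis
  obtain M where M: "2 / \<eta> < real M" using reals_Archimedean2 by blast
  then have "M > 0" using \<eta>(1) by (metis divide_pos_pos less_trans of_nat_0_less_iff zero_less_numeral)
  let ?t = "\<lambda>x q. refine_cuts M c q x"
  note fine = cuts_refine[OF c(1) \<open>M > 0\<close>]
  show ?thesis
  proof (rule that[of "Pow {..<B * M}" "\<lambda>x. slab (B * M) (?t x)"])
    show "continuous_on X (\<lambda>x. slab (B * M) (?t x) v)" if "v \<in> Pow {..<B * M}" for v
      using fine that by (intro continuous_on_slab) (auto simp: cuts_def)
    show "card {v\<in>Pow {..<B * M}. slab (B * M) (?t x) v \<noteq> 0} \<le> n + 1" if "x \<in> X" for x
    proof -
      have "{v\<in>Pow {..<B * M}. slab (B * M) (?t x) v \<noteq> 0} = {v\<in>Pow {..<B * M}. slab (B * M) (?t x) v > 0}"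
        using slab_nonneg by (auto simp: less_le)
      moreover have "card ((\<lambda>q. ?t x q) ` {..<B * M} \<inter> {0<..<1}) \<le> n"
        using fine that unfolding cuts_def by blast
      ultimately show ?thesis using card_slab_support by simp
    qed
    fix x y v m assume xy: "x \<in> X" "y \<in> X" and v: "v \<in> Pow {..<B * M}"
      "slab (B * M) (?t x) v > 0" "slab (B * M) (?t y) v > 0" and m: "m \<in> \<Omega>"
    show "dist (T m x) (T m y) < \<epsilon>"
    proof (rule \<eta>(2)[OF xy _ m])
      fix j assume j: "j < B"
      have c01: "c j x \<in> {0..1}" "c j y \<in> {0..1}" using c(1) xy j unfolding cuts_def by blast+
      have "real M * c j y < real M * c j x + 2" "real M * c j x < real M * c j y + 2"
        using refine_cuts_star_aux[OF c01 j \<open>M > 0\<close> v(2,3)] refine_cuts_star_aux[OF c01(2,1) j \<open>M > 0\<close> v(3,2)] v(1)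
        by auto
      then have "real M * \<bar>c j x - c j y\<bar> < 2" by (auto simp: abs_if algebra_simps)
      also have "2 < real M * \<eta>" using M \<eta>(1) by (simp add: field_simps)
      finally show "\<bar>c j x - c j y\<bar> < \<eta>" using \<open>M > 0\<close> by simp
    qed
  qed (auto simp: slab_nonneg sum_slab)
qed

end

section \<open>Clopen markers\<close>

definition zdiff :: "('k \<Rightarrow> int) \<Rightarrow> ('k \<Rightarrow> int) \<Rightarrow> ('k \<Rightarrow> int)" where
  "zdiff m n = (\<lambda>i. m i - n i)"

definition zneg :: "('k \<Rightarrow> int) \<Rightarrow> ('k \<Rightarrow> int)" where "zneg n = (\<lambda>i. - n i)"

lemma zadd_simps [simp]:
  "zadd (\<lambda>i. 0) a = a" "zadd a (\<lambda>i. 0) = a" "zadd (zneg a) a = (\<lambda>i. 0)" "zadd a (zneg a) = (\<lambda>i. 0)"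
  "zadd (zneg a) (zadd a b) = b" "zadd (zdiff a b) b = a" "zadd (zadd b (zneg a)) a = b" "zneg (zneg a) = a"
  by (simp_all add: zadd_def zneg_def zdiff_def)

lemma zneg_eq_0_iff [simp]: "zneg a = (\<lambda>i. 0) \<longleftrightarrow> a = (\<lambda>i. 0)"
  by (simp add: zneg_def fun_eq_iff)

definition cbx :: "int \<Rightarrow> ('k \<Rightarrow> int) set" where "cbx R = {n. \<forall>i. \<bar>n i\<bar> \<le> R}"

lemma finite_cbx: "finite (cbx R :: ('k::finite \<Rightarrow> int) set)"
proof -
  have "cbx R = (PiE UNIV (\<lambda>_. {-R..R}) :: ('k \<Rightarrow> int) set)"
    by (auto simp: cbx_def PiE_def Pi_def extensional_def abs_le_iff minus_le_iff)
  then show ?thesis by (simp add: finite_PiE)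
qed

lemma zneg_in_cbx [simp]: "zneg a \<in> cbx R \<longleftrightarrow> a \<in> cbx R"
  by (simp add: cbx_def zneg_def)

text \<open>For a predicate this says that it cuts out a clopen subset of \<open>X\<close>.
  Arbitrary target types also cover set-valued data, such as the markers seen in a window.\<close>

definition loc_const_on :: "'a::topological_space set \<Rightarrow> ('a \<Rightarrow> 'b) \<Rightarrow> bool" where
  "loc_const_on X f \<longleftrightarrow> (\<forall>x\<in>X. \<forall>\<^sub>F y in nhds x. y \<in> X \<longrightarrow> f y = f x)"

lemma loc_const_on_openin:
  assumes "loc_const_on X P" shows "openin (top_of_set X) {x\<in>X. P x}"
proof (subst openin_subopen, intro ballI)
  fix x assume x: "x \<in> {x\<in>X. P x}"
  then have "\<forall>\<^sub>F y in nhds x. y \<in> X \<longrightarrow> P y = P x" using assms unfolding loc_const_on_def by blast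
  then obtain U where U: "open U" "x \<in> U" "\<forall>y\<in>U. y \<in> X \<longrightarrow> P y = P x"
    unfolding eventually_nhds by blast
  show "\<exists>T. openin (top_of_set X) T \<and> x \<in> T \<and> T \<subseteq> {x\<in>X. P x}"
    using U x by (intro exI[of _ "X \<inter> U"]) auto
qed

lemma loc_const_on_compose2:
  assumes "loc_const_on X f" "loc_const_on X g" shows "loc_const_on X (\<lambda>x. h (f x) (g x))"
  unfolding loc_const_on_def
proof
  fix x assume "x \<in> X"
  then have "\<forall>\<^sub>F y in nhds x. y \<in> X \<longrightarrow> f y = f x" "\<forall>\<^sub>F y in nhds x. y \<in> X \<longrightarrow> g y = g x"
    using assms unfolding loc_const_on_def by blast+
  then show "\<forall>\<^sub>F y in nhds x. y \<in> X \<longrightarrow> h (f y) (g y) = h (f x) (g x)"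
    by eventually_elim auto
qed

lemma loc_const_on_const: "loc_const_on X (\<lambda>_. c)"
  by (simp add: loc_const_on_def)

lemma loc_const_on_compose: "loc_const_on X f \<Longrightarrow> loc_const_on X (\<lambda>x. h (f x))"
  using loc_const_on_compose2[of X f f "\<lambda>a b. h a"] by simp

lemma loc_const_on_family:
  assumes "finite I" "\<And>i. i \<in> I \<Longrightarrow> loc_const_on X (\<lambda>x. f x i)"
    and "\<And>x y. x \<in> X \<Longrightarrow> y \<in> X \<Longrightarrow> (\<And>i. i \<in> I \<Longrightarrow> f y i = f x i) \<Longrightarrow> g y = g x"
  shows "loc_const_on X g"
  unfolding loc_const_on_def
proof
  fix x assume x: "x \<in> X"
  have "\<forall>\<^sub>F y in nhds x. \<forall>i\<in>I. y \<in> X \<longrightarrow> f y i = f x i"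
    using assms x unfolding loc_const_on_def by (intro eventually_ball_finite) blast+
  then show "\<forall>\<^sub>F y in nhds x. y \<in> X \<longrightarrow> g y = g x"
    by eventually_elim (use assms(3) x in blast)
qed

lemma loc_const_on_continuous:
  fixes f :: "'a::topological_space \<Rightarrow> 'b::discrete_topology"
  assumes "continuous_on X f" shows "loc_const_on X f"
  unfolding loc_const_on_def
proof
  fix x assume "x \<in> X"
  then have "(f \<longlongrightarrow> f x) (at x within X)" using assms by (simp add: continuous_on_def)
  then have "\<forall>\<^sub>F y in at x within X. f y \<in> {f x}"
    by (rule topological_tendstoD) (auto simp: open_discrete)
  then show "\<forall>\<^sub>F y in nhds x. y \<in> X \<longrightarrow> f y = f x"
    unfolding eventually_at_filter by eventually_elim auto
qed

lemma loc_const_on_pullback: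
  assumes "loc_const_on X f" "continuous_on X T" "T ` X \<subseteq> X"
  shows "loc_const_on X (\<lambda>x. f (T x))"
  unfolding loc_const_on_def
proof
  fix x assume x: "x \<in> X"
  have "\<forall>\<^sub>F y in nhds (T x). y \<in> X \<longrightarrow> f y = f (T x)"
    using assms x unfolding loc_const_on_def by blast
  moreover have "(T \<longlongrightarrow> T x) (at x within X)" using assms x by (simp add: continuous_on_def)
  ultimately have "\<forall>\<^sub>F y in at x within X. T y \<in> X \<longrightarrow> f (T y) = f (T x)"
    unfolding filterlim_iff by blast
  then show "\<forall>\<^sub>F y in nhds x. y \<in> X \<longrightarrow> f (T y) = f (T x)"
    unfolding eventually_at_filter by eventually_elim (use assms(3) in auto)
qed

text \<open>Made for an observable defined by cases, where the case that applies is locally constant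
  at each point.\<close>

lemma continuous_on_locally_eq:
  fixes g :: "'a::t2_space \<Rightarrow> 'b::topological_space"
  assumes "\<And>x. x \<in> X \<Longrightarrow> \<exists>h. continuous_on X h \<and> (\<forall>\<^sub>F y in nhds x. y \<in> X \<longrightarrow> g y = h y)"
  shows "continuous_on X g"
  unfolding continuous_on_def
proof
  fix x assume x: "x \<in> X"
  then obtain h where h: "continuous_on X h" "\<forall>\<^sub>F y in nhds x. y \<in> X \<longrightarrow> g y = h y"
    using assms by blast
  have "g x = h x" using eventually_nhds_x_imp_x[OF h(2)] x by blast
  have "(h \<longlongrightarrow> h x) (at x within X)" using h(1) x by (simp add: continuous_on_def)
  moreover have "\<forall>\<^sub>F y in at x within X. h y = g y"
    unfolding eventually_at_filter using h(2) by eventually_elim auto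
  ultimately show "(g \<longlongrightarrow> g x) (at x within X)"
    unfolding \<open>g x = h x\<close> by (rule Lim_transform_eventually)
qed

section \<open>Construction of markers over the symbolic factor\<close>

locale symbolic_extension = nonempty_zk_system X T
  for X :: "'a::metric_space set" and T :: "('k::finite \<Rightarrow> int) \<Rightarrow> 'a \<Rightarrow> 'a" +
  fixes \<pi> :: "'a \<Rightarrow> ('k \<Rightarrow> int) \<Rightarrow> nat"
  assumes continuous_on_\<pi>: "continuous_on X \<pi>"
    and equivariant: "x \<in> X \<Longrightarrow> \<pi> (T a x) = zshift a (\<pi> x)"
    and free: "x \<in> X \<Longrightarrow> zshift a (\<pi> x) = \<pi> x \<Longrightarrow> a = (\<lambda>i. 0)"
begin

lemma T_zneg: "x \<in> X \<Longrightarrow> T (zneg a) (T a x) = x" "x \<in> X \<Longrightarrow> T a (T (zneg a) x) = x"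
  by (simp_all flip: T_zadd add: T_0)

lemma \<pi>_T_cong: "x \<in> X \<Longrightarrow> y \<in> X \<Longrightarrow> \<pi> x = \<pi> y \<Longrightarrow> \<pi> (T a x) = \<pi> (T a y)"
  by (simp add: equivariant)

lemma loc_const_on_T: "loc_const_on X f \<Longrightarrow> loc_const_on X (\<lambda>x. f (T a x))"
  by (rule loc_const_on_pullback[OF _ continuous_on_T]) (auto simp: T_in)

lemma loc_const_on_symbol: "loc_const_on X (\<lambda>x. \<pi> x n)"
  by (rule loc_const_on_continuous[OF continuous_on_product_then_coordinatewise[OF continuous_on_\<pi>]])

text \<open>By freeness, each \<open>a\<close> in \<open>A\<close> has a site where
  \<open>\<pi> x\<close> and its shift by \<open>a\<close> carry different symbols. The cylinder
  that fixes both symbols cannot contain a point together with its translate by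
  \<open>a\<close>.\<close>

lemma local_separation:
  assumes "finite A" "(\<lambda>i. 0) \<notin> A" "x \<in> X"
  shows "\<exists>P. loc_const_on X P \<and> P x \<and> (\<forall>y z. \<pi> y = \<pi> z \<longrightarrow> P y = P z)
    \<and> (\<forall>y\<in>X. \<forall>a\<in>A. P y \<longrightarrow> \<not> P (T a y))"
proof -
  have "\<exists>n. \<pi> x (zadd n a) \<noteq> \<pi> x n" if a: "a \<in> A" for a
  proof (rule ccontr)
    assume "\<not> ?thesis"
    then have "zshift a (\<pi> x) = \<pi> x" by (auto simp: zshift_def)
    then show False using free[OF assms(3)] a assms(2) by blast
  qed
  then obtain n where n: "\<And>a. a \<in> A \<Longrightarrow> \<pi> x (zadd (n a) a) \<noteq> \<pi> x (n a)" by metis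
  define P where "P y \<longleftrightarrow> (\<forall>a\<in>A. \<pi> y (n a) = \<pi> x (n a) \<and> \<pi> y (zadd (n a) a) = \<pi> x (zadd (n a) a))" for y
  show ?thesis
  proof (intro exI[of _ P] conjI allI ballI impI)
    show "loc_const_on X P"
      by (rule loc_const_on_family[OF assms(1), of _ "\<lambda>y a. (\<pi> y (n a), \<pi> y (zadd (n a) a))"])
        (auto simp: P_def intro!: loc_const_on_compose2[of _ _ _ Pair] loc_const_on_symbol)
    show "P x" by (simp add: P_def)
    show "P y = P z" if "\<pi> y = \<pi> z" for y z using that by (simp add: P_def)
    show "\<not> P (T a y)" if "y \<in> X" "a \<in> A" "P y" for y a
    proof
      assume "P (T a y)"
      then have "\<pi> (T a y) (n a) = \<pi> x (n a)" using that unfolding P_def by blast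
      then have "\<pi> y (zadd (n a) a) = \<pi> x (n a)" using that by (simp add: equivariant zshift_def)
      moreover have "\<pi> y (zadd (n a) a) = \<pi> x (zadd (n a) a)" using that unfolding P_def by blast
      ultimately show False using n[OF that(2)] by simp
    qed
  qed
qed

text \<open>By compactness finitely many of the separating cylinders cover \<open>X\<close>; the
  colour of a point is the index of the first one that contains it.\<close>

lemma proper_colouring:
  assumes "finite A" "(\<lambda>i. 0) \<notin> A"
  obtains c :: "'a \<Rightarrow> nat" and K where "loc_const_on X c" "\<And>x. x \<in> X \<Longrightarrow> c x < K"
    "\<And>x y. \<pi> x = \<pi> y \<Longrightarrow> c x = c y" "\<And>x a. x \<in> X \<Longrightarrow> a \<in> A \<Longrightarrow> c (T a x) \<noteq> c x"
proof -
  have "\<forall>x\<in>X. \<exists>P. loc_const_on X P \<and> P x \<and> (\<forall>y z. \<pi> y = \<pi> z \<longrightarrow> P y = P z)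
      \<and> (\<forall>y\<in>X. \<forall>a\<in>A. P y \<longrightarrow> \<not> P (T a y))"
    by (intro ballI local_separation[OF assms])
  from bchoice[OF this] obtain Q where Q': "\<forall>x\<in>X. loc_const_on X (Q x) \<and> Q x x
      \<and> (\<forall>y z. \<pi> y = \<pi> z \<longrightarrow> Q x y = Q x z) \<and> (\<forall>y\<in>X. \<forall>a\<in>A. Q x y \<longrightarrow> \<not> Q x (T a y))" ..
  have Q: "loc_const_on X (Q x)" "Q x x" "\<pi> y = \<pi> z \<Longrightarrow> Q x y = Q x z"
      "y \<in> X \<Longrightarrow> a \<in> A \<Longrightarrow> Q x y \<Longrightarrow> \<not> Q x (T a y)" if "x \<in> X" for x y z a
    using bspec[OF Q' that] by blast+
  have "\<exists>D\<subseteq>(\<lambda>x. {y\<in>X. Q x y}) ` X. finite D \<and> X \<subseteq> \<Union>D"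
  proof (rule compact_X[unfolded compact_eq_openin_cover, rule_format], intro conjI ballI)
    show "openin (top_of_set X) U" if "U \<in> (\<lambda>x. {y\<in>X. Q x y}) ` X" for U
      using that Q(1) loc_const_on_openin by auto
    show "X \<subseteq> (\<Union>x\<in>X. {y\<in>X. Q x y})" using Q(2) by auto
  qed
  then obtain D where D: "D \<subseteq> (\<lambda>x. {y\<in>X. Q x y}) ` X \<and> finite D \<and> X \<subseteq> \<Union>D" ..
  then have "\<exists>F\<subseteq>X. finite F \<and> D = (\<lambda>x. {y\<in>X. Q x y}) ` F"
    by (intro finite_subset_image) simp_all
  then obtain F where F': "F \<subseteq> X \<and> finite F \<and> D = (\<lambda>x. {y\<in>X. Q x y}) ` F" ..
  then have F: "F \<subseteq> X" "finite F" "X \<subseteq> (\<Union>x\<in>F. {y\<in>X. Q x y})" using D by simp_all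
  obtain xs where xs: "set xs = F" using finite_list[OF F(2)] by blast
  define c where "c y = length (takeWhile (\<lambda>x. \<not> Q x y) xs)" for y
  have hit: "c y < length xs \<and> Q (xs ! c y) y" if y: "y \<in> X" for y
  proof -
    have "\<exists>x\<in>set xs. Q x y" using F(3) y xs by blast
    then have "c y < length xs" unfolding c_def by (induction xs) auto
    then show ?thesis using nth_length_takeWhile[of "\<lambda>x. \<not> Q x y" xs] unfolding c_def by simp
  qed
  have xsX: "xs ! i \<in> X" if "i < length xs" for i using that xs F(1) nth_mem by blast
  have congc: "c y = c z" if "\<And>x. x \<in> F \<Longrightarrow> Q x y = Q x z" for y z
  proof -
    have "takeWhile (\<lambda>x. \<not> Q x y) xs = takeWhile (\<lambda>x. \<not> Q x z) xs"
      by (rule takeWhile_cong) (simp_all add: that xs)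
    then show ?thesis by (simp add: c_def)
  qed
  show ?thesis
  proof (rule that)
    show "loc_const_on X c"
    proof (rule loc_const_on_family[OF F(2), where f = "\<lambda>y x. Q x y"])
      show "loc_const_on X (\<lambda>y. Q x y)" if "x \<in> F" for x using Q(1) F(1) that by (simp add: subsetD)
      show "c y = c x" if "\<And>i. i \<in> F \<Longrightarrow> Q i y = Q i x" for x y using that by (rule congc)
    qed
    show "c x < length xs" if "x \<in> X" for x using hit that by blast
    show "c x = c y" if "\<pi> x = \<pi> y" for x y
      by (rule congc, rule Q(3)) (use F(1) that in auto)
    show "c (T a x) \<noteq> c x" if "x \<in> X" "a \<in> A" for x a
    proof
      assume eq: "c (T a x) = c x"
      have h: "c x < length xs" "Q (xs ! c x) x" using hit[OF that(1)] by simp_all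
      have "Q (xs ! c x) (T a x)" using hit[OF T_in[OF that(1)], of a] eq by simp
      then show False using Q(4)[OF xsX[OF h(1)] that h(2)] by simp
    qed
  qed
qed

text \<open>Points are accepted greedily in the order of their colours.\<close>

lemma ex_markers:
  fixes N :: nat
  obtains mk where "loc_const_on X mk" "\<And>x y. x \<in> X \<Longrightarrow> y \<in> X \<Longrightarrow> \<pi> x = \<pi> y \<Longrightarrow> mk x = mk y"
    "\<And>x a. x \<in> X \<Longrightarrow> mk x \<Longrightarrow> mk (T a x) \<Longrightarrow> a \<in> cbx N \<Longrightarrow> a = (\<lambda>i. 0)"
    "\<And>x. x \<in> X \<Longrightarrow> \<exists>a\<in>cbx N. mk (T a x)"
proof -
  define A where "A = (cbx N - {\<lambda>i. 0} :: ('k \<Rightarrow> int) set)"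
  have fA: "finite A" and A0: "(\<lambda>i. 0) \<notin> A" by (simp_all add: A_def finite_cbx)
  obtain c :: "'a \<Rightarrow> nat" and K where c: "loc_const_on X c" "\<And>x. x \<in> X \<Longrightarrow> c x < K"
    "\<And>x y. \<pi> x = \<pi> y \<Longrightarrow> c x = c y" "\<And>x a. x \<in> X \<Longrightarrow> a \<in> A \<Longrightarrow> c (T a x) \<noteq> c x"
    by (rule proper_colouring[OF fA A0]) (rule that; assumption)
  \<comment> \<open>\<open>M i\<close> holds at the points accepted among the colours below
    \<open>i\<close>. A colour class is processed at once, because no two of its points are in
    conflict.\<close>
  define M where "M = rec_nat (\<lambda>_. False) (\<lambda>i P x. P x \<or> c x = i \<and> (\<forall>a\<in>A. \<not> P (T a x)))"
  have M0: "M 0 x = False" and MS: "M (Suc i) x \<longleftrightarrow> M i x \<or> c x = i \<and> (\<forall>a\<in>A. \<not> M i (T a x))" for i x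
    by (simp_all add: M_def)
  have lc: "loc_const_on X (M i)" for i
  proof (induction i)
    case (Suc i)
    have "loc_const_on X (\<lambda>x. \<forall>a\<in>A. \<not> M i (T a x))"
      by (rule loc_const_on_family[OF fA, of _ "\<lambda>x a. M i (T a x)"]) (auto intro: loc_const_on_T Suc)
    then have "loc_const_on X (\<lambda>x. M i x \<or> c x = i \<and> (\<forall>a\<in>A. \<not> M i (T a x)))"
      by (intro loc_const_on_compose2[of _ _ _ "(\<or>)"] loc_const_on_compose2[of _ _ _ "(\<and>)"] Suc
          loc_const_on_compose[OF c(1)])
    then show ?case unfolding MS[abs_def] .
  qed (simp add: M0[abs_def] loc_const_on_const)
  have inv: "M i x = M i y" if "x \<in> X" "y \<in> X" "\<pi> x = \<pi> y" for i x y
    using that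
  proof (induction i arbitrary: x y)
    case (Suc i)
    have "M i (T a x) = M i (T a y)" for a
      by (rule Suc.IH[OF T_in[OF Suc.prems(1)] T_in[OF Suc.prems(2)] \<pi>_T_cong[OF Suc.prems]])
    then show ?case unfolding MS Suc.IH[OF Suc.prems] c(3)[OF Suc.prems(3)] by simp
  qed (simp only: M0)
  have sep: "\<not> M i (T a x)" if "x \<in> X" "M i x" "a \<in> A" for i x a
    using that
  proof (induction i arbitrary: x a)
    case (Suc i)
    \<comment> \<open>Conflict is symmetric: if \<open>x\<close> was accepted earlier, then
      \<open>T a x\<close> sees it as its neighbour at \<open>zneg a\<close>.\<close>
    have a': "zneg a \<in> A" using Suc.prems(3) by (auto simp: A_def)
    have "\<not> M i (T a x)"
    proof (cases "M i x")
      case False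
      then show ?thesis using Suc.prems MS by blast
    qed (use Suc in blast)
    moreover have "\<not> (c (T a x) = i \<and> (\<forall>b\<in>A. \<not> M i (T b (T a x))))"
    proof (cases "M i x")
      case True
      then show ?thesis using a' T_zneg(1)[OF Suc.prems(1)] by metis
    next
      case False
      then have "c x = i" using Suc.prems MS by blast
      then show ?thesis using c(4)[OF Suc.prems(1,3)] by simp
    qed
    ultimately show ?case unfolding MS by blast
  qed (simp add: M0)
  have mono: "M i x \<Longrightarrow> i \<le> j \<Longrightarrow> M j x" for i j x
    by (induction j rule: nat_induct) (auto simp: MS le_Suc_eq)
  show ?thesis
  proof (rule that)
    show "loc_const_on X (M K)" by (rule lc)
    show "M K x = M K y" if "x \<in> X" "y \<in> X" "\<pi> x = \<pi> y" for x y using that by (rule inv)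
    show "a = (\<lambda>i. 0)" if "x \<in> X" "M K x" "M K (T a x)" "a \<in> cbx N" for x a
      using sep[OF that(1,2), of a] that by (auto simp: A_def)
    show "\<exists>a\<in>cbx N. M K (T a x)" if x: "x \<in> X" for x
    \<comment> \<open>A point without accepted neighbours when its colour comes up is accepted
      itself.\<close>
    proof (cases "\<forall>a\<in>A. \<not> M (c x) (T a x)")
      case True
      then have "M (Suc (c x)) x" unfolding MS by simp
      then have "M K (T (\<lambda>i. 0) x)" using mono c(2)[OF x] T_0[OF x] by (metis Suc_leI)
      moreover have "(\<lambda>i. 0) \<in> cbx N" by (simp add: cbx_def)
      ultimately show ?thesis by blast
    next
      case False
      then obtain a where "a \<in> A" "M (c x) (T a x)" by blast
      then show ?thesis using mono c(2)[OF x] unfolding A_def by (metis DiffD1 less_imp_le)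
    qed
  qed
qed

end

section \<open>Voronoi tiles of lattice point sets\<close>

definition isq :: "('k::finite \<Rightarrow> int) \<Rightarrow> int" where "isq n = (\<Sum>i\<in>UNIV. (n i)\<^sup>2)"

definition syndetic :: "nat \<Rightarrow> ('k \<Rightarrow> int) set \<Rightarrow> bool" where
  "syndetic N P \<longleftrightarrow> (\<forall>n. \<exists>q\<in>P. zdiff q n \<in> cbx N)"

definition closest :: "('k::finite \<Rightarrow> int) set \<Rightarrow> ('k \<Rightarrow> int) \<Rightarrow> ('k \<Rightarrow> int) \<Rightarrow> bool" where
  "closest P n p \<longleftrightarrow> p \<in> P \<and> (\<forall>r\<in>P. isq (zdiff p n) \<le> isq (zdiff r n))"

definition strictly_closest :: "('k::finite \<Rightarrow> int) set \<Rightarrow> ('k \<Rightarrow> int) \<Rightarrow> ('k \<Rightarrow> int) \<Rightarrow> bool" where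
  "strictly_closest P n p \<longleftrightarrow> p \<in> P \<and> (\<forall>r\<in>P. r \<noteq> p \<longrightarrow> isq (zdiff p n) < isq (zdiff r n))"

definition open_tile :: "('k::finite \<Rightarrow> int) set \<Rightarrow> ('k \<Rightarrow> int) set" where
  "open_tile P = {n. strictly_closest P n (\<lambda>i. 0)}"

definition closed_tile :: "('k::finite \<Rightarrow> int) set \<Rightarrow> ('k \<Rightarrow> int) set" where
  "closed_tile P = {n. closest P n (\<lambda>i. 0)}"

lemma isq_nonneg: "isq n \<ge> 0"
  unfolding isq_def by (rule sum_nonneg) simp

lemma isq_le:
  fixes a :: "'k::finite \<Rightarrow> int"
  assumes "a \<in> cbx R"
  shows "isq a \<le> int CARD('k) * R\<^sup>2"
proof -
  have "isq a \<le> (\<Sum>i\<in>(UNIV :: 'k set). R\<^sup>2)"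
    unfolding isq_def using assms by (intro sum_mono) (auto simp: cbx_def abs_le_square_iff[symmetric] intro: order_trans)
  then show ?thesis by simp
qed

lemma isq_gt:
  assumes "a \<notin> cbx R" "R \<ge> 0"
  shows "R\<^sup>2 < isq a"
proof -
  obtain i where "\<bar>a i\<bar> > R" using assms(1) by (auto simp: cbx_def not_le)
  then have "R\<^sup>2 < \<bar>a i\<bar>\<^sup>2" using assms(2) by (intro power_strict_mono) auto
  also have "\<dots> \<le> isq a" unfolding isq_def using member_le_sum[of i UNIV "\<lambda>i. (a i)\<^sup>2"] by simp
  finally show ?thesis .
qed

text \<open>The sup norm and the Euclidean norm differ by a factor of at most the square root of
  \<open>CARD('k)\<close>; the cruder factor \<open>CARD('k)\<close> keeps the radius an
  integer.\<close>

lemma isq_outside: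
  fixes a b :: "'k::finite \<Rightarrow> int"
  assumes "a \<notin> cbx (int CARD('k) * R)" "b \<in> cbx R" "R \<ge> 0"
  shows "isq b < isq a"
proof -
  have "isq b \<le> int CARD('k) * R\<^sup>2" by (rule isq_le[OF assms(2)])
  also have "\<dots> \<le> (int CARD('k) * R)\<^sup>2"
  proof -
    have "int CARD('k) * R\<^sup>2 * 1 \<le> int CARD('k) * R\<^sup>2 * int CARD('k)"
      by (intro mult_left_mono) (auto simp: Suc_leI)
    then show ?thesis by (simp add: power2_eq_square ac_simps)
  qed
  also have "\<dots> < isq a" using assms by (intro isq_gt) auto
  finally show ?thesis .
qed

lemma strictly_closest_imp_closest: "strictly_closest P n p \<Longrightarrow> closest P n p"
  unfolding strictly_closest_def closest_def by (metis less_imp_le order_refl)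

lemma strictly_closest_unique: "strictly_closest P n p \<Longrightarrow> strictly_closest P n q \<Longrightarrow> p = q"
  unfolding strictly_closest_def by (metis less_asym)

lemma ex_closest:
  assumes "syndetic N P" obtains p where "closest P n p"
proof -
  obtain q where "q \<in> P" using assms unfolding syndetic_def by blast
  then obtain p where p: "p \<in> P" "\<And>r. r \<in> P \<Longrightarrow> nat (isq (zdiff p n)) \<le> nat (isq (zdiff r n))"
    using ex_has_least_nat[of "\<lambda>p. p \<in> P" q "\<lambda>p. nat (isq (zdiff p n))"] by blast
  then have "closest P n p" unfolding closest_def by (simp add: isq_nonneg nat_le_eq_zle)
  then show ?thesis by (rule that)
qed

lemma closest_near:
  fixes p :: "'k::finite \<Rightarrow> int"
  assumes "syndetic N P" "closest P n p"
  shows "zdiff p n \<in> cbx (int CARD('k) * int N)"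
proof (rule ccontr)
  assume "zdiff p n \<notin> cbx (int CARD('k) * int N)"
  moreover obtain q where "q \<in> P" "zdiff q n \<in> cbx N" using assms(1) unfolding syndetic_def by blast
  ultimately show False using isq_outside[of "zdiff p n" N "zdiff q n"] assms(2)
    unfolding closest_def by (auto simp: not_le[symmetric])
qed

text \<open>Some point of \<open>P\<close> lies within \<open>N\<close> of \<open>n\<close>, and
  everything outside the window of radius \<open>CARD('k) * N\<close> is farther away than that. So
  only the window decides.\<close>

lemma closest_local:
  fixes p :: "'k::finite \<Rightarrow> int"
  assumes "syndetic N P" "\<And>r. zdiff r n \<in> cbx (int CARD('k) * int N) \<Longrightarrow> r \<in> P \<longleftrightarrow> r \<in> P'"
  shows "closest P n p \<Longrightarrow> closest P' n p" "strictly_closest P n p \<Longrightarrow> strictly_closest P' n p"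
proof -
  have far: "isq (zdiff p n) < isq (zdiff r n)"
    if "closest P n p" "zdiff r n \<notin> cbx (int CARD('k) * int N)" for r
  proof -
    obtain q where q: "q \<in> P" "zdiff q n \<in> cbx N" using assms(1) unfolding syndetic_def by blast
    have "isq (zdiff p n) \<le> isq (zdiff q n)" using that q unfolding closest_def by blast
    also have "\<dots> < isq (zdiff r n)" using isq_outside[OF that(2) q(2)] by simp
    finally show ?thesis .
  qed
  show "closest P' n p" if c: "closest P n p"
    unfolding closest_def
  proof (intro conjI ballI)
    show "p \<in> P'" using closest_near[OF assms(1) c] c assms(2) unfolding closest_def by blast
    fix r assume "r \<in> P'"
    then show "isq (zdiff p n) \<le> isq (zdiff r n)"
      using far[OF c, of r] c assms(2)[of r] unfolding closest_def by (meson less_imp_le)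
  qed
  show "strictly_closest P' n p" if s: "strictly_closest P n p"
    unfolding strictly_closest_def
  proof (intro conjI ballI impI)
    note c = strictly_closest_imp_closest[OF s]
    show "p \<in> P'" using closest_near[OF assms(1) c] c assms(2) unfolding closest_def by blast
    fix r assume "r \<in> P'" "r \<noteq> p"
    then show "isq (zdiff p n) < isq (zdiff r n)"
      using far[OF c, of r] s assms(2)[of r] unfolding strictly_closest_def by blast
  qed
qed

lemma closed_tile_subset:
  assumes "syndetic N P"
  shows "closed_tile P \<subseteq> (cbx (int CARD('k) * int N) :: ('k::finite \<Rightarrow> int) set)"
proof
  fix n :: "'k \<Rightarrow> int" assume "n \<in> closed_tile P"
  then have "zdiff (\<lambda>i. 0) n \<in> cbx (int CARD('k) * int N)"
    unfolding closed_tile_def using closest_near[OF assms] by blast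
  then show "n \<in> cbx (int CARD('k) * int N)" by (simp add: cbx_def zdiff_def)
qed

lemma finite_closed_tile: "syndetic N P \<Longrightarrow> finite (closed_tile P)"
  using closed_tile_subset finite_cbx finite_subset by metis

lemma open_tile_subset: "open_tile P \<subseteq> closed_tile P"
  unfolding open_tile_def closed_tile_def using strictly_closest_imp_closest by blast

lemma finite_open_tile: "syndetic N P \<Longrightarrow> finite (open_tile P)"
  using open_tile_subset finite_closed_tile finite_subset by metis

text \<open>Sites of the tile lie within \<open>CARD('k) * N\<close> of the origin, and the points
  that compete for such a site lie within the same distance of it; hence the doubled radius.\<close>

lemma tile_local_aux:
  fixes P P' :: "('k::finite \<Rightarrow> int) set"
  assumes "syndetic N P" "P \<inter> cbx (2 * (int CARD('k) * int N)) = P' \<inter> cbx (2 * (int CARD('k) * int N))"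
  shows "closed_tile P \<subseteq> closed_tile P'" "open_tile P \<subseteq> open_tile P'"
proof -
  have agree: "r \<in> P \<longleftrightarrow> r \<in> P'"
    if "n \<in> closed_tile P" "zdiff r n \<in> cbx (int CARD('k) * int N)" for n r
  proof -
    have n: "n \<in> cbx (int CARD('k) * int N)" using closed_tile_subset[OF assms(1)] that(1) by blast
    have "\<bar>r i\<bar> \<le> 2 * (int CARD('k) * int N)" for i
    proof -
      have "\<bar>n i\<bar> \<le> int CARD('k) * int N" "\<bar>r i - n i\<bar> \<le> int CARD('k) * int N"
        using n that(2) by (auto simp: cbx_def zdiff_def)
      then show ?thesis by linarith
    qed
    then have "r \<in> cbx (2 * (int CARD('k) * int N))" by (simp add: cbx_def)
    then show ?thesis using assms(2) by blast
  qed
  show "closed_tile P \<subseteq> closed_tile P'"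
  proof
    fix n assume n: "n \<in> closed_tile P"
    then show "n \<in> closed_tile P'"
      using closest_local(1)[OF assms(1) agree[OF n]] by (simp add: closed_tile_def)
  qed
  show "open_tile P \<subseteq> open_tile P'"
  proof
    fix n assume n: "n \<in> open_tile P"
    then have "n \<in> closed_tile P" using open_tile_subset by blast
    then show "n \<in> open_tile P'"
      using closest_local(2)[OF assms(1) agree] n by (simp add: open_tile_def)
  qed
qed

lemma tile_local:
  fixes P P' :: "('k::finite \<Rightarrow> int) set"
  assumes "syndetic N P" "syndetic N P'"
    "P \<inter> cbx (2 * (int CARD('k) * int N)) = P' \<inter> cbx (2 * (int CARD('k) * int N))"
  shows "closed_tile P = closed_tile P'" "open_tile P = open_tile P'"
  using tile_local_aux[OF assms(1,3)] tile_local_aux[OF assms(2) assms(3)[symmetric]] by blast+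

text \<open>Comparing the volume of the Voronoi cell with slightly larger and smaller homothetic copies
  bounds the number of lattice cubes needed to cover the closed tile by the size of the open tile.\<close>

definition zvec :: "('k::finite \<Rightarrow> int) \<Rightarrow> real ^ 'k" where "zvec n = (\<chi> i. real_of_int (n i))"

lemma zvec_nth [simp]: "zvec n $ i = real_of_int (n i)"
  by (simp add: zvec_def)

lemma norm_zvec_power2: "(norm (zvec n))\<^sup>2 = real_of_int (isq n)"
  unfolding power2_norm_eq_inner by (simp add: inner_vec_def isq_def power2_eq_square)

text \<open>The Voronoi cell of the origin in real space. The inequality is
  \<open>norm u \<le> norm (u - zvec q)\<close>, squared and expanded; being linear in
  \<open>u\<close>, it shows how the cell scales.\<close>

definition zcell :: "('k::finite \<Rightarrow> int) set \<Rightarrow> (real ^ 'k) set" where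
  "zcell P = {u. \<forall>q\<in>P. 2 * (u \<bullet> zvec q) \<le> (norm (zvec q))\<^sup>2}"

lemma isq_zdiff: "real_of_int (isq (zdiff q n)) = (norm (zvec q))\<^sup>2 - 2 * (zvec n \<bullet> zvec q) + real_of_int (isq n)"
  unfolding norm_zvec_power2
  by (simp add: inner_vec_def isq_def zdiff_def power2_diff sum.distrib sum_subtractf sum_distrib_left algebra_simps)

lemma isq_zdiff_0: "isq (zdiff (\<lambda>i. 0) n) = isq n"
  by (simp add: isq_def zdiff_def)

lemma closed_tile_iff: "n \<in> closed_tile P \<longleftrightarrow> (\<lambda>i. 0) \<in> P \<and> zvec n \<in> zcell P"
proof -
  have "isq n \<le> isq (zdiff q n) \<longleftrightarrow> 2 * (zvec n \<bullet> zvec q) \<le> (norm (zvec q))\<^sup>2" for q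
    using isq_zdiff[of q n] by (simp only: of_int_le_iff[where ?'a = real, symmetric]) linarith
  then show ?thesis by (simp add: closed_tile_def closest_def zcell_def isq_zdiff_0)
qed

lemma open_tile_iff:
  "n \<in> open_tile P \<longleftrightarrow> (\<lambda>i. 0) \<in> P \<and> (\<forall>q\<in>P. q \<noteq> (\<lambda>i. 0) \<longrightarrow> 2 * (zvec n \<bullet> zvec q) < (norm (zvec q))\<^sup>2)"
proof -
  have "isq n < isq (zdiff q n) \<longleftrightarrow> 2 * (zvec n \<bullet> zvec q) < (norm (zvec q))\<^sup>2" for q
    using isq_zdiff[of q n] by (simp only: of_int_less_iff[where ?'a = real, symmetric]) linarith
  then show ?thesis by (simp add: open_tile_def strictly_closest_def isq_zdiff_0)
qed

lemma norm_vec_le: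
  fixes u :: "real ^ 'k"
  assumes "\<And>i. \<bar>u $ i\<bar> \<le> R" shows "norm u \<le> real CARD('k) * R"
proof -
  have "norm u \<le> (\<Sum>i\<in>UNIV. \<bar>u $ i\<bar>)" by (rule norm_le_l1_cart)
  also have "\<dots> \<le> (\<Sum>i\<in>(UNIV :: 'k set). R)" by (intro sum_mono assms)
  finally show ?thesis by simp
qed

lemma inner_le_norm_diff:
  fixes u v q :: "real ^ 'k"
  assumes "\<And>i. \<bar>(u - v) $ i\<bar> \<le> R" shows "u \<bullet> q \<le> v \<bullet> q + real CARD('k) * R * norm q"
proof -
  have "(u - v) \<bullet> q \<le> norm (u - v) * norm q" by (rule norm_cauchy_schwarz)
  also have "\<dots> \<le> real CARD('k) * R * norm q" using assms by (intro mult_right_mono norm_vec_le) auto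
  finally show ?thesis by (simp add: inner_diff_left)
qed

lemma compact_zcell:
  fixes P :: "('k::finite \<Rightarrow> int) set"
  assumes "syndetic N P" shows "compact (zcell P)"
  unfolding compact_eq_bounded_closed
proof
  have "zcell P = (\<Inter>q\<in>P. {u. 2 * (u \<bullet> zvec q) \<le> (norm (zvec q))\<^sup>2})" unfolding zcell_def by auto
  then show "closed (zcell P)"
    by (auto intro!: closed_INT closed_Collect_le continuous_intros)
  have "norm u \<le> real CARD('k) * (real N + 1)" if u: "u \<in> zcell P" for u
  proof -
    \<comment> \<open>Some \<open>q\<close> in \<open>P\<close> is near the integer part of
      \<open>u\<close>. As \<open>u\<close> is no farther from 0 than from \<open>q\<close>, this
      bounds its norm.\<close>
    define n where "n = (\<lambda>i. \<lfloor>u $ i\<rfloor>)"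
    obtain q where q: "q \<in> P" "zdiff q n \<in> cbx N" using assms unfolding syndetic_def by blast
    have "2 * (u \<bullet> zvec q) \<le> (norm (zvec q))\<^sup>2" using u q(1) unfolding zcell_def by blast
    then have "(norm u)\<^sup>2 \<le> (norm (u - zvec q))\<^sup>2"
      by (simp add: power2_norm_eq_inner inner_diff_left inner_diff_right inner_commute)
    then have "norm u \<le> norm (u - zvec q)" by (rule power2_le_imp_le) simp
    also have "\<dots> \<le> real CARD('k) * (real N + 1)"
    proof (rule norm_vec_le)
      fix i
      have "\<bar>q i - n i\<bar> \<le> int N" using q(2) by (simp add: cbx_def zdiff_def)
      then have "\<bar>real_of_int (q i) - real_of_int (n i)\<bar> \<le> real N" by linarith
      moreover have "real_of_int (n i) \<le> u $ i" "u $ i < real_of_int (n i) + 1"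
        unfolding n_def by linarith+
      ultimately show "\<bar>(u - zvec q) $ i\<bar> \<le> real N + 1" by simp
    qed
    finally show ?thesis .
  qed
  then show "bounded (zcell P)" unfolding bounded_iff by blast
qed

lemma measure_zbox:
  fixes a :: "'k::finite \<Rightarrow> int"
  shows "measure lebesgue (box (zvec a) (zvec (\<lambda>i. a i + int M))) = real M ^ CARD('k)"
    and "measure lebesgue (cbox (zvec a) (zvec (\<lambda>i. a i + int M))) = real M ^ CARD('k)"
proof -
  have ne: "cbox (zvec a) (zvec (\<lambda>i. a i + int M)) \<noteq> {}"
    by (auto simp: interval_ne_empty_cart)
  have "measure lborel (cbox (zvec a) (zvec (\<lambda>i. a i + int M))) = real M ^ CARD('k)"
    using content_cbox_cart[OF ne] by simp
  moreover have "measure lborel (box (zvec a) (zvec (\<lambda>i. a i + int M)))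
      = measure lborel (cbox (zvec a) (zvec (\<lambda>i. a i + int M)))"
    by (simp add: measure_lborel_box_eq measure_lborel_cbox_eq)
  ultimately show "measure lebesgue (box (zvec a) (zvec (\<lambda>i. a i + int M))) = real M ^ CARD('k)"
    "measure lebesgue (cbox (zvec a) (zvec (\<lambda>i. a i + int M))) = real M ^ CARD('k)"
    by (simp_all add: measure_completion)
qed

text \<open>The lower corner of the cube containing \<open>n\<close> in the grid of mesh
  \<open>M\<close>. The image of a tile under this map thus counts the grid cubes that meet
  it.\<close>

definition corner :: "nat \<Rightarrow> ('k \<Rightarrow> int) \<Rightarrow> ('k \<Rightarrow> int)" where
  "corner M n = (\<lambda>i. int M * (n i div int M))"

lemma corner_bounds:
  assumes "M > 0" shows "corner M n i \<le> n i" "n i < corner M n i + int M"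
  using assms pos_mod_bound[of "int M" "n i"] pos_mod_sign[of "int M" "n i"] mult_div_mod_eq[of "int M" "n i"]
  unfolding corner_def by linarith+

lemma zcell_scale_iff:
  fixes P :: "('k::finite \<Rightarrow> int) set"
  assumes "s > 0"
  shows "(*\<^sub>R) s ` zcell P = {u. \<forall>q\<in>P. 2 * (u \<bullet> zvec q) \<le> s * (norm (zvec q))\<^sup>2}"
proof (intro set_eqI iffI)
  fix u assume "u \<in> {u. \<forall>q\<in>P. 2 * (u \<bullet> zvec q) \<le> s * (norm (zvec q))\<^sup>2}"
  then have "(1 / s) *\<^sub>R u \<in> zcell P" using assms by (auto simp: zcell_def field_simps)
  then have "s *\<^sub>R ((1 / s) *\<^sub>R u) \<in> (*\<^sub>R) s ` zcell P" by blast
  then show "u \<in> (*\<^sub>R) s ` zcell P" using assms by simp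
qed (use assms in \<open>auto simp: zcell_def mult.left_commute[of 2]\<close>)

lemma measure_zcell_scale:
  fixes P :: "('k::finite \<Rightarrow> int) set"
  assumes "s > 0"
  shows "measure lebesgue ((*\<^sub>R) s ` zcell P) = s ^ CARD('k) * measure lebesgue (zcell P)"
  using measure_lebesgue_affine[of s 0 "zcell P"] assms by simp

lemma compact_zcell_scale: "syndetic N P \<Longrightarrow> compact ((*\<^sub>R) s ` zcell P)"
  by (intro compact_scaling compact_zcell)

lemma norm_zvec_gt:
  assumes "q \<notin> cbx N" shows "real N < norm (zvec q)"
proof -
  have "(real N)\<^sup>2 < (norm (zvec q))\<^sup>2"
    using isq_gt[OF assms] unfolding norm_zvec_power2 by (metis of_int_less_iff of_int_of_nat_eq of_int_power of_nat_0_le_iff)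
  then show ?thesis by (rule power2_less_imp_less) simp
qed

text \<open>Write k for the dimension. A point of such a cube differs from a site of the tile by at
  most \<open>M\<close> in each coordinate, which changes the inner product with \<open>q\<close> by
  at most k M |q|. Since |q| > N for nonzero \<open>q\<close>, this is at most (k M / N) |q|^2, so
  the cube lies in the cell enlarged by the factor 1 + 2 k M / N.\<close>

lemma cubes_le_volume:
  fixes P :: "('k::finite \<Rightarrow> int) set"
  assumes P: "syndetic N P" "\<And>q. q \<in> P \<Longrightarrow> q \<in> cbx N \<Longrightarrow> q = (\<lambda>i. 0)" and "M > 0" "N > 0"
  shows "real (card (corner M ` closed_tile P)) * real M ^ CARD('k)
    \<le> (1 + 2 * real CARD('k) * real M / real N) ^ CARD('k) * measure lebesgue (zcell P)"
proof -
  let ?A = "corner M ` closed_tile P" and ?s = "1 + 2 * real CARD('k) * real M / real N"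
  \<comment> \<open>Open cubes, because distinct open cubes of the grid are disjoint and their
    volumes add up.\<close>
  let ?Q = "\<lambda>a :: 'k \<Rightarrow> int. box (zvec a) (zvec (\<lambda>i. a i + int M))"
  have "?s > 0" by (simp add: add_pos_nonneg)
  have finA: "finite ?A" using finite_closed_tile[OF P(1)] by simp
  have disj: "a = b" if ab: "a \<in> ?A" "b \<in> ?A" and x: "x \<in> ?Q a" "x \<in> ?Q b" for a b x
  proof
    fix i
    obtain m n where mn: "a = corner M m" "b = corner M n" using ab by blast
    have "real_of_int (a i) < x $ i" "x $ i < real_of_int (a i + int M)"
      "real_of_int (b i) < x $ i" "x $ i < real_of_int (b i + int M)"
      using x by (auto simp: mem_box_cart)
    then have "a i < b i + int M" "b i < a i + int M" by linarith+
    then have "int M * (m i div int M) < int M * (n i div int M + 1)"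
      "int M * (n i div int M) < int M * (m i div int M + 1)"
      unfolding mn corner_def by (simp_all add: distrib_left)
    then have "m i div int M = n i div int M" using assms(3) by simp
    then show "a i = b i" unfolding mn corner_def by simp
  qed
  have "measure lebesgue (\<Union>a\<in>?A. ?Q a) = (\<Sum>a\<in>?A. measure lebesgue (?Q a))"
  proof (rule measure_finite_Union[OF finA])
    show "disjoint_family_on ?Q ?A" unfolding disjoint_family_on_def using disj by blast
    show "emeasure lebesgue (?Q a) \<noteq> \<infinity>" for a using fmeasurableD2[OF lmeasurable_box] by simp
  qed auto
  also have "\<dots> = real (card ?A) * real M ^ CARD('k)" by (simp add: measure_zbox)
  finally have "real (card ?A) * real M ^ CARD('k) = measure lebesgue (\<Union>a\<in>?A. ?Q a)" by simp
  also have "\<dots> \<le> measure lebesgue ((*\<^sub>R) ?s ` zcell P)"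
  proof (rule measure_mono_fmeasurable)
    show "(*\<^sub>R) ?s ` zcell P \<in> lmeasurable" by (intro lmeasurable_compact compact_zcell_scale[OF P(1)])
    show "(\<Union>a\<in>?A. ?Q a) \<in> sets lebesgue" using finA by (intro sets.finite_UN) auto
    show "(\<Union>a\<in>?A. ?Q a) \<subseteq> (*\<^sub>R) ?s ` zcell P"
    proof
      fix x assume "x \<in> (\<Union>a\<in>?A. ?Q a)"
      then obtain n where n: "n \<in> closed_tile P" "x \<in> ?Q (corner M n)" by blast
      have near: "\<bar>(x - zvec n) $ i\<bar> \<le> real M" for i
      proof -
        have "real_of_int (corner M n i) < x $ i" "x $ i < real_of_int (corner M n i + int M)"
          using n(2) by (auto simp: mem_box_cart)
        then show ?thesis using corner_bounds[OF assms(3), of n i] by simp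
      qed
      show "x \<in> (*\<^sub>R) ?s ` zcell P"
        unfolding zcell_scale_iff[OF \<open>?s > 0\<close>]
      proof (intro CollectI ballI)
        fix q assume q: "q \<in> P"
        show "2 * (x \<bullet> zvec q) \<le> ?s * (norm (zvec q))\<^sup>2"
        proof (cases "q = (\<lambda>i. 0)")
          case True
          then have "zvec q = 0" by (simp add: vec_eq_iff)
          then show ?thesis by simp
        next
          case False
          then have "real N < norm (zvec q)" using P(2)[OF q] norm_zvec_gt by blast
          then have "norm (zvec q) * real N \<le> (norm (zvec q))\<^sup>2"
            unfolding power2_eq_square by (intro mult_left_mono) auto
          then have "norm (zvec q) \<le> (norm (zvec q))\<^sup>2 / real N" using assms(4) by (simp add: field_simps)
          then have "real CARD('k) * real M * norm (zvec q) \<le> real CARD('k) * real M * ((norm (zvec q))\<^sup>2 / real N)"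
            by (intro mult_left_mono) auto
          moreover have "2 * (zvec n \<bullet> zvec q) \<le> (norm (zvec q))\<^sup>2"
            using n(1) q unfolding closed_tile_iff zcell_def by blast
          moreover have "x \<bullet> zvec q \<le> zvec n \<bullet> zvec q + real CARD('k) * real M * norm (zvec q)"
            by (rule inner_le_norm_diff[OF near])
          moreover have "?s * (norm (zvec q))\<^sup>2
              = (norm (zvec q))\<^sup>2 + 2 * (real CARD('k) * real M * ((norm (zvec q))\<^sup>2 / real N))"
            by (simp add: distrib_right)
          ultimately show ?thesis by linarith
        qed
      qed
    qed
  qed
  also have "\<dots> = ?s ^ CARD('k) * measure lebesgue (zcell P)" by (rule measure_zcell_scale[OF \<open>?s > 0\<close>])
  finally show ?thesis .
qed

text \<open>Rounding down a point of the cell shrunk by 1 - 2 k / N, where k is the dimension,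
  changes the inner product with a nonzero \<open>q\<close> by at most k |q| < (k / N) |q|^2. The
  inequalities of the cell then hold strictly, so the unit cubes at sites of the open tile cover the
  shrunk cell.\<close>

lemma volume_le_open_tile:
  fixes P :: "('k::finite \<Rightarrow> int) set"
  assumes P: "syndetic N P" "\<And>q. q \<in> P \<Longrightarrow> q \<in> cbx N \<Longrightarrow> q = (\<lambda>i. 0)" "(\<lambda>i. 0) \<in> P"
    and N: "2 * CARD('k) < N"
  shows "(1 - 2 * real CARD('k) / real N) ^ CARD('k) * measure lebesgue (zcell P) \<le> real (card (open_tile P))"
proof -
  let ?s = "1 - 2 * real CARD('k) / real N"
  let ?Q = "\<lambda>a :: 'k \<Rightarrow> int. cbox (zvec a) (zvec (\<lambda>i. a i + int 1))"
  have "real N > 0" using N by simp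
  have "2 * real CARD('k) < real N" using N by linarith
  then have "?s > 0" using \<open>real N > 0\<close> by (simp add: field_simps)
  have "?s ^ CARD('k) * measure lebesgue (zcell P) = measure lebesgue ((*\<^sub>R) ?s ` zcell P)"
    by (rule measure_zcell_scale[OF \<open>?s > 0\<close>, symmetric])
  also have "\<dots> \<le> measure lebesgue (\<Union>a\<in>open_tile P. ?Q a)"
  proof (rule measure_mono_fmeasurable)
    show "(*\<^sub>R) ?s ` zcell P \<in> sets lebesgue"
      by (intro fmeasurableD lmeasurable_compact compact_zcell_scale[OF P(1)])
    show "(\<Union>a\<in>open_tile P. ?Q a) \<in> lmeasurable"
      using finite_open_tile[OF P(1)] by (intro lmeasurable_compact compact_UN) auto
    show "(*\<^sub>R) ?s ` zcell P \<subseteq> (\<Union>a\<in>open_tile P. ?Q a)"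
    proof
      fix u assume u: "u \<in> (*\<^sub>R) ?s ` zcell P"
      define n where "n = (\<lambda>i. \<lfloor>u $ i\<rfloor>)"
      have n: "real_of_int (n i) \<le> u $ i" "u $ i < real_of_int (n i) + 1" for i
        unfolding n_def by linarith+
      have near: "\<bar>(zvec n - u) $ i\<bar> \<le> 1" for i using n[of i] by simp
      have "n \<in> open_tile P"
        unfolding open_tile_iff
      proof (intro conjI ballI impI)
        fix q assume q: "q \<in> P" "q \<noteq> (\<lambda>i. 0)"
        then have gt: "real N < norm (zvec q)" using P(2) norm_zvec_gt by blast
        then have "norm (zvec q) * real N < (norm (zvec q))\<^sup>2"
          unfolding power2_eq_square using \<open>real N > 0\<close> by (intro mult_strict_left_mono) linarith+
        then have "norm (zvec q) < (norm (zvec q))\<^sup>2 / real N" using \<open>real N > 0\<close> by (simp add: field_simps)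
        then have "real CARD('k) * norm (zvec q) < real CARD('k) * ((norm (zvec q))\<^sup>2 / real N)"
          by (intro mult_strict_left_mono) auto
        moreover have "2 * (u \<bullet> zvec q) \<le> ?s * (norm (zvec q))\<^sup>2"
          using u q(1) unfolding zcell_scale_iff[OF \<open>?s > 0\<close>] by blast
        moreover have "zvec n \<bullet> zvec q \<le> u \<bullet> zvec q + real CARD('k) * 1 * norm (zvec q)"
          by (rule inner_le_norm_diff[OF near])
        moreover have "?s * (norm (zvec q))\<^sup>2
            = (norm (zvec q))\<^sup>2 - 2 * (real CARD('k) * ((norm (zvec q))\<^sup>2 / real N))"
          by (simp add: left_diff_distrib)
        ultimately show "2 * (zvec n \<bullet> zvec q) < (norm (zvec q))\<^sup>2" by linarith
      qed (rule P(3))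
      moreover have "u \<in> ?Q n" using n by (auto simp: mem_box_cart less_imp_le)
      ultimately show "u \<in> (\<Union>a\<in>open_tile P. ?Q a)" by blast
    qed
  qed
  also have "\<dots> \<le> (\<Sum>a\<in>open_tile P. measure lebesgue (?Q a))"
    using finite_open_tile[OF P(1)] by (intro measure_UNION_le) auto
  also have "\<dots> = real (card (open_tile P))" by (simp only: measure_zbox) simp
  finally show ?thesis .
qed

text \<open>Guarantees that open tiles are large. Any other marker has a coordinate beyond
  \<open>N\<close>, so seen from a site of the box it lies outside the cube of radius
  \<open>CARD('k) * L\<close> and loses to the origin.\<close>

lemma zbox_subset_open_tile:
  fixes P :: "('k::finite \<Rightarrow> int) set"
  assumes "\<And>q. q \<in> P \<Longrightarrow> q \<in> cbx N \<Longrightarrow> q = (\<lambda>i. 0)" "(\<lambda>i. 0) \<in> P" "L + CARD('k) * L \<le> N"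
  shows "zbox L \<subseteq> open_tile P"
proof
  fix n :: "'k \<Rightarrow> int" assume n: "n \<in> zbox L"
  have nb: "n \<in> cbx (int L)" using n by (auto simp: zbox_def cbx_def less_imp_le)
  have "isq n < isq (zdiff q n)" if q: "q \<in> P" "q \<noteq> (\<lambda>i. 0)" for q
  proof (rule isq_outside[OF _ nb])
    have "q \<notin> cbx N" using assms(1) q by blast
    then obtain i where "\<bar>q i\<bar> > int N" by (auto simp: cbx_def not_le)
    moreover have "\<bar>n i\<bar> \<le> int L" using nb by (simp add: cbx_def)
    moreover have "int L + int CARD('k) * int L \<le> int N"
      using assms(3) by (metis of_nat_add of_nat_le_iff of_nat_mult)
    ultimately have "\<bar>zdiff q n i\<bar> > int CARD('k) * int L" unfolding zdiff_def by linarith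
    then show "zdiff q n \<notin> cbx (int CARD('k) * int L)" by (auto simp: cbx_def not_le)
  qed simp
  then show "n \<in> open_tile P" using assms(2) by (simp add: open_tile_def strictly_closest_def isq_zdiff_0)
qed

lemma closed_tile_subset_cubes:
  assumes "M > 0"
  shows "closed_tile P \<subseteq> (\<Union>a\<in>corner M ` closed_tile P. (\<lambda>n. zadd n a) ` zbox M)"
proof
  fix n assume n: "n \<in> closed_tile P"
  have "n = zadd (zdiff n (corner M n)) (corner M n)" by simp
  moreover have "zdiff n (corner M n) \<in> zbox M"
    using corner_bounds[OF assms, of n] by (simp add: zbox_def zdiff_def algebra_simps)
  ultimately show "n \<in> (\<Union>a\<in>corner M ` closed_tile P. (\<lambda>n. zadd n a) ` zbox M)" using n by blast
qed

text \<open>Let m be the number of cubes, o the size of the open tile and x = M^k the size of a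
  cube. By integrality \<open>2 * w < D * x\<close> leaves one spare coordinate per cube, m in all,
  and m is at least o / x. Half of o / x absorbs the error of the volume comparison; the other half
  is at least 1 and yields the final \<open>+ 1\<close>.\<close>

lemma ex_good_tile_scale:
  assumes "M > 0" "D > 0"
  obtains N where "\<And>(P :: ('k::finite \<Rightarrow> int) set) w. syndetic N P \<Longrightarrow> (\<lambda>i. 0) \<in> P \<Longrightarrow>
    (\<And>q. q \<in> P \<Longrightarrow> q \<in> cbx N \<Longrightarrow> q = (\<lambda>i. 0)) \<Longrightarrow> 2 * w < D * M ^ CARD('k) \<Longrightarrow>
    2 * (card (corner M ` closed_tile P) * w) + 1 \<le> D * card (open_tile P)"
proof -
  let ?k = "CARD('k)"
  \<comment> \<open>Chosen so that the volume error, \<open>D * \<eta>\<close> times the size of the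
    open tile, is half the number of cubes that the open tile would fill.\<close>
  define \<eta> where "\<eta> = 1 / (2 * real D * real M ^ ?k)"
  have "\<eta> > 0" using assms by (simp add: \<eta>_def)
  have "(\<lambda>N. (1 + 2 * real ?k * real M * (1 / real N)) ^ ?k / (1 - 2 * real ?k * (1 / real N)) ^ ?k)
      \<longlonglongrightarrow> (1 + 2 * real ?k * real M * 0) ^ ?k / (1 - 2 * real ?k * 0) ^ ?k"
    by (intro tendsto_intros lim_1_over_n) auto
  then have lim: "(\<lambda>N. (1 + 2 * real ?k * real M / real N) ^ ?k / (1 - 2 * real ?k / real N) ^ ?k) \<longlonglongrightarrow> 1"
    by simp
  have "\<forall>\<^sub>F N in sequentially. (1 + 2 * real ?k * real M / real N) ^ ?k / (1 - 2 * real ?k / real N) ^ ?k < 1 + \<eta>"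
    by (rule order_tendstoD[OF lim]) (use \<open>\<eta> > 0\<close> in simp)
  \<comment> \<open>Large enough for a box of side \<open>2 * M\<close> inside the open tile, and
    for a positive shrinking factor \<open>1 - 2 * ?k / N\<close>.\<close>
  moreover have "\<forall>\<^sub>F N in sequentially. N \<ge> 2 * M + ?k * (2 * M) + 2 * ?k + 1" by (rule eventually_ge_at_top)
  ultimately have "\<forall>\<^sub>F N in sequentially. N \<ge> 2 * M + ?k * (2 * M) + 2 * ?k + 1 \<and>
      (1 + 2 * real ?k * real M / real N) ^ ?k / (1 - 2 * real ?k / real N) ^ ?k < 1 + \<eta>"
    by eventually_elim simp
  then obtain N where N: "N \<ge> 2 * M + ?k * (2 * M) + 2 * ?k + 1"
      "(1 + 2 * real ?k * real M / real N) ^ ?k / (1 - 2 * real ?k / real N) ^ ?k < 1 + \<eta>"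
    unfolding eventually_sequentially by blast
  show ?thesis
  proof (rule that[of N])
    fix P :: "('k \<Rightarrow> int) set" and w :: nat
    assume P: "syndetic N P" "(\<lambda>i. 0) \<in> P" "\<And>q. q \<in> P \<Longrightarrow> q \<in> cbx N \<Longrightarrow> q = (\<lambda>i. 0)"
      and w: "2 * w < D * M ^ CARD('k)"
    let ?V = "measure lebesgue (zcell P)" and ?m = "card (corner M ` closed_tile P)" and ?o = "card (open_tile P)"
    let ?up = "(1 + 2 * real ?k * real M / real N) ^ ?k" and ?lo = "(1 - 2 * real ?k / real N) ^ ?k"
    have "2 * ?k < N" using N(1) by linarith
    then have "2 * real ?k < real N" by linarith
    then have lo: "?lo > 0" by (simp add: field_simps)
    have up: "real ?m * real M ^ ?k \<le> ?up * ?V"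
      using N(1) by (intro cubes_le_volume P assms) auto
    have "?lo * ?V \<le> real ?o" using \<open>2 * ?k < N\<close> by (intro volume_le_open_tile P)
    then have "?up / ?lo * (?lo * ?V) \<le> ?up / ?lo * real ?o"
      using lo by (intro mult_left_mono divide_nonneg_pos zero_le_power) auto
    moreover have "a / b * (b * c) = a * c" if "b > 0" for a b c :: real using that by simp
    ultimately have "?up * ?V \<le> ?up / ?lo * real ?o" using lo by metis
    also have "\<dots> \<le> (1 + \<eta>) * real ?o" using N(2) by (intro mult_right_mono) auto
    finally have mo: "real ?m * real M ^ ?k \<le> (1 + \<eta>) * real ?o" using up by linarith
    have "zbox (2 * M) \<subseteq> open_tile P" using N(1) by (intro zbox_subset_open_tile P) auto
    then have "card (zbox (2 * M) :: ('k \<Rightarrow> int) set) \<le> ?o" by (intro card_mono finite_open_tile[OF P(1)])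
    then have "(2 * M) ^ ?k \<le> ?o" by (simp add: card_zbox)
    moreover have "2 * M ^ ?k \<le> (2 * M) ^ ?k"
      using self_le_power[of "2::nat" ?k] by (simp add: power_mult_distrib)
    ultimately have big: "2 * real M ^ ?k \<le> real ?o"
      by (metis (mono_tags, lifting) le_trans of_nat_le_iff of_nat_mult of_nat_numeral of_nat_power)
    have "?o \<le> card (closed_tile P)"
      by (intro card_mono finite_closed_tile[OF P(1)] open_tile_subset)
    also have "\<dots> \<le> card (\<Union>a\<in>corner M ` closed_tile P. (\<lambda>n. zadd n a) ` zbox M :: ('k \<Rightarrow> int) set)"
      using finite_closed_tile[OF P(1)] assms(1)
      by (intro card_mono closed_tile_subset_cubes finite_UN_I finite_imageI finite_zbox) auto
    also have "\<dots> \<le> (\<Sum>a\<in>corner M ` closed_tile P. card ((\<lambda>n. zadd n a) ` zbox M :: ('k \<Rightarrow> int) set))"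
      using finite_closed_tile[OF P(1)] by (intro card_UN_le) auto
    also have "\<dots> \<le> (\<Sum>a\<in>corner M ` closed_tile P. M ^ ?k)"
      by (intro sum_mono) (metis card_image_le card_zbox finite_zbox)
    finally have om: "real ?o \<le> real ?m * real M ^ ?k"
      by (simp add: of_nat_le_iff[where ?'a = real, symmetric] del: of_nat_le_iff)
    define x where "x = real M ^ ?k"
    have x: "x > 0" using assms(1) by (simp add: x_def)
    have "2 * real w + 1 \<le> real D * x"
      using w unfolding x_def by (metis Suc_leI add.commute of_nat_1 of_nat_add of_nat_le_iff of_nat_mult of_nat_numeral of_nat_power plus_1_eq_Suc)
    then have "real ?m * (2 * real w + 1) \<le> real ?m * (real D * x)" by (intro mult_left_mono) auto
    then have 1: "2 * (real ?m * real w) \<le> real D * (real ?m * x) - real ?m" by (simp add: algebra_simps)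
    have "real D * (real ?m * x) \<le> real D * ((1 + \<eta>) * real ?o)"
      using mo unfolding x_def by (intro mult_left_mono) auto
    also have "\<dots> = real D * real ?o + real ?o / (2 * x)"
      using assms x unfolding \<eta>_def x_def[symmetric] by (simp add: field_simps)
    finally have 2: "real D * (real ?m * x) \<le> real D * real ?o + real ?o / (2 * x)" .
    have 3: "real ?o / x \<le> real ?m" using om x unfolding x_def[symmetric] by (simp add: field_simps)
    have 4: "real ?o / (2 * x) \<ge> 1" using big x unfolding x_def[symmetric] by (simp add: field_simps)
    have "real ?o / x = real ?o / (2 * x) + real ?o / (2 * x)" by simp
    then have "2 * (real ?m * real w) + 1 \<le> real D * real ?o" using 1 2 3 4 by linarith
    then have "real (2 * (?m * w) + 1) \<le> real (D * ?o)" by simp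
    then show "2 * (?m * w) + 1 \<le> D * ?o" by (simp only: of_nat_le_iff)
  qed
qed

section \<open>Density of separating observables\<close>

context nonempty_zk_system
begin

text \<open>Each vertex receives the values of \<open>f\<close> along \<open>O'\<close> on the orbit
  of one point of its star, moved into general position; \<open>E\<close> is their mean with the
  partition of unity as weights. Small stars make \<open>E\<close> close to \<open>f\<close>. Equal
  codes force equal weights, hence a common star, and this controls the orbits on all of
  \<open>C\<close>, not only on \<open>O'\<close>.\<close>

lemma tile_encoding:
  fixes f :: "'a \<Rightarrow> real ^ 'd"
  assumes dim: "cut_dim_le X T C e n" "2 * n + 1 \<le> CARD('d) * card O'" and fin: "finite C" and sub: "O' \<subseteq> C"
    and "\<delta> > 0" and f: "\<And>x y. x \<in> X \<Longrightarrow> y \<in> X \<Longrightarrow> dist x y < e \<Longrightarrow> dist (f x) (f y) < \<delta> / 2"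
  shows "\<exists>E :: 'a \<Rightarrow> ('k \<Rightarrow> int) \<Rightarrow> real ^ 'd. (\<forall>m. continuous_on X (\<lambda>x. E x m)) \<and>
    (\<forall>x\<in>X. \<forall>m\<in>O'. \<forall>i. \<bar>E x m $ i - f (T m x) $ i\<bar> < \<delta>) \<and>
    (\<forall>x\<in>X. \<forall>y\<in>X. (\<forall>m\<in>O'. E x m = E y m) \<longrightarrow> (\<forall>m\<in>C. dist (T m x) (T m y) < e))"
proof -
  obtain V :: "nat set set" and \<phi> :: "'a \<Rightarrow> nat set \<Rightarrow> real" where V: "finite V"
    "\<And>v. v \<in> V \<Longrightarrow> continuous_on X (\<lambda>x. \<phi> x v)"
    "\<And>x v. \<phi> x v \<ge> 0" "\<And>x. sum (\<phi> x) V = 1"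
    "\<And>x. x \<in> X \<Longrightarrow> card {v\<in>V. \<phi> x v \<noteq> 0} \<le> n + 1"
    and star: "\<And>x y v m. x \<in> X \<Longrightarrow> y \<in> X \<Longrightarrow> v \<in> V \<Longrightarrow> \<phi> x v > 0 \<Longrightarrow> \<phi> y v > 0 \<Longrightarrow> m \<in> C \<Longrightarrow> dist (T m x) (T m y) < e"
    by (rule partition_of_unity_small_stars[OF dim(1) fin]) (rule that; assumption)
  \<comment> \<open>At a vertex charged by no point of \<open>X\<close> the choice is arbitrary;
    such a vertex contributes nothing to \<open>E\<close> on \<open>X\<close>.\<close>
  define z where "z v = (SOME z. z \<in> X \<and> \<phi> z v > 0)" for v
  have z: "z v \<in> X \<and> \<phi> (z v) v > 0" if "x \<in> X" "\<phi> x v > 0" for x v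
    unfolding z_def by (rule someI[of _ x]) (use that in simp)
  define w0 where "w0 v j = f (T (fst j) (z v)) $ snd j" for v and j :: "('k \<Rightarrow> int) \<times> 'd"
  let ?J = "O' \<times> (UNIV :: 'd set)"
  have "finite O'" using fin sub finite_subset by blast
  then have finJ: "finite ?J" by simp
  have cardJ: "2 * n + 1 \<le> card ?J" using dim(2) by (simp add: card_cartesian_product mult.commute)
  obtain w where w: "\<And>v j. \<bar>w v j - w0 v j\<bar> < \<delta> / 2"
    and gp: "\<And>p q v. card {v\<in>V. p v \<noteq> 0} \<le> n + 1 \<Longrightarrow> card {v\<in>V. q v \<noteq> 0} \<le> n + 1 \<Longrightarrow> sum p V = sum q V \<Longrightarrow>
      (\<And>j. j \<in> ?J \<Longrightarrow> (\<Sum>v\<in>V. p v * w v j) = (\<Sum>v\<in>V. q v * w v j)) \<Longrightarrow> v \<in> V \<Longrightarrow> p v = q v"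
    by (rule perturb_simplicial_injective[OF V(1) finJ half_gt_zero[OF \<open>\<delta> > 0\<close>] cardJ, of w0])
      (erule that, blast)
  define E where "E x m = (\<chi> i. \<Sum>v\<in>V. \<phi> x v * w v (m, i))" for x m
  show ?thesis
  proof (intro exI[of _ E] conjI allI ballI impI)
    show "continuous_on X (\<lambda>x. E x m)" for m
      unfolding E_def by (intro continuous_on_vec_lambda continuous_on_sum continuous_on_mult V(2) continuous_on_const)
  next
    fix x m i assume x: "x \<in> X" and m: "m \<in> O'"
    \<comment> \<open>The strict form needs positive weight. Since some vertex has it, the weighted
      mean of the errors is strictly below \<open>\<delta>\<close>.\<close>
    have close: "\<phi> x v * \<bar>w v (m, i) - f (T m x) $ i\<bar> \<le> \<phi> x v * \<delta>"
      "\<phi> x v > 0 \<Longrightarrow> \<phi> x v * \<bar>w v (m, i) - f (T m x) $ i\<bar> < \<phi> x v * \<delta>" if v: "v \<in> V" for v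
    proof -
      have "\<bar>w v (m, i) - f (T m x) $ i\<bar> < \<delta>" if pos: "\<phi> x v > 0"
      proof -
        have "dist (T m (z v)) (T m x) < e" using star[of "z v" x v m] z[OF x pos] x v m sub pos by blast
        then have "dist (f (T m (z v))) (f (T m x)) < \<delta> / 2"
          by (intro f T_in x) (use z[OF x pos] in simp_all)
        then have "norm (f (T m (z v)) - f (T m x)) < \<delta> / 2" by (simp add: dist_norm)
        then have "\<bar>(f (T m (z v)) - f (T m x)) $ i\<bar> < \<delta> / 2"
          using component_le_norm_cart[of "f (T m (z v)) - f (T m x)" i] by linarith
        moreover have "\<bar>w v (m, i) - f (T m (z v)) $ i\<bar> < \<delta> / 2"
          using w[of v "(m, i)"] by (simp add: w0_def)
        ultimately show ?thesis unfolding vector_minus_component by linarith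
      qed
      then show "\<phi> x v > 0 \<Longrightarrow> \<phi> x v * \<bar>w v (m, i) - f (T m x) $ i\<bar> < \<phi> x v * \<delta>"
        by (intro mult_strict_left_mono)
      then show "\<phi> x v * \<bar>w v (m, i) - f (T m x) $ i\<bar> \<le> \<phi> x v * \<delta>"
        using V(3)[of x v] by (cases "\<phi> x v = 0") (auto simp: less_le)
    qed
    have "\<exists>v\<in>V. \<phi> x v > 0"
    proof (rule ccontr)
      assume "\<not> ?thesis"
      then have "sum (\<phi> x) V \<le> 0" by (intro sum_nonpos) (auto simp: not_less)
      then show False using V(4)[of x] by simp
    qed
    then obtain v where v: "v \<in> V" "\<phi> x v > 0" by blast
    have "E x m $ i - f (T m x) $ i = (\<Sum>v\<in>V. \<phi> x v * (w v (m, i) - f (T m x) $ i))"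
      using V(4)[of x] by (simp add: E_def right_diff_distrib sum_subtractf flip: sum_distrib_right)
    also have "\<bar>\<dots>\<bar> \<le> (\<Sum>v\<in>V. \<bar>\<phi> x v * (w v (m, i) - f (T m x) $ i)\<bar>)" by (rule sum_abs)
    also have "\<dots> = (\<Sum>v\<in>V. \<phi> x v * \<bar>w v (m, i) - f (T m x) $ i\<bar>)" by (simp add: abs_mult V(3))
    also have "\<dots> < (\<Sum>v\<in>V. \<phi> x v * \<delta>)"
      by (rule sum_strict_mono_ex1[OF V(1)]) (use close v in blast)+
    also have "\<dots> = \<delta>" using V(4)[of x] by (simp flip: sum_distrib_right)
    finally show "\<bar>E x m $ i - f (T m x) $ i\<bar> < \<delta>" .
  next
    fix x y m assume xy: "x \<in> X" "y \<in> X" and eq: "\<forall>m\<in>O'. E x m = E y m" and m: "m \<in> C"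
    have same: "\<phi> x v = \<phi> y v" if "v \<in> V" for v
    proof (rule gp[OF V(5)[OF xy(1)] V(5)[OF xy(2)] _ _ that])
      fix j assume j: "j \<in> ?J"
      then have "E x (fst j) $ snd j = E y (fst j) $ snd j" using eq by auto
      then show "(\<Sum>v\<in>V. \<phi> x v * w v j) = (\<Sum>v\<in>V. \<phi> y v * w v j)" by (simp add: E_def)
    qed (simp add: V(4))
    have "\<exists>v\<in>V. \<phi> x v > 0"
    proof (rule ccontr)
      assume "\<not> ?thesis"
      then have "sum (\<phi> x) V \<le> 0" by (intro sum_nonpos) (auto simp: not_less)
      then show False using V(4)[of x] by simp
    qed
    then obtain v where v: "v \<in> V" "\<phi> x v > 0" by blast
    then show "dist (T m x) (T m y) < e" using star[OF xy v(1) v(2) _ m] same[OF v(1)] by simp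
  qed
qed

end

text \<open>Lets each tile be described from its own marker, placed at the origin: moving along the
  orbit by \<open>p\<close> recentres the marker set at \<open>p\<close>.\<close>

lemma closest_translate:
  fixes P :: "('k::finite \<Rightarrow> int) set"
  shows "closest {q. zadd q p \<in> P} n r \<longleftrightarrow> closest P (zadd n p) (zadd r p)"
    and "strictly_closest {q. zadd q p \<in> P} n r \<longleftrightarrow> strictly_closest P (zadd n p) (zadd r p)"
proof -
  have d: "zdiff (zadd r p) (zadd n p) = zdiff r n" for r n :: "'k \<Rightarrow> int"
    by (simp add: zdiff_def zadd_def)
  have d': "zdiff s (zadd n p) = zdiff (zdiff s p) n" "zadd (zdiff s p) p = s" for s
    by (simp_all add: zdiff_def zadd_def algebra_simps)
  have inj: "zadd s p = zadd r p \<longleftrightarrow> s = r" for s r :: "'k \<Rightarrow> int"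
    by (auto simp: zadd_def fun_eq_iff)
  have all: "(\<forall>s\<in>P. Q s) \<longleftrightarrow> (\<forall>q\<in>{q. zadd q p \<in> P}. Q (zadd q p))" for Q
  proof
    assume *: "\<forall>q\<in>{q. zadd q p \<in> P}. Q (zadd q p)"
    show "\<forall>s\<in>P. Q s"
    proof
      fix s assume "s \<in> P"
      then have "zadd (zdiff s p) p \<in> P" by (simp add: d')
      then have "Q (zadd (zdiff s p) p)" using * by blast
      then show "Q s" by (simp add: d')
    qed
  qed simp
  show "closest {q. zadd q p \<in> P} n r \<longleftrightarrow> closest P (zadd n p) (zadd r p)"
    unfolding closest_def all by (simp add: d)
  show "strictly_closest {q. zadd q p \<in> P} n r \<longleftrightarrow> strictly_closest P (zadd n p) (zadd r p)"
    unfolding strictly_closest_def all by (simp add: d inj)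
qed

context symbolic_extension
begin

definition separating :: "real \<Rightarrow> ('a \<Rightarrow> 'b) \<Rightarrow> bool" where
  "separating \<epsilon> g \<longleftrightarrow>
    (\<forall>x\<in>X. \<forall>y\<in>X. \<pi> x = \<pi> y \<longrightarrow> (\<forall>n. g (T n x) = g (T n y)) \<longrightarrow> dist x y < \<epsilon>)"

lemma approx_separating:
  fixes f :: "'a \<Rightarrow> real ^ 'd"
  assumes f: "continuous_on X f" and pos: "\<delta> > 0" "\<epsilon> > 0"
    and mdim: "mdim X T < ereal (real CARD('d) / 2)"
  shows "\<exists>g :: 'a \<Rightarrow> real ^ 'd. continuous_on X g \<and> (\<forall>x\<in>X. \<forall>i. \<bar>g x $ i - f x $ i\<bar> < \<delta>) \<and> separating \<epsilon> g"
proof -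
  have "uniformly_continuous_on X f" by (rule compact_uniformly_continuous[OF f compact_X])
  from uniformly_continuous_onE[OF this half_gt_zero[OF pos(1)]]
  obtain e0 where e0: "e0 > 0" "\<And>x y. x \<in> X \<Longrightarrow> y \<in> X \<Longrightarrow> dist y x < e0 \<Longrightarrow> dist (f y) (f x) < \<delta> / 2"
    by metis
  \<comment> \<open>The bound \<open>e0\<close> serves the approximation of \<open>f\<close>, the
    bound \<open>\<epsilon>\<close> the separation of points.\<close>
  define e where "e = min e0 \<epsilon>"
  have e: "e > 0" "e \<le> \<epsilon>" using e0(1) pos(2) by (simp_all add: e_def)
  have fe: "dist (f x) (f y) < \<delta> / 2" if "x \<in> X" "y \<in> X" "dist x y < e" for x y
    using e0(2)[of y x] that by (simp add: e_def)
  obtain M where M: "M \<ge> 1" "2 * cut_dim (zbox M) e < CARD('d) * M ^ CARD('k)"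
    by (rule ex_cut_dim_zbox_less[OF mdim e(1)])
  define w where "w = cut_dim (zbox M) e"
  have "M > 0" using M(1) by simp
  have D: "CARD('d) > 0" by simp
  obtain N where N: "\<And>(P :: ('k \<Rightarrow> int) set) w. syndetic N P \<Longrightarrow> (\<lambda>i. 0) \<in> P \<Longrightarrow>
    (\<And>q. q \<in> P \<Longrightarrow> q \<in> cbx N \<Longrightarrow> q = (\<lambda>i. 0)) \<Longrightarrow> 2 * w < CARD('d) * M ^ CARD('k) \<Longrightarrow>
    2 * (card (corner M ` closed_tile P) * w) + 1 \<le> CARD('d) * card (open_tile P)"
    by (rule ex_good_tile_scale[where ?'k = 'k, OF \<open>M > 0\<close> D]) (rule that, blast)
  obtain mk where mk: "loc_const_on X mk" "\<And>x y. x \<in> X \<Longrightarrow> y \<in> X \<Longrightarrow> \<pi> x = \<pi> y \<Longrightarrow> mk x = mk y"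
    "\<And>x a. x \<in> X \<Longrightarrow> mk x \<Longrightarrow> mk (T a x) \<Longrightarrow> a \<in> cbx N \<Longrightarrow> a = (\<lambda>i. 0)"
    "\<And>x. x \<in> X \<Longrightarrow> \<exists>a\<in>cbx N. mk (T a x)"
    by (rule ex_markers[of N]) (rule that, assumption, blast+)
  define P where "P x = {p. mk (T p x)}" for x
  have P_T: "P (T p x) = {q. zadd q p \<in> P x}" if "x \<in> X" for p x
    using that by (simp add: P_def T_zadd)
  have synd: "syndetic N (P x)" if x: "x \<in> X" for x
    unfolding syndetic_def
  proof
    fix n
    obtain a where a: "a \<in> cbx N" "mk (T a (T n x))" using mk(4)[OF T_in[OF x]] by blast
    then have "zadd a n \<in> P x" using x by (simp add: P_def T_zadd)
    moreover have "zdiff (zadd a n) n = a" by (simp add: zdiff_def zadd_def)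
    ultimately show "\<exists>q\<in>P x. zdiff q n \<in> cbx N" using a(1) by (intro bexI[of _ "zadd a n"]) simp_all
  qed
  define tile where "tile x = (open_tile (P x), closed_tile (P x))" for x
  define Good where "Good \<tau> E \<longleftrightarrow> (\<forall>m. continuous_on X (\<lambda>x. E x m)) \<and>
    (\<forall>x\<in>X. \<forall>m\<in>fst \<tau>. \<forall>i. \<bar>E x m $ i - f (T m x) $ i\<bar> < \<delta>) \<and>
    (\<forall>x\<in>X. \<forall>y\<in>X. (\<forall>m\<in>fst \<tau>. E x m = E y m) \<longrightarrow> (\<forall>m\<in>snd \<tau>. dist (T m x) (T m y) < e))"
    for \<tau> :: "('k \<Rightarrow> int) set \<times> ('k \<Rightarrow> int) set" and E :: "'a \<Rightarrow> ('k \<Rightarrow> int) \<Rightarrow> real ^ 'd"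
  have ex_good: "\<exists>E. Good (tile x) E" if x: "x \<in> X" "mk x" for x
  proof -
    let ?A = "corner M ` closed_tile (P x)"
    have fin: "finite (closed_tile (P x))" by (rule finite_closed_tile[OF synd[OF x(1)]])
    have "cut_dim_le X T (\<Union>a\<in>?A. (\<lambda>n. zadd n a) ` zbox M) e (card ?A * w)"
      unfolding w_def using fin by (intro cut_dim_le_translates cut_dim_le_cut_dim finite_imageI finite_zbox e(1))
    then have "cut_dim_le X T (closed_tile (P x)) e (card ?A * w)"
      by (rule cut_dim_le_mono) (rule closed_tile_subset_cubes[OF \<open>M > 0\<close>] order_refl)+
    moreover have "2 * (card ?A * w) + 1 \<le> CARD('d) * card (open_tile (P x))"
    proof (rule N[OF synd[OF x(1)]])
      show "(\<lambda>i. 0) \<in> P x" using x by (simp add: P_def T_0)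
      show "q = (\<lambda>i. 0)" if "q \<in> P x" "q \<in> cbx N" for q
        using mk(3)[OF x] that by (simp add: P_def)
      show "2 * w < CARD('d) * M ^ CARD('k)" using M(2) by (simp add: w_def)
    qed
    ultimately show ?thesis
      unfolding Good_def tile_def fst_conv snd_conv
      using tile_encoding[OF _ _ fin open_tile_subset pos(1) fe] by simp
  qed
  \<comment> \<open>One code per tile shape, not per point: points with the same shape must share
    their code, both for continuity and for comparing two points of a fibre.\<close>
  have "\<forall>\<tau>. \<exists>E. (\<exists>x\<in>X. mk x \<and> tile x = \<tau>) \<longrightarrow> Good \<tau> E" using ex_good by blast
  from choice[OF this] obtain Enc where Enc': "\<forall>\<tau>. (\<exists>x\<in>X. mk x \<and> tile x = \<tau>) \<longrightarrow> Good \<tau> (Enc \<tau>)" ..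
  then have Enc: "Good (tile x) (Enc (tile x))" if "x \<in> X" "mk x" for x using that by blast
  define sc where "sc x p \<longleftrightarrow> strictly_closest (P x) (\<lambda>i. 0) p" for x p
  \<comment> \<open>If the origin lies in the open tile of the marker \<open>p\<close>, read off its coordinate in the code of \<open>T\<^sup>p x\<close>.\<close>
  define g where "g x = (if \<exists>p. sc x p then Enc (tile (T (THE p. sc x p) x)) (T (THE p. sc x p) x) (zneg (THE p. sc x p)) else f x)" for x
  have g_sc: "g x = Enc (tile (T p x)) (T p x) (zneg p)" if sc: "sc x p" for x p
  proof -
    have "(THE p. sc x p) = p"
      using sc strictly_closest_unique unfolding sc_def by (intro the_equality) blast+
    then show ?thesis using sc unfolding g_def by auto
  qed
  have sc_mk: "mk (T p x)" if "sc x p" for x p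
    using that unfolding sc_def strictly_closest_def P_def by simp
  have sc_tile: "zneg p \<in> open_tile (P (T p x))" if "x \<in> X" "sc x p" for x p
    using that unfolding open_tile_def P_T[OF that(1)] sc_def by (simp add: closest_translate)
  have tile_sc: "sc (T n x) (zneg n)" if "x \<in> X" "n \<in> open_tile (P x)" for n x
    using that unfolding open_tile_def sc_def P_T[OF that(1)] by (simp add: closest_translate)
  have g_tile: "g (T n x) = Enc (tile x) x n" if "x \<in> X" "n \<in> open_tile (P x)" for x n
    using g_sc[OF tile_sc[OF that]] T_zneg(1)[OF that(1)] by simp
  \<comment> \<open>Radius of a window of markers that determines the tile of the origin as well as
    the strictly closest marker.\<close>
  define L where "L = 2 * (int CARD('k) * int N)"
  have lcP: "loc_const_on X (\<lambda>x. P x \<inter> cbx L)"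
  proof (rule loc_const_on_family[OF finite_cbx, where f = "\<lambda>x p. mk (T p x)"])
    show "loc_const_on X (\<lambda>x. mk (T p x))" for p by (rule loc_const_on_T[OF mk(1)])
    show "P y \<inter> cbx L = P x \<inter> cbx L" if "\<And>p. p \<in> cbx L \<Longrightarrow> mk (T p y) = mk (T p x)" for x y
      using that by (auto simp: P_def)
  qed
  have sub: "cbx (int CARD('k) * int N) \<subseteq> (cbx L :: ('k \<Rightarrow> int) set)"
  proof -
    have "int CARD('k) * int N \<le> L" by (simp add: L_def)
    then show ?thesis unfolding cbx_def using order_trans by blast
  qed
  have sc_local: "sc y p" if "x \<in> X" "P y \<inter> cbx L = P x \<inter> cbx L" "sc x p" for x y p
    unfolding sc_def
  proof (rule closest_local(2)[OF synd[OF that(1)]])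
    fix r :: "'k \<Rightarrow> int" assume "zdiff r (\<lambda>i. 0) \<in> cbx (int CARD('k) * int N)"
    then have "r \<in> cbx L" using sub by (auto simp: zdiff_def)
    then show "r \<in> P x \<longleftrightarrow> r \<in> P y" using that(2) by blast
  qed (use that(3) in \<open>simp add: sc_def\<close>)
  have tile_loc: "tile y = tile x" if "x \<in> X" "y \<in> X" "P y \<inter> cbx L = P x \<inter> cbx L" for x y
    using tile_local[OF synd[OF that(2)] synd[OF that(1)]] that(3) by (simp add: tile_def L_def)
  \<comment> \<open>Near \<open>x\<close> the strictly closest marker and the shape of its tile do
    not change, so \<open>g\<close> agrees there with one fixed code or with
    \<open>f\<close>.\<close>
  have contg: "continuous_on X g"
  proof (rule continuous_on_locally_eq)
    fix x assume x: "x \<in> X"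
    have near: "\<forall>\<^sub>F y in nhds x. y \<in> X \<longrightarrow> P y \<inter> cbx L = P x \<inter> cbx L"
      using lcP x unfolding loc_const_on_def by blast
    show "\<exists>h. continuous_on X h \<and> (\<forall>\<^sub>F y in nhds x. y \<in> X \<longrightarrow> g y = h y)"
    proof (cases "\<exists>p. sc x p")
      case True
      then obtain p where p: "sc x p" ..
      have near': "\<forall>\<^sub>F y in nhds x. y \<in> X \<longrightarrow> P (T p y) \<inter> cbx L = P (T p x) \<inter> cbx L"
        using loc_const_on_T[OF lcP, of p] x unfolding loc_const_on_def by blast
      have "\<forall>\<^sub>F y in nhds x. y \<in> X \<longrightarrow> g y = Enc (tile (T p x)) (T p y) (zneg p)"
        using near near'
      proof eventually_elim
        case (elim y)
        show ?case
        proof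
          assume y: "y \<in> X"
          have "sc y p" using elim(1) y by (intro sc_local[OF x _ p]) simp
          moreover have "tile (T p y) = tile (T p x)"
            using elim(2) y by (intro tile_loc T_in x) simp_all
          ultimately show "g y = Enc (tile (T p x)) (T p y) (zneg p)" by (simp add: g_sc)
        qed
      qed
      moreover have "continuous_on X (\<lambda>y. Enc (tile (T p x)) (T p y) (zneg p))"
      proof (rule continuous_on_compose2[OF _ continuous_on_T])
        show "continuous_on X (\<lambda>y. Enc (tile (T p x)) y (zneg p))"
          using Enc[OF T_in[OF x] sc_mk[OF p]] unfolding Good_def by blast
      qed (auto simp: T_in)
      ultimately show ?thesis by blast
    next
      case False
      have "\<forall>\<^sub>F y in nhds x. y \<in> X \<longrightarrow> g y = f y"
        using near
      proof eventually_elim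
        case (elim y)
        show ?case
        proof
          assume y: "y \<in> X"
          \<comment> \<open>Locality is used backwards: a marker strictly closest at
            \<open>y\<close> would be strictly closest at \<open>x\<close> too.\<close>
          have "\<not> sc y p" for p
            using sc_local[OF y, of x p] elim y False by metis
          then show "g y = f y" by (simp add: g_def)
        qed
      qed
      then show ?thesis using f by blast
    qed
  qed
  have close: "\<bar>g x $ i - f x $ i\<bar> < \<delta>" if x: "x \<in> X" for x i
  proof (cases "\<exists>p. sc x p")
    case True
    then obtain p where p: "sc x p" ..
    have "zneg p \<in> fst (tile (T p x))" using sc_tile[OF x p] by (simp add: tile_def)
    then have "\<bar>Enc (tile (T p x)) (T p x) (zneg p) $ i - f (T (zneg p) (T p x)) $ i\<bar> < \<delta>"
      using Enc[OF T_in[OF x] sc_mk[OF p]] T_in[OF x] unfolding Good_def by blast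
    then show ?thesis unfolding T_zneg(1)[OF x] g_sc[OF p] .
  next
    case False
    then show ?thesis using pos(1) by (simp add: g_def)
  qed
  have "separating \<epsilon> g"
    unfolding separating_def
  proof (intro ballI impI)
    fix x y assume x: "x \<in> X" and y: "y \<in> X" and "\<pi> x = \<pi> y" and geq: "\<forall>n. g (T n x) = g (T n y)"
    have "mk (T p x) = mk (T p y)" for p
      by (rule mk(2)[OF T_in[OF x] T_in[OF y] \<pi>_T_cong[OF x y \<open>\<pi> x = \<pi> y\<close>]])
    then have Pxy: "P x = P y" by (simp add: P_def)
    \<comment> \<open>A closest marker exists even if it is tied. The origin then lies in the closed
      tile of \<open>p\<close>, which the code on the open tile resolves.\<close>
    obtain p where p: "closest (P x) (\<lambda>i. 0) p" by (rule ex_closest[OF synd[OF x]])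
    have mkp: "mk (T p x)" using p unfolding closest_def P_def by simp
    have xp: "T p x \<in> X" and yp: "T p y \<in> X" using x y T_in by blast+
    have Peq: "P (T p x) = P (T p y)" by (simp add: P_T x y Pxy)
    then have teq: "tile (T p x) = tile (T p y)" by (simp add: tile_def)
    have "Enc (tile (T p x)) (T p x) m = Enc (tile (T p x)) (T p y) m" if "m \<in> fst (tile (T p x))" for m
    proof -
      have m: "m \<in> open_tile (P (T p x))" using that by (simp add: tile_def)
      have "g (T m (T p x)) = g (T m (T p y))" using geq by (simp add: x y flip: T_zadd)
      then show ?thesis using g_tile[OF xp m] g_tile[OF yp m[unfolded Peq]] teq by simp
    qed
    moreover have "zneg p \<in> snd (tile (T p x))"
      using p by (simp add: tile_def closed_tile_def P_T x closest_translate)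
    ultimately have "dist (T (zneg p) (T p x)) (T (zneg p) (T p y)) < e"
      using Enc[OF xp mkp] xp yp unfolding Good_def by blast
    then show "dist x y < \<epsilon>" using e(2) by (simp add: T_zneg x y)
  qed
  then show ?thesis using contg close by blast
qed

end

section \<open>Separating all points\<close>

context symbolic_extension
begin

text \<open>Otherwise maps ever closer to \<open>g\<close> fail to separate, which gives pairs in
  common fibres, at least \<open>\<epsilon>\<close> apart, whose orbits under \<open>g\<close>
  become uniformly close. A limit pair is still in one fibre by continuity of \<open>\<pi>\<close>,
  and its orbits under \<open>g\<close> coincide.\<close>

lemma separating_stable:
  fixes g :: "'a \<Rightarrow> 'b::metric_space"
  assumes g: "continuous_on X g" and sep: "separating \<epsilon> g"
  shows "\<exists>\<rho>>0. \<forall>h. (\<forall>x\<in>X. dist (h x) (g x) \<le> \<rho>) \<longrightarrow> separating \<epsilon> h"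
proof (rule ccontr)
  assume neg: "\<not> ?thesis"
  have "\<exists>p. fst p \<in> X \<and> snd p \<in> X \<and> \<pi> (fst p) = \<pi> (snd p) \<and>
      (\<forall>n. dist (g (T n (fst p))) (g (T n (snd p))) \<le> 2 / real (Suc i)) \<and> \<epsilon> \<le> dist (fst p) (snd p)" for i
  proof -
    have "1 / real (Suc i) > 0" by simp
    then obtain h where h: "\<forall>x\<in>X. dist (h x) (g x) \<le> 1 / real (Suc i)" "\<not> separating \<epsilon> h"
      using neg by blast
    then obtain x y where xy: "x \<in> X" "y \<in> X" "\<pi> x = \<pi> y" "\<forall>n. h (T n x) = h (T n y)" "\<epsilon> \<le> dist x y"
      unfolding separating_def by (auto simp: not_less)
    have "dist (g (T n x)) (g (T n y)) \<le> 2 / real (Suc i)" for n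
    proof -
      have "dist (h (T n x)) (g (T n x)) \<le> 1 / real (Suc i)" "dist (h (T n y)) (g (T n y)) \<le> 1 / real (Suc i)"
        using h(1) T_in xy(1,2) by blast+
      moreover have "h (T n x) = h (T n y)" using xy(4) by blast
      moreover have "2 / real (Suc i) = 1 / real (Suc i) + 1 / real (Suc i)" by simp
      ultimately show ?thesis
        using dist_triangle2[of "g (T n x)" "g (T n y)" "h (T n x)"] by (simp add: dist_commute)
    qed
    then show ?thesis using xy by (intro exI[of _ "(x, y)"]) simp
  qed
  then have "\<forall>i. \<exists>p. fst p \<in> X \<and> snd p \<in> X \<and> \<pi> (fst p) = \<pi> (snd p) \<and>
      (\<forall>n. dist (g (T n (fst p))) (g (T n (snd p))) \<le> 2 / real (Suc i)) \<and> \<epsilon> \<le> dist (fst p) (snd p)" ..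
  from choice[OF this] obtain s where s: "\<forall>i. fst (s i) \<in> X \<and> snd (s i) \<in> X \<and> \<pi> (fst (s i)) = \<pi> (snd (s i)) \<and>
      (\<forall>n. dist (g (T n (fst (s i)))) (g (T n (snd (s i)))) \<le> 2 / real (Suc i)) \<and> \<epsilon> \<le> dist (fst (s i)) (snd (s i))" ..
  have "\<forall>i. s i \<in> X \<times> X" using s by (simp add: mem_Times_iff)
  then obtain l r where l: "l \<in> X \<times> X" and r: "strict_mono r" and lim: "(s \<circ> r) \<longlonglongrightarrow> l"
    using compact_Times[OF compact_X compact_X, unfolded compact_def] by blast
  define x y where "x = fst l" and "y = snd l"
  have xy: "x \<in> X" "y \<in> X" using l by (auto simp: x_def y_def)
  have limx: "(\<lambda>i. fst (s (r i))) \<longlonglongrightarrow> x" and limy: "(\<lambda>i. snd (s (r i))) \<longlonglongrightarrow> y"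
    using tendsto_fst[OF lim] tendsto_snd[OF lim] by (simp_all add: x_def y_def o_def)
  have limF: "(\<lambda>i. F (fst (s (r i)))) \<longlonglongrightarrow> F x" "(\<lambda>i. F (snd (s (r i)))) \<longlonglongrightarrow> F y"
    if "continuous_on X F" for F :: "'a \<Rightarrow> 'c::topological_space"
  proof -
    show "(\<lambda>i. F (fst (s (r i)))) \<longlonglongrightarrow> F x"
      by (rule continuous_on_tendsto_compose[OF that limx xy(1)]) (use s in simp)
    show "(\<lambda>i. F (snd (s (r i)))) \<longlonglongrightarrow> F y"
      by (rule continuous_on_tendsto_compose[OF that limy xy(2)]) (use s in simp)
  qed
  have "\<pi> x n = \<pi> y n" for n
  proof -
    have "continuous_on X (\<lambda>x. \<pi> x n)"
      by (rule continuous_on_product_then_coordinatewise[OF continuous_on_\<pi>])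
    note c = limF[OF this]
    have "(\<lambda>i. \<pi> (fst (s (r i))) n) = (\<lambda>i. \<pi> (snd (s (r i))) n)" using s by simp
    then show ?thesis using c LIMSEQ_unique by metis
  qed
  then have "\<pi> x = \<pi> y" by blast
  moreover have "g (T n x) = g (T n y)" for n
  proof -
    have gT: "continuous_on X (\<lambda>x. g (T n x))"
      by (rule continuous_on_compose2[OF g continuous_on_T]) (auto simp: T_in)
    have "(\<lambda>i. dist (g (T n (fst (s (r i))))) (g (T n (snd (s (r i)))))) \<longlonglongrightarrow> dist (g (T n x)) (g (T n y))"
      by (rule tendsto_dist[OF limF[OF gT]])
    moreover have "(\<lambda>i. 2 * (1 / real (Suc (r i)))) \<longlonglongrightarrow> 2 * 0"
      using LIMSEQ_subseq_LIMSEQ[OF LIMSEQ_Suc[OF lim_1_over_n] r] by (intro tendsto_mult tendsto_const) (simp add: o_def)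
    ultimately have "dist (g (T n x)) (g (T n y)) \<le> 2 * 0"
      by (rule LIMSEQ_le) (use s in auto)
    then show ?thesis by simp
  qed
  ultimately have "dist x y < \<epsilon>" using sep xy unfolding separating_def by blast
  moreover have "\<epsilon> \<le> dist x y"
    by (rule LIMSEQ_le_const[OF tendsto_dist[OF limx limy]]) (use s in auto)
  ultimately show False by simp
qed

text \<open>A Baire category argument by hand: separation at scale \<open>1 / Suc i\<close> is a
  dense condition by \<open>approx_separating\<close> and a stable one by
  \<open>separating_stable\<close>. Each pair \<open>s i\<close> holds the centre and the radius of
  a ball of maps on which it holds.\<close>

lemma ex_separating:
  assumes mdim: "mdim X T < ereal (real CARD('d::finite) / 2)"
  shows "\<exists>F :: 'a \<Rightarrow> real ^ 'd. continuous_on X F \<and>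
    (\<forall>x\<in>X. \<forall>y\<in>X. \<pi> x = \<pi> y \<longrightarrow> (\<forall>n. F (T n x) = F (T n y)) \<longrightarrow> x = y)"
proof -
  define Q where "Q i p \<longleftrightarrow> continuous_on X (fst p) \<and> snd p > 0 \<and>
      (\<forall>h. (\<forall>x\<in>X. dist (h x) (fst p x) \<le> snd p) \<longrightarrow> separating (1 / real (Suc i)) h)"
    for i :: nat and p :: "('a \<Rightarrow> real ^ 'd) \<times> real"
  \<comment> \<open>Half of the old radius is spent on moving the centre and half on the new ball,
    so that the balls are nested.\<close>
  define R where "R p q \<longleftrightarrow> (\<forall>x\<in>X. dist (fst q x) (fst p x) \<le> snd p / 2) \<and> snd q \<le> snd p / 2"
    for p q :: "('a \<Rightarrow> real ^ 'd) \<times> real"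
  have step: "\<exists>q. Q i q \<and> R p q" if p: "continuous_on X (fst p)" "snd p > 0" for i p
  proof -
    \<comment> \<open>\<open>approx_separating\<close> bounds single coordinates; the division by
      their number turns this into a bound for the norm.\<close>
    let ?\<delta> = "snd p / (2 * real CARD('d))"
    have "?\<delta> > 0" using p(2) by simp
    have "1 / real (Suc i) > 0" by simp
    obtain g :: "'a \<Rightarrow> real ^ 'd" where g: "continuous_on X g"
        "\<forall>x\<in>X. \<forall>j. \<bar>g x $ j - fst p x $ j\<bar> < ?\<delta>" "separating (1 / real (Suc i)) g"
      using approx_separating[OF p(1) \<open>?\<delta> > 0\<close> \<open>1 / real (Suc i) > 0\<close> mdim] by blast
    obtain \<rho> where \<rho>: "\<rho> > 0" "\<forall>h. (\<forall>x\<in>X. dist (h x) (g x) \<le> \<rho>) \<longrightarrow> separating (1 / real (Suc i)) h"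
      using separating_stable[OF g(1,3)] by blast
    have "dist (g x) (fst p x) \<le> snd p / 2" if "x \<in> X" for x
    proof -
      have "norm (g x - fst p x) \<le> real CARD('d) * ?\<delta>"
        using g(2) that by (intro norm_vec_le) (auto intro: less_imp_le)
      then show ?thesis by (simp add: dist_norm)
    qed
    moreover have "Q i (g, min \<rho> (snd p / 2))"
      unfolding Q_def using g(1) \<rho> p(2) by simp
    ultimately show ?thesis by (intro exI[of _ "(g, min \<rho> (snd p / 2))"]) (simp add: R_def)
  qed
  have "\<exists>s. \<forall>i. Q i (s i) \<and> R (s i) (s (Suc i))"
  proof (rule dependent_nat_choice)
    show "\<exists>p. Q 0 p" using step[of "(\<lambda>_. 0, 1)" 0] by auto
    show "\<exists>q. Q (Suc i) q \<and> R p q" if "Q i p" for i p using step[of p "Suc i"] that by (simp add: Q_def)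
  qed
  then obtain s where s: "\<forall>i. Q i (s i) \<and> R (s i) (s (Suc i))" ..
  define f where "f i = fst (s i)" for i
  define \<rho> where "\<rho> i = snd (s i)" for i
  have fc: "continuous_on X (f i)" and \<rho>0: "\<rho> i > 0" for i
    using s unfolding Q_def f_def \<rho>_def by blast+
  have fs: "separating (1 / real (Suc i)) h" if "\<And>x. x \<in> X \<Longrightarrow> dist (h x) (f i x) \<le> \<rho> i" for i h
    using s that unfolding Q_def f_def \<rho>_def by blast
  have fR: "\<rho> (Suc i) \<le> \<rho> i / 2" "x \<in> X \<Longrightarrow> dist (f (Suc i) x) (f i x) \<le> \<rho> i / 2" for i x
    using s unfolding R_def f_def \<rho>_def by blast+
  \<comment> \<open>Nesting places the limit in every ball, where it inherits separation at every
    scale.\<close>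
  have nest: "dist (f j x) (f i x) + \<rho> j \<le> \<rho> i" if x: "x \<in> X" and "i \<le> j" for i j x
    using that(2)
  proof (induction j rule: dec_induct)
    case (step j)
    have "dist (f (Suc j) x) (f i x) \<le> dist (f (Suc j) x) (f j x) + dist (f j x) (f i x)" by (rule dist_triangle)
    then show ?case using fR(1)[of j] fR(2)[OF x, of j] step.IH by linarith
  qed simp
  have \<rho>_le: "\<rho> i \<le> \<rho> 0 * (1 / 2) ^ i" for i
  proof (induction i)
    case (Suc i)
    then show ?case using fR(1)[of i] by simp
  qed simp
  have "(\<lambda>i. \<rho> 0 * (1 / 2) ^ i) \<longlonglongrightarrow> \<rho> 0 * 0"
    by (intro tendsto_mult tendsto_const LIMSEQ_power_zero) simp
  then have lim0: "(\<lambda>i. \<rho> 0 * (1 / 2) ^ i) \<longlonglongrightarrow> 0" by simp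
  have \<rho>lim: "\<rho> \<longlonglongrightarrow> 0"
    by (rule tendsto_sandwich[OF _ _ tendsto_const lim0])
      (intro always_eventually allI \<rho>_le less_imp_le[OF \<rho>0])+
  have cauchy: "\<exists>l. (\<lambda>i. f i x) \<longlonglongrightarrow> l" if x: "x \<in> X" for x
  proof -
    have "Cauchy (\<lambda>i. f i x)"
    proof (rule metric_CauchyI)
      fix e :: real assume "e > 0"
      then have "\<forall>\<^sub>F i in sequentially. \<rho> i < e / 2" by (intro order_tendstoD(2)[OF \<rho>lim]) simp
      then obtain K where K: "\<rho> K < e / 2" unfolding eventually_sequentially by blast
      have "dist (f m x) (f n x) < e" if "m \<ge> K" "n \<ge> K" for m n
        using nest[OF x that(1)] nest[OF x that(2)] \<rho>0[of m] \<rho>0[of n] K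
          dist_triangle2[of "f m x" "f n x" "f K x"] by linarith
      then show "\<exists>M. \<forall>m\<ge>M. \<forall>n\<ge>M. dist (f m x) (f n x) < e" by blast
    qed
    then show ?thesis by (simp add: Cauchy_convergent_iff convergent_def)
  qed
  define F where "F x = lim (\<lambda>i. f i x)" for x
  have Flim: "(\<lambda>i. f i x) \<longlonglongrightarrow> F x" if x: "x \<in> X" for x
    using cauchy[OF x] unfolding F_def by (simp add: convergent_LIMSEQ_iff[symmetric] convergent_def)
  have Fclose: "dist (F x) (f i x) \<le> \<rho> i" if x: "x \<in> X" for i x
  proof (rule LIMSEQ_le_const2[OF tendsto_dist[OF Flim[OF x] tendsto_const]])
    have "dist (f j x) (f i x) \<le> \<rho> i" if "j \<ge> i" for j using nest[OF x that] \<rho>0[of j] by linarith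
    then show "\<exists>M. \<forall>j\<ge>M. dist (f j x) (f i x) \<le> \<rho> i" by blast
  qed
  have "uniform_limit X f F sequentially"
  proof (rule uniform_limitI)
    fix e :: real assume "e > 0"
    then have "\<forall>\<^sub>F i in sequentially. \<rho> i < e" by (rule order_tendstoD(2)[OF \<rho>lim])
    then show "\<forall>\<^sub>F i in sequentially. \<forall>x\<in>X. dist (f i x) (F x) < e"
    proof eventually_elim
      case (elim i)
      then show ?case using Fclose[of _ i] by (metis dist_commute le_less_trans)
    qed
  qed
  then have "continuous_on X F"
    by (rule uniform_limit_theorem[rotated]) (auto simp: fc)
  moreover have "x = y" if "x \<in> X" "y \<in> X" "\<pi> x = \<pi> y" "\<forall>n. F (T n x) = F (T n y)" for x y
  proof (rule ccontr)
    assume "x \<noteq> y"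
    then obtain i where "1 / real (Suc i) < dist x y"
      using nat_approx_posE[of "dist x y"] by auto
    moreover have "separating (1 / real (Suc i)) F" by (rule fs[OF Fclose])
    then have "dist x y < 1 / real (Suc i)" using that unfolding separating_def by blast
    ultimately show False by simp
  qed
  ultimately show ?thesis by blast
qed

text \<open>The symbol at \<open>0\<close> selects one of disjoint subintervals of \<open>[0,1]\<close> in each coordinate, so that
  a single observable with values in the cube records both the symbol and the rescaled value of \<open>F\<close>.\<close>

lemma ex_equivariant_cube_embedding:
  assumes mdim: "mdim X T < ereal (real CARD('d::finite) / 2)"
    and sym: "\<And>x n. x \<in> X \<Longrightarrow> \<pi> x n \<le> l"
  shows "\<exists>I :: 'a \<Rightarrow> ('k \<Rightarrow> int) \<Rightarrow> real ^ 'd. equivariant_cube_embedding X T I"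
proof -
  obtain F :: "'a \<Rightarrow> real ^ 'd" where F: "continuous_on X F"
    "\<forall>x\<in>X. \<forall>y\<in>X. \<pi> x = \<pi> y \<longrightarrow> (\<forall>n. F (T n x) = F (T n y)) \<longrightarrow> x = y"
    using ex_separating[OF mdim] by blast
  have "bounded (F ` X)" by (rule compact_imp_bounded[OF compact_continuous_image[OF F(1) compact_X]])
  then obtain R where R: "R > 0" "\<forall>z\<in>F ` X. norm z \<le> R" unfolding bounded_pos by blast
  have Fb: "\<bar>F x $ i\<bar> \<le> R" if "x \<in> X" for x i
    using R(2) that component_le_norm_cart[of "F x" i] by force
  \<comment> \<open>Rescaling to [0, 1/2] rather than [0, 1] leaves gaps between the intervals of
    consecutive symbols.\<close>
  define c where "c x i = (F x $ i + R) / (4 * R)" for x i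
  have c: "0 \<le> c x i" "c x i \<le> 1 / 2" if "x \<in> X" for x i
    using Fb[OF that, of i] R(1) by (auto simp: c_def field_simps abs_le_iff)
  define a :: "'a \<Rightarrow> real ^ 'd" where "a x = (\<chi> i. (real (\<pi> x (\<lambda>i. 0)) + c x i) / (real l + 1))" for x
  define I where "I x n = a (T n x)" for x n
  have a01: "a x $ i \<in> {0..1}" if "x \<in> X" for x i
    using c[OF that, of i] sym[OF that, of "\<lambda>i. 0"] by (simp add: a_def divide_le_eq)
  have conta: "continuous_on X a"
  proof -
    have "continuous_on X (\<lambda>x. \<pi> x (\<lambda>i. 0))"
      by (rule continuous_on_product_then_coordinatewise[OF continuous_on_\<pi>])
    then have "continuous_on X (\<lambda>x. real (\<pi> x (\<lambda>i. 0)))"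
      by (rule continuous_on_compose2[of UNIV of_nat, rotated]) auto
    moreover have "continuous_on X (\<lambda>x. c x i)" for i
      unfolding c_def using R(1) by (intro continuous_intros F(1)) auto
    ultimately show ?thesis
      unfolding a_def
      by (intro continuous_on_vec_lambda continuous_on_divide continuous_on_add continuous_on_const) auto
  qed
  have contI: "continuous_on X I"
  proof (rule continuous_on_coordinatewise_then_product)
    show "continuous_on X (\<lambda>x. I x n)" for n
      unfolding I_def by (rule continuous_on_compose2[OF conta continuous_on_T]) (auto simp: T_in)
  qed
  have a_inj: "\<pi> x (\<lambda>i. 0) = \<pi> y (\<lambda>i. 0) \<and> F x = F y" if xy: "x \<in> X" "y \<in> X" "a x = a y" for x y
  proof -
    have eq: "real (\<pi> x (\<lambda>i. 0)) + c x i = real (\<pi> y (\<lambda>i. 0)) + c y i" for i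
    proof -
      have "a x $ i = a y $ i" using xy by simp
      then show ?thesis by (simp add: a_def)
    qed
    \<comment> \<open>A single coordinate decides the symbol, and \<open>undefined\<close> names an
      arbitrary one: the parts \<open>c\<close> differ by at most 1/2, distinct symbols by at least
      1.\<close>
    have \<pi>eq: "\<pi> x (\<lambda>i. 0) = \<pi> y (\<lambda>i. 0)"
      using eq[of undefined] c[OF xy(1), of undefined] c[OF xy(2), of undefined] by linarith
    moreover have "F x $ i = F y $ i" for i
      using eq[of i] \<pi>eq R(1) by (simp add: c_def)
    ultimately show ?thesis by (simp add: vec_eq_iff)
  qed
  have "inj_on I X"
  proof (rule inj_onI)
    fix x y assume xy: "x \<in> X" "y \<in> X" "I x = I y"
    have n: "\<pi> (T n x) (\<lambda>i. 0) = \<pi> (T n y) (\<lambda>i. 0) \<and> F (T n x) = F (T n y)" for n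
      using fun_cong[OF xy(3), of n] by (intro a_inj T_in xy(1,2)) (simp add: I_def)
    then have "\<pi> x n = \<pi> y n" for n
      using xy by (simp add: equivariant zshift_def)
    then have "\<pi> x = \<pi> y" by blast
    then show "x = y" using F(2) xy(1,2) n by blast
  qed
  then have "\<exists>g. homeomorphism X (I ` X) I g"
    by (intro homeomorphism_compact compact_X contI) auto
  moreover have "I ` X \<subseteq> {z. \<forall>n i. z n $ i \<in> {0..1}}"
  proof
    fix z assume "z \<in> I ` X"
    then obtain x where "x \<in> X" "z = I x" by blast
    then show "z \<in> {z. \<forall>n i. z n $ i \<in> {0..1}}"
      using a01[OF T_in[OF \<open>x \<in> X\<close>]] unfolding I_def by blast
  qed
  moreover have "I (T b x) = zshift b (I x)" if "x \<in> X" for b x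
    using that by (simp add: I_def zshift_def T_zadd fun_eq_iff)
  ultimately show ?thesis unfolding equivariant_cube_embedding_def by blast
qed

end

theorem theorem1p6:
  fixes X :: "'a::metric_space set"
    and T :: "('k::finite \<Rightarrow> int) \<Rightarrow> 'a \<Rightarrow> 'a"
  assumes "zk_system X T"
    and "has_aperiodic_symbolic_factor X T"
    and "mdim X T < ereal (real CARD('d::finite) / 2)"
  shows "\<exists>f :: 'a \<Rightarrow> ('k \<Rightarrow> int) \<Rightarrow> real ^ 'd. equivariant_cube_embedding X T f"
proof (cases "X = {}")
  \<comment> \<open>Treated apart because the widim of the empty space is -1, realised by the empty
    complex, and not a \<open>cut_dim\<close>.\<close>
  case True
  then show ?thesis
    unfolding equivariant_cube_embedding_def homeomorphism_def by auto
next
  case False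
  obtain l Y and \<pi> :: "'a \<Rightarrow> ('k \<Rightarrow> int) \<Rightarrow> nat" where Y: "aperiodic_symbolic l Y"
    and \<pi>: "continuous_on X \<pi>" "\<pi> ` X = Y" "\<forall>a. \<forall>x\<in>X. \<pi> (T a x) = zshift a (\<pi> x)"
    using assms(2) unfolding has_aperiodic_symbolic_factor_def by blast
  have in_Y: "\<pi> x \<in> Y" if "x \<in> X" for x using \<pi>(2) that by blast
  interpret symbolic_extension X T \<pi>
  proof
    show "a = (\<lambda>i. 0)" if "x \<in> X" "zshift a (\<pi> x) = \<pi> x" for x a
      using Y in_Y[OF that(1)] that(2) unfolding aperiodic_symbolic_def by blast
  qed (use assms(1) False \<pi> in auto)
  have "\<pi> x n \<le> l" if "x \<in> X" for x n
    using Y in_Y[OF that] unfolding aperiodic_symbolic_def by force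
  then show ?thesis by (rule ex_equivariant_cube_embedding[OF assms(3)])
qed

end
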